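(* Let $X=\mathcal A^{\mathbb N}$ and $Y=\mathcal D^{\mathbb N}$ be two full shifts over finite alphabets, with left shifts $T$ and $S$, and let $\pi:X\to Y$ be a one-block factor map. Let $\mathbf a=(a,b)\in\mathbb R^2$ with $a>0$ and $b\ge0$. Let $\Phi=(\log\phi_n)_{n=1}^\infty\in\mathcal C_{aa}(X,T)$ satisfy the bounded distortion property. Then $\Phi$ has a unique $\mathbf a$-weighted equilibrium state, denoted $\mu$. The measure $\mu$ is quasi-Bernoulli and has the following Gibbs property: $$\mu(I)\approx\exp\Big(\frac{-nP^{\mathbf a}(T,\Phi)}{a+b}\Big)\frac{\phi(I)^{1/a}}{\psi(\pi I)^{b/(a+b)}},\qquad I\in\mathcal A^n,\ n\in\mathbb N,$$ where $\phi(I):=\sup_{x\in[I]}\phi_n(x)$ for $I\in\mathcal A^n$ and $\psi(J):=\sum_{I\in\mathcal A^n:\ \pi I=J}\phi(I)^{1/a}$ for $J\in\mathcal D^n$. Furthermore, for $\nu:=\mu\circ\pi^{-1}$, we have $$\nu(J)\approx\exp\Big(\frac{-nP^{\mathbf a}(T,\Phi)}{a+b}\Big)\psi(J)^{\frac{a}{a+b}},\qquad J\in\mathcal D^n,\ n\in\mathbb N,$$ and $$\mu(I)^a\,\nu(\pi I)^b\approx\phi(I)\exp(-nP^{\mathbf a}(T,\Phi)),\qquad I\in\mathcal A^n,\ n\in\mathbb N.$$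
   Context: A one-block factor map $\pi:X\to Y$ is a continuous surjection with $\pi T=S\pi$ induced letter by letter by a map $\pi:\mathcal A\to\mathcal D$; $\pi I$ denotes the word obtained from $I$ letterwise. $[I]$ is the cylinder of sequences beginning with the word $I$, and $\mu(I):=\mu([I])$. $\mathcal M(X,T)$ is the set of $T$-invariant Borel probability measures; $h_\mu(T)$ is measure-theoretic entropy. $\mathcal C_{aa}(X,T)$ is the set of almost additive potentials: sequences $\Phi=(\log\phi_n)_{n\ge1}$ with each $\phi_n:X\to(0,\infty)$ continuous and some $c>0$ with $c^{-1}\phi_n(x)\phi_m(T^nx)\le\phi_{n+m}(x)\le c\,\phi_n(x)\phi_m(T^nx)$ for all $x\in X$, $n,m\in\mathbb N$. $\Phi$ has the bounded distortion property if there is $c>0$ such that $c^{-1}\phi_n(y)\le\phi_n(x)\le c\,\phi_n(y)$ for all $n$ whenever $x,y$ lie in the same $n$-th cylinder. $\Phi_*(\eta)=\lim_{n}\frac1n\int\log\phi_n\,d\eta$. $P^{\mathbf a}(T,\Phi)=\sup\{\Phi_*(\eta)+a h_\eta(T)+b h_{\eta\circ\pi^{-1}}(S):\eta\in\mathcal M(X,T)\}$; an $\mathbf a$-weighted equilibrium state of $\Phi$ is an $\eta\in\mathcal M(X,T)$ attaining the supremum. A fully supported Borel probability measure $\mu$ on $\mathcal A^{\mathbb N}$ is quasi-Bernoulli if there is $c>0$ with $c^{-1}\le\mu(IJ)/(\mu(I)\mu(J))\le c$ for all $I,J\in\bigcup_{n\ge1}\mathcal A^n$. For families of non-negative numbers,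 $a_i\approx b_i$ means there is a constant $c>0$ with $c^{-1}b_i\le a_i\le c\,b_i$ for all indices $i$. *)

theory Defs
  imports "HOL-Probability.Probability"
begin

text \<open>
  A finite alphabet is a type of class \<open>finite\<close> with its discrete topology, so that
  \<open>nat \<Rightarrow> 'a\<close> with the library's product topology and \<open>borel\<close> is the one-sided
  full shift. Letters are indexed from 0: the word formed by the first \<open>n\<close> letters of
  \<open>x\<close> is \<open>[x 0, \<dots>, x (n - 1)]\<close>. The positive integers of the theory are the
  \<open>n \<ge> 1\<close>; nothing is assumed about index 0 of a potential.
\<close>

definition shift :: "(nat \<Rightarrow> 'a) \<Rightarrow> nat \<Rightarrow> 'a" where
  "shift x = (\<lambda>i. x (Suc i))"

definition cylinder :: "'a list \<Rightarrow> (nat \<Rightarrow> 'a) set" where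
  "cylinder I = {x. \<forall>i<length I. x i = I ! i}"

definition one_block_factor_map ::
  "('a::{finite,discrete_topology} \<Rightarrow> 'd::{finite,discrete_topology})
     \<Rightarrow> ((nat \<Rightarrow> 'a) \<Rightarrow> nat \<Rightarrow> 'd) \<Rightarrow> bool" where
  "one_block_factor_map p \<pi> \<longleftrightarrow>
     continuous_on UNIV \<pi> \<and> surj \<pi> \<and> \<pi> \<circ> shift = shift \<circ> \<pi> \<and> (\<forall>x i. \<pi> x i = p (x i))"

definition borel_prob_measures :: "'x::topological_space measure set" where
  "borel_prob_measures = {\<mu>. prob_space \<mu> \<and> sets \<mu> = sets borel}"

definition invariant_measures :: "('x::topological_space \<Rightarrow> 'x) \<Rightarrow> 'x measure set" where
  "invariant_measures T =
     {\<mu> \<in> borel_prob_measures. T \<in> measurable \<mu> \<mu> \<and> distr \<mu> \<mu> T = \<mu>}"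


subsection \<open>Measure-theoretic (Kolmogorov--Sinai) entropy\<close>

definition finite_partitions :: "'x measure \<Rightarrow> 'x set set set" where
  "finite_partitions \<mu> = {P. finite P \<and> P \<subseteq> sets \<mu> \<and> partition_on (space \<mu>) P}"

text \<open>The convention \<open>0 log 0 = 0\<close> is automatic.\<close>

definition partition_entropy :: "'x measure \<Rightarrow> 'x set set \<Rightarrow> real" where
  "partition_entropy \<mu> P = - (\<Sum>A\<in>P. measure \<mu> A * ln (measure \<mu> A))"

text \<open>The nonempty atoms of the join of the first \<open>n\<close> preimages \<open>P, T\<inverse>P, T\<inverse>T\<inverse>P, \<dots>\<close>.\<close>

definition iterated_join ::
  "'x measure \<Rightarrow> ('x \<Rightarrow> 'x) \<Rightarrow> 'x set set \<Rightarrow> nat \<Rightarrow> 'x set set" where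
  "iterated_join \<mu> T P n =
     {{x \<in> space \<mu>. \<forall>i<n. (T ^^ i) x \<in> A i} | A. \<forall>i<n. A i \<in> P} - {{}}"

definition entropy_wrt :: "'x measure \<Rightarrow> ('x \<Rightarrow> 'x) \<Rightarrow> 'x set set \<Rightarrow> real" where
  "entropy_wrt \<mu> T P = lim (\<lambda>n. partition_entropy \<mu> (iterated_join \<mu> T P n) / real n)"

definition ks_entropy :: "'x measure \<Rightarrow> ('x \<Rightarrow> 'x) \<Rightarrow> ereal" where
  "ks_entropy \<mu> T = (SUP P\<in>finite_partitions \<mu>. ereal (entropy_wrt \<mu> T P))"


subsection \<open>Potentials\<close>

text \<open>
  A potential \<open>(log \<phi>\<^sub>n)\<^sub>n\<close> is represented by the sequence of positive functions
  \<open>\<phi>\<^sub>n\<close>.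
\<close>

definition almost_additive ::
  "('x \<Rightarrow> 'x) \<Rightarrow> (nat \<Rightarrow> 'x::topological_space \<Rightarrow> real) \<Rightarrow> bool" where
  "almost_additive T \<phi> \<longleftrightarrow>
     (\<forall>n\<ge>1. continuous_on UNIV (\<phi> n) \<and> (\<forall>x. \<phi> n x > 0)) \<and>
     (\<exists>c>0. \<forall>n\<ge>1. \<forall>m\<ge>1. \<forall>x.
        inverse c * \<phi> n x * \<phi> m ((T ^^ n) x) \<le> \<phi> (n + m) x \<and>
        \<phi> (n + m) x \<le> c * \<phi> n x * \<phi> m ((T ^^ n) x))"

definition bounded_distortion :: "(nat \<Rightarrow> (nat \<Rightarrow> 'a) \<Rightarrow> real) \<Rightarrow> bool" where
  "bounded_distortion \<phi> \<longleftrightarrow>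
     (\<exists>c>0. \<forall>n\<ge>1. \<forall>I. length I = n \<longrightarrow> (\<forall>x\<in>cylinder I. \<forall>y\<in>cylinder I.
        inverse c * \<phi> n y \<le> \<phi> n x \<and> \<phi> n x \<le> c * \<phi> n y))"

definition potential_mean :: "(nat \<Rightarrow> 'x \<Rightarrow> real) \<Rightarrow> 'x measure \<Rightarrow> real" where
  "potential_mean \<phi> \<eta> = lim (\<lambda>n. (1 / real n) * (\<integral>x. ln (\<phi> n x) \<partial>\<eta>))"


subsection \<open>Weighted pressure and equilibrium states\<close>

definition weighted_free_energy ::
  "('x \<Rightarrow> 'x) \<Rightarrow> ('y::topological_space \<Rightarrow> 'y) \<Rightarrow> ('x \<Rightarrow> 'y) \<Rightarrow> real \<Rightarrow> real
     \<Rightarrow> (nat \<Rightarrow> 'x \<Rightarrow> real) \<Rightarrow> 'x measure \<Rightarrow> ereal" where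
  "weighted_free_energy T S \<pi> a b \<phi> \<eta> =
     ereal (potential_mean \<phi> \<eta>) + ereal a * ks_entropy \<eta> T
       + ereal b * ks_entropy (distr \<eta> borel \<pi>) S"

definition weighted_pressure ::
  "('x::topological_space \<Rightarrow> 'x) \<Rightarrow> ('y::topological_space \<Rightarrow> 'y) \<Rightarrow> ('x \<Rightarrow> 'y) \<Rightarrow> real \<Rightarrow> real
     \<Rightarrow> (nat \<Rightarrow> 'x \<Rightarrow> real) \<Rightarrow> ereal" where
  "weighted_pressure T S \<pi> a b \<phi> =
     (SUP \<eta>\<in>invariant_measures T. weighted_free_energy T S \<pi> a b \<phi> \<eta>)"

definition weighted_equilibrium_state ::
  "('x::topological_space \<Rightarrow> 'x) \<Rightarrow> ('y::topological_space \<Rightarrow> 'y) \<Rightarrow> ('x \<Rightarrow> 'y) \<Rightarrow> real \<Rightarrow> real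
     \<Rightarrow> (nat \<Rightarrow> 'x \<Rightarrow> real) \<Rightarrow> 'x measure \<Rightarrow> bool" where
  "weighted_equilibrium_state T S \<pi> a b \<phi> \<eta> \<longleftrightarrow>
     \<eta> \<in> invariant_measures T \<and>
     weighted_free_energy T S \<pi> a b \<phi> \<eta> = weighted_pressure T S \<pi> a b \<phi>"


subsection \<open>Words\<close>

definition quasi_bernoulli :: "(nat \<Rightarrow> 'a::{finite,discrete_topology}) measure \<Rightarrow> bool" where
  "quasi_bernoulli \<mu> \<longleftrightarrow>
     \<mu> \<in> borel_prob_measures \<and>
     (\<forall>U. open U \<and> U \<noteq> {} \<longrightarrow> measure \<mu> U > 0) \<and>
     (\<exists>c>0. \<forall>I J. I \<noteq> [] \<and> J \<noteq> [] \<longrightarrow>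
        inverse c \<le> measure \<mu> (cylinder (I @ J))
                     / (measure \<mu> (cylinder I) * measure \<mu> (cylinder J)) \<and>
        measure \<mu> (cylinder (I @ J))
          / (measure \<mu> (cylinder I) * measure \<mu> (cylinder J)) \<le> c)"

definition word_sup :: "(nat \<Rightarrow> (nat \<Rightarrow> 'a) \<Rightarrow> real) \<Rightarrow> 'a list \<Rightarrow> real" where
  "word_sup \<phi> I = (SUP x\<in>cylinder I. \<phi> (length I) x)"

definition fiber_sum ::
  "('a \<Rightarrow> 'd) \<Rightarrow> real \<Rightarrow> (nat \<Rightarrow> (nat \<Rightarrow> 'a) \<Rightarrow> real) \<Rightarrow> 'd list \<Rightarrow> real" where
  "fiber_sum p a \<phi> J =
     (\<Sum>I | length I = length J \<and> map p I = J. word_sup \<phi> I powr (1 / a))"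

definition comparable_on :: "'i set \<Rightarrow> ('i \<Rightarrow> real) \<Rightarrow> ('i \<Rightarrow> real) \<Rightarrow> bool" where
  "comparable_on K f g \<longleftrightarrow>
     (\<exists>c>0. \<forall>i\<in>K. inverse c * g i \<le> f i \<and> f i \<le> c * g i)"

end

theory Submission
  imports Defs
begin

text \<open>
  Write \<open>u I = \<phi>(I) powr (1 / a)\<close>. The weight \<open>w I = u I / \<psi>(\<pi> I) powr (b / (a + b))\<close> is
  quasi-multiplicative, so there is an invariant measure \<open>\<mu>\<close> with
  \<open>\<mu>(I) \<approx> w I * exp (- n Q)\<close>, and \<open>P = (a + b) Q\<close>. Inserting the resulting Gibbs estimate for
  \<open>\<mu>(I) powr a * \<nu>(\<pi> I) powr b\<close> into the free energy of any invariant \<open>\<eta>\<close> gives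
  \<open>P - lim (a D n + b D' n) / n\<close>, where \<open>D n\<close> and \<open>D' n\<close> are the relative entropies, on
  words of length \<open>n\<close>, of \<open>\<eta>\<close> with respect to \<open>\<mu>\<close> and of the images in \<open>Y\<close>. Hence \<open>\<mu>\<close>
  is an equilibrium state and any other one has \<open>D n / n \<longlonglongrightarrow> 0\<close>. Since \<open>\<mu>\<close> is
  quasi-Bernoulli, a small increment of \<open>D\<close> forces \<open>\<eta> \<ge> \<mu> / (2 c)\<close> with a uniform \<open>c\<close>, and
  splitting off the largest multiple of \<open>\<mu>\<close> below \<open>\<eta>\<close> yields \<open>\<eta> = \<mu>\<close>.
\<close>

subsection \<open>Subadditive sequences\<close>

text \<open>The exponent \<open>b / (a + b)\<close> makes the fibre sums of \<open>w\<close> equal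
  to \<psi> powr (a / (a + b)). In \<open>a * ln w\<close> plus \<open>b\<close> times the logarithm
  of the fibre sum the powers of \<psi> then cancel and leave ln \<phi>(I). This is how a single
  weight on words balances both entropies, and the two factors exp (- n Q) give the exponent (a + b)
  Q. All comparisons hold up to bounded factors. After \<open>ln\<close> these are bounded errors,
  which vanish in every rate per letter, so the deficit of the free energy is an exact limit.
  Uniqueness is argued with values on words alone: the normalised remainder of \<eta> after
  splitting off a multiple of \<mu> is again a stationary function on words, so neither ergodicity
  of \<mu> nor an ergodic decomposition of \<eta> enters. Only the first of the two relative
  entropies is needed for it; the other one is nonnegative and is dropped, which uses b \<ge> 0. The
  entropy in the statement is a supremum over all finite partitions. It has to be identified with
  the entropy rate of words before any of this can start.\<close>

lemma fekete:
  fixes u :: "nat \<Rightarrow> real"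
  assumes sub: "\<And>n m. n \<ge> 1 \<Longrightarrow> m \<ge> 1 \<Longrightarrow> u (n + m) \<le> u n + u m"
    and bdd: "\<And>n. n \<ge> 1 \<Longrightarrow> - B * real n \<le> u n"
  obtains L where "(\<lambda>n. u n / real n) \<longlonglongrightarrow> L" "\<And>n. n \<ge> 1 \<Longrightarrow> L \<le> u n / real n"
proof -
  define V where "V = (\<lambda>n. u n / real n) ` {1..}"
  define L where "L = Inf V"
  have bV: "bdd_below V"
    unfolding V_def using bdd by (intro bdd_belowI2[of _ "- B"]) (simp add: field_simps)
  have low: "L \<le> u n / real n" if "n \<ge> 1" for n
    unfolding L_def using that bV by (intro cInf_lower) (auto simp: V_def)
  have mult: "u (q * k + r) \<le> real q * u k + u r" if "k \<ge> 1" "r \<ge> 1" for q k r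
  proof (induction q)
    case (Suc q)
    have "u (Suc q * k + r) = u (k + (q * k + r))"
      by (simp add: algebra_simps)
    also have "\<dots> \<le> u k + u (q * k + r)"
      using that by (intro sub) auto
    finally show ?case
      using Suc by (simp add: algebra_simps)
  qed simp
  have "(\<lambda>n. u n / real n) \<longlonglongrightarrow> L"
  proof (rule LIMSEQ_I)
    fix e :: real
    assume e: "e > 0"
    have "V \<noteq> {}" by (auto simp: V_def)
    then obtain v where "v \<in> V" "v < L + e / 2"
      using e cInf_lessD[of V "L + e / 2"] by (auto simp: L_def)
    then obtain k where k: "k \<ge> 1" "u k / real k < L + e / 2"
      by (auto simp: V_def)
    \<comment> \<open>\<open>C\<close> collects what does not grow with \<open>n\<close>: the loss
      from replacing \<open>q * k\<close> by \<open>n\<close>, and the remainder term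
      \<open>u r\<close>.\<close>
    define C where "C = \<bar>u k\<bar> + (\<Sum>r\<in>{1..k}. \<bar>u r\<bar>)"
    have up: "u n / real n \<le> u k / real k + C / real n" if n: "n \<ge> 1" for n
    proof -
      \<comment> \<open>The remainder is taken in \<open>{1..k}\<close> rather than
        \<open>{0..<k}\<close>, because nothing is assumed about \<open>u 0\<close>.\<close>
      define q r where "q = (n - 1) div k" and "r = (n - 1) mod k + 1"
      have "q * k + (n - 1) mod k = n - 1"
        unfolding q_def by (rule div_mult_mod_eq)
      then have nq: "n = q * k + r"
        using n unfolding r_def by linarith
      have r: "r \<ge> 1" "r \<le> k"
        using k(1) by (auto simp: r_def Suc_le_eq)
      have "u n \<le> real q * u k + u r"
        unfolding nq using k r by (intro mult) auto
      moreover have "u r \<le> (\<Sum>r\<in>{1..k}. \<bar>u r\<bar>)"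
        using r member_le_sum[of r "{1..k}" "\<lambda>r. \<bar>u r\<bar>"] by auto
      moreover have "real q * u k = real n * (u k / real k) - real r / real k * u k"
        using k(1) by (simp add: nq field_simps)
      moreover have "\<bar>real r / real k * u k\<bar> \<le> 1 * \<bar>u k\<bar>"
        unfolding abs_mult using r k(1) by (intro mult_right_mono) auto
      ultimately have "u n \<le> real n * (u k / real k) + C"
        unfolding C_def by linarith
      then show ?thesis
        using n by (simp add: field_simps)
    qed
    obtain N where N: "real N > 2 * C / e" "N \<ge> 1"
      by (metis less_eq_real_def max.absorb4 max.cobounded1 max.cobounded2 nat_le_real_less reals_Archimedean2 of_nat_max dual_order.strict_trans1)
    have "norm (u n / real n - L) < e" if "n \<ge> N" for n
    proof -
      have n: "n \<ge> 1" using that N by simp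
      have "2 * C < e * real n"
        using N(1) that e by (simp add: field_simps) (metis less_le_trans mult_left_mono less_eq_real_def of_nat_le_iff mult.commute)
      then have "C / real n < e / 2"
        using n by (simp add: field_simps)
      with up[OF n] low[OF n] k(2) show ?thesis
        unfolding real_norm_def by linarith
    qed
    then show "\<exists>N. \<forall>n\<ge>N. norm (u n / real n - L) < e" by blast
  qed
  with low that show ?thesis by blast
qed

text \<open>Both \<open>u + k\<close> and \<open>- u + k\<close> are subadditive. In each case the
  limit is also a lower bound, and the two lower bounds together give the two-sided estimate with
  the same \<open>k\<close>. This explicit error later makes partition sums comparable to
  exponentials uniformly in \<open>n\<close>.\<close>

lemma almost_additive_sequence:
  fixes u :: "nat \<Rightarrow> real"
  assumes "\<And>n m. n \<ge> 1 \<Longrightarrow> m \<ge> 1 \<Longrightarrow> \<bar>u (n + m) - u n - u m\<bar> \<le> k"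
  obtains L where "(\<lambda>n. u n / real n) \<longlonglongrightarrow> L" "\<And>n. n \<ge> 1 \<Longrightarrow> \<bar>u n - real n * L\<bar> \<le> k"
proof -
  have k: "k \<ge> 0" using assms[of 1 1] by simp
  have bd: "\<bar>u n\<bar> \<le> real n * (\<bar>u 1\<bar> + k)" if "n \<ge> 1" for n
    using that
  proof (induction n rule: dec_induct)
    case (step n)
    then show ?case using assms[of n 1] by (simp add: algebra_simps)
  qed (use k in simp)
  have bd': "- (\<bar>u 1\<bar> + 2 * k) * real n \<le> u n - k" "- (\<bar>u 1\<bar> + 2 * k) * real n \<le> - u n - k"
    if "n \<ge> 1" for n
  proof -
    have "k * 1 \<le> k * real n" using that k by (intro mult_left_mono) auto
    then show "- (\<bar>u 1\<bar> + 2 * k) * real n \<le> u n - k" "- (\<bar>u 1\<bar> + 2 * k) * real n \<le> - u n - k"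
      using bd[OF that] by (auto simp: algebra_simps)
  qed
  obtain L where L: "(\<lambda>n. (u n + k) / real n) \<longlonglongrightarrow> L" "\<And>n. n \<ge> 1 \<Longrightarrow> L \<le> (u n + k) / real n"
  proof (rule fekete[of "\<lambda>n. u n + k" "\<bar>u 1\<bar> + 2 * k"])
    show "u (n + m) + k \<le> u n + k + (u m + k)" if "n \<ge> 1" "m \<ge> 1" for n m
      using assms[OF that] k by linarith
    show "- (\<bar>u 1\<bar> + 2 * k) * real n \<le> u n + k" if "n \<ge> 1" for n
      using bd'(1)[OF that] k by linarith
  qed blast
  obtain L' where L': "(\<lambda>n. (- u n + k) / real n) \<longlonglongrightarrow> L'" "\<And>n. n \<ge> 1 \<Longrightarrow> L' \<le> (- u n + k) / real n"
  proof (rule fekete[of "\<lambda>n. - u n + k" "\<bar>u 1\<bar> + 2 * k"])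
    show "- u (n + m) + k \<le> - u n + k + (- u m + k)" if "n \<ge> 1" "m \<ge> 1" for n m
      using assms[OF that] k by linarith
    show "- (\<bar>u 1\<bar> + 2 * k) * real n \<le> - u n + k" if "n \<ge> 1" for n
      using bd'(2)[OF that] k by linarith
  qed blast
  have k0: "(\<lambda>n. k / real n) \<longlonglongrightarrow> 0"
    by (rule lim_const_over_n)
  have l1: "(\<lambda>n. u n / real n) \<longlonglongrightarrow> L"
    using tendsto_diff[OF L(1) k0] by (simp add: add_divide_distrib)
  have "(\<lambda>n. - (u n / real n)) \<longlonglongrightarrow> L'"
    using tendsto_diff[OF L'(1) k0] by (simp add: add_divide_distrib diff_divide_distrib)
  then have "L' = - L"
    using tendsto_minus[OF l1] LIMSEQ_unique by blast
  then have "\<bar>u n - real n * L\<bar> \<le> k" if "n \<ge> 1" for n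
    using L(2)[OF that] L'(2)[OF that] that by (simp add: field_simps)
  with l1 that show ?thesis by blast
qed

subsection \<open>Words and cylinders\<close>

definition words :: "nat \<Rightarrow> 'a list set" where
  "words n = {I. length I = n}"

definition initial_word :: "nat \<Rightarrow> (nat \<Rightarrow> 'a) \<Rightarrow> 'a list" where
  "initial_word n x = map x [0..<n]"

lemma finite_words [simp, intro]: "finite (words n :: 'a::finite list set)"
  using finite_lists_length_eq[of "UNIV :: 'a set" n] by (simp add: words_def)

lemma words_0 [simp]: "words 0 = {[]}"
  by (auto simp: words_def)

lemma in_words_iff: "I \<in> words n \<longleftrightarrow> length I = n"
  by (simp add: words_def)

lemma length_initial_word [simp]: "length (initial_word n x) = n"
  by (simp add: initial_word_def)

lemma initial_word_in_words [simp, intro]: "initial_word n x \<in> words n"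
  by (simp add: words_def)

lemma bij_betw_append_words:
  "bij_betw (\<lambda>(I, J). I @ J) (words n \<times> words m) (words (n + m))"
  by (rule bij_betwI[where g = "\<lambda>K. (take n K, drop n K)"]) (auto simp: words_def)

lemma sum_words_add:
  fixes f :: "'a::finite list \<Rightarrow> real"
  shows "sum f (words (n + m)) = (\<Sum>I\<in>words n. \<Sum>J\<in>words m. f (I @ J))"
proof -
  have "sum f (words (n + m)) = (\<Sum>u\<in>words n \<times> words m. f (case u of (I, J) \<Rightarrow> I @ J))"
    by (rule sum.reindex_bij_betw[OF bij_betw_append_words, symmetric])
  then show ?thesis
    by (simp add: sum.cartesian_product case_prod_unfold)
qed

lemma sum_words_1: "sum f (words (Suc 0) :: 'a::finite list set) = (\<Sum>x\<in>UNIV. f [x])"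
proof -
  have "(words (Suc 0) :: 'a list set) = (\<lambda>x. [x]) ` UNIV"
    by (auto simp: words_def length_Suc_conv)
  then show ?thesis
    by (simp add: sum.reindex inj_on_def)
qed

lemma cylinder_iff: "x \<in> cylinder I \<longleftrightarrow> initial_word (length I) x = I"
  unfolding cylinder_def initial_word_def
  apply (subst list_eq_iff_nth_eq)
  apply simp done

lemma cylinder_eq_vimage: "cylinder I = initial_word (length I) -` {I}"
  by (auto simp: cylinder_iff)

lemma in_cylinder_initial_word [simp]: "x \<in> cylinder (initial_word n x)"
  by (simp add: cylinder_iff)

lemma cylinder_Nil [simp]: "cylinder [] = UNIV"
  by (simp add: cylinder_def)

lemma cylinder_nonempty [simp]: "cylinder I \<noteq> {}"
proof -
  have "(\<lambda>i. I ! i) \<in> cylinder I" by (simp add: cylinder_def)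
  then show ?thesis by blast
qed

lemma cylinder_disjoint:
  assumes "length I = length J" "I \<noteq> J"
  shows "cylinder I \<inter> cylinder J = {}"
  using assms by (auto simp: cylinder_iff)

lemma take_initial_word: "n \<le> m \<Longrightarrow> take n (initial_word m x) = initial_word n x"
  by (simp add: initial_word_def take_map)

lemma shift_funpow: "(shift ^^ n) x i = x (n + i)"
  by (induction n arbitrary: i) (simp_all add: shift_def)

lemma initial_word_add: "initial_word (n + m) x = initial_word n x @ initial_word m ((shift ^^ n) x)"
  by (auto simp: initial_word_def list_eq_iff_nth_eq nth_append shift_funpow)

lemma cylinder_append: "cylinder (I @ J) = cylinder I \<inter> (shift ^^ length I) -` cylinder J"
  by (auto simp: cylinder_iff initial_word_add)

lemma shift_vimage_cylinder: "shift -` cylinder I = (\<Union>x. cylinder (x # I))"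
  by (auto simp: cylinder_def shift_def nth_Cons split: nat.splits)

lemma cylinder_snoc: "cylinder I = (\<Union>x. cylinder (I @ [x]))"
proof (intro equalityI subsetI)
  fix y assume "y \<in> cylinder I"
  then have "y \<in> cylinder (I @ [y (length I)])"
    by (auto simp: cylinder_def nth_append less_Suc_eq)
  then show "y \<in> (\<Union>x. cylinder (I @ [x]))" by blast
qed (auto simp: cylinder_append)

section \<open>Topology and Borel sets of the full shift\<close>

lemma open_cylinder [simp, intro]: "open (cylinder (I :: 'a::{finite,discrete_topology} list))"
proof -
  have "cylinder I = (\<Inter>i\<in>{..<length I}. (\<lambda>x. x i) -` {I ! i})"
    by (auto simp: cylinder_def)
  also have "open \<dots>"
    by (intro open_INT ballI finite_lessThan open_vimage continuous_on_product_coordinates)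
      (simp_all add: Topological_Spaces.discrete_topology_class.open_discrete)
  finally show ?thesis .
qed

text \<open>A basic open set of the product restricts finitely many coordinates, and these all lie
  below some \<open>n\<close>.\<close>

lemma open_contains_cylinder:
  fixes U :: "(nat \<Rightarrow> 'a::{finite,discrete_topology}) set"
  assumes "open U" "x \<in> U"
  obtains n where "cylinder (initial_word n x) \<subseteq> U"
proof -
  obtain X where X: "x \<in> Pi\<^sub>E UNIV X" "finite {i. X i \<noteq> UNIV}" "Pi\<^sub>E UNIV X \<subseteq> U"
    using product_topology_open_contains_basis[of "\<lambda>_::nat. euclidean :: 'a topology" UNIV U x]
      assms by (auto simp: open_fun_def)
  obtain n where n: "{i. X i \<noteq> UNIV} \<subseteq> {..<n}"
    using X(2) finite_nat_iff_bounded by blast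
  have "y \<in> U" if "y \<in> cylinder (initial_word n x)" for y
  proof -
    have "y i \<in> X i" for i
    proof (cases "i < n")
      case True
      then have "y i = x i"
        using that by (auto simp: cylinder_def initial_word_def)
      then show ?thesis using X(1) by auto
    next
      case False
      then show ?thesis using n by auto
    qed
    then show ?thesis using X(3) by (auto simp: PiE_iff)
  qed
  then show ?thesis using that by blast
qed

text \<open>There are only countably many words, so every open set is a countable union of
  cylinders.\<close>

lemma sets_borel_cylinders:
  "sets (borel :: (nat \<Rightarrow> 'a::{finite,discrete_topology}) measure) = sigma_sets UNIV (range cylinder)"
proof -
  have "U \<in> sigma_sets UNIV (range cylinder)" if "open U" for U :: "(nat \<Rightarrow> 'a) set"
  proof -
    have "U = \<Union> (cylinder ` {I. cylinder I \<subseteq> U})"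
    proof (intro equalityI subsetI)
      fix x assume "x \<in> U"
      then obtain n where "cylinder (initial_word n x) \<subseteq> U"
        using open_contains_cylinder \<open>open U\<close> by metis
      then show "x \<in> \<Union> (cylinder ` {I. cylinder I \<subseteq> U})"
        using in_cylinder_initial_word by blast
    qed auto
    also have "\<dots> \<in> sigma_sets UNIV (range cylinder)"
      by (intro sigma_sets_UNION countable_image countableI_type) auto
    finally show ?thesis .
  qed
  then have "sigma_sets UNIV {U :: (nat \<Rightarrow> 'a) set. open U} \<subseteq> sigma_sets UNIV (range cylinder)"
    by (intro sigma_sets_mono) auto
  moreover have "sigma_sets UNIV (range cylinder) \<subseteq> sigma_sets UNIV {U :: (nat \<Rightarrow> 'a) set. open U}"
    by (intro sigma_sets_mono) auto
  ultimately show ?thesis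
    by (simp add: borel_def)
qed

lemma cylinder_borel [measurable]:
  "cylinder (I :: 'a::{finite,discrete_topology} list) \<in> sets borel"
  by (rule borel_open) simp

lemma measurable_borel_cylinders:
  fixes f :: "'x \<Rightarrow> nat \<Rightarrow> 'a::{finite,discrete_topology}"
  assumes "\<And>I. f -` cylinder I \<inter> space M \<in> sets M"
  shows "f \<in> borel_measurable M"
  by (rule measurable_sigma_sets[OF sets_borel_cylinders]) (use assms in auto)

lemma measurable_shift [measurable]:
  "shift \<in> borel_measurable (borel :: (nat \<Rightarrow> 'a::{finite,discrete_topology}) measure)"
  by (rule measurable_borel_cylinders) (simp add: shift_vimage_cylinder)

lemma measurable_initial_word [measurable]:
  "initial_word n \<in> (borel :: (nat \<Rightarrow> 'a::{finite,discrete_topology}) measure) \<rightarrow>\<^sub>M count_space UNIV"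
proof (rule measurable_count_space_eq2_countable[THEN iffD2], safe)
  fix I :: "'a list"
  have "initial_word n -` {I} = (if length I = n then cylinder I else {})"
    by (auto simp: cylinder_iff)
  then show "initial_word n -` {I} \<inter> space borel \<in> sets borel"
    by simp
qed auto

text \<open>Two cylinders are nested or disjoint. Since no cylinder is empty, the empty set is added
  to obtain a generator that is stable under intersections.\<close>

lemma measure_eq_cylinders:
  fixes \<mu> \<eta> :: "(nat \<Rightarrow> 'a::{finite,discrete_topology}) measure"
  assumes "\<mu> \<in> borel_prob_measures" "\<eta> \<in> borel_prob_measures"
    and eq: "\<And>I. measure \<mu> (cylinder I) = measure \<eta> (cylinder I)"
  shows "\<mu> = \<eta>"
proof -
  interpret M: prob_space \<mu> using assms by (simp add: borel_prob_measures_def)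
  interpret N: prob_space \<eta> using assms by (simp add: borel_prob_measures_def)
  let ?E = "insert {} (range (cylinder :: 'a list \<Rightarrow> _))"
  have sE: "sigma_sets UNIV ?E = sets borel"
  proof
    show "sigma_sets UNIV ?E \<subseteq> sets borel"
      using sets.sigma_sets_subset[of ?E borel] by (simp add: image_subset_iff)
    show "sets borel \<subseteq> sigma_sets UNIV ?E"
      unfolding sets_borel_cylinders by (rule sigma_sets_mono') auto
  qed
  show ?thesis
  proof (rule measure_eqI_generator_eq[where E = ?E and \<Omega> = UNIV and A = "\<lambda>_. UNIV"])
    have *: "cylinder I \<inter> cylinder J \<in> ?E" if "length I \<le> length J" for I J :: "'a list"
    proof (cases "take (length I) J = I")
      case True
      then have "J = I @ drop (length I) J" by (metis append_take_drop_id)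
      then have "cylinder J \<subseteq> cylinder I"
        using cylinder_append[of I "drop (length I) J"] by simp
      then show ?thesis by (simp add: Int_absorb1)
    next
      case False
      have "cylinder I \<inter> cylinder J = {}"
        using False that by (auto simp: cylinder_def list_eq_iff_nth_eq)
      then show ?thesis by simp
    qed
    show "Int_stable ?E"
    proof (rule Int_stableI)
      fix A B assume "A \<in> ?E" "B \<in> ?E"
      then consider "A = {}" | "B = {}" | I J where "A = cylinder I" "B = cylinder J"
        by blast
      then show "A \<inter> B \<in> ?E"
      proof cases
        case 3
        then show ?thesis
          using *[of I J] *[of J I] by (cases "length I \<le> length J") (simp_all add: Int_commute)
      qed simp_all
    qed
    show "emeasure \<mu> X = emeasure \<eta> X" if "X \<in> ?E" for X
      using that eq by (auto simp: M.emeasure_eq_measure N.emeasure_eq_measure)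
    show "sets \<mu> = sigma_sets UNIV ?E" "sets \<eta> = sigma_sets UNIV ?E"
      using assms by (auto simp: sE borel_prob_measures_def)
    show "range (\<lambda>_. UNIV) \<subseteq> ?E"
      using cylinder_Nil by (auto intro: range_eqI[of _ _ "[]"])
  qed auto
qed

subsection \<open>Entropy of finite-valued maps\<close>

text \<open>Shannon entropy of the partition into the fibres of \<open>X\<close>. With maps in place
  of partitions, joins become pairs and iterated joins become lists.\<close>

definition ent :: "'x measure \<Rightarrow> ('x \<Rightarrow> 'c) \<Rightarrow> real" where
  "ent M X = - (\<Sum>c\<in>X ` space M. measure M (X -` {c} \<inter> space M) * ln (measure M (X -` {c} \<inter> space M)))"

text \<open>Nonnegativity of mutual information for a table of total mass \<open>s\<close>. The mass
  is left free because the inequality will be applied separately to each value of a third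
  variable.\<close>

lemma entropy_marginals:
  fixes p :: "'x \<Rightarrow> 'y \<Rightarrow> real"
  assumes fin: "finite A" "finite B" and nonneg: "\<And>x y. x \<in> A \<Longrightarrow> y \<in> B \<Longrightarrow> 0 \<le> p x y"
    and q: "\<And>x. x \<in> A \<Longrightarrow> q x = (\<Sum>y\<in>B. p x y)" and r: "\<And>y. y \<in> B \<Longrightarrow> r y = (\<Sum>x\<in>A. p x y)"
    and s: "s = (\<Sum>x\<in>A. \<Sum>y\<in>B. p x y)"
  shows "(\<Sum>x\<in>A. q x * ln (q x)) + (\<Sum>y\<in>B. r y * ln (r y))
    \<le> (\<Sum>x\<in>A. \<Sum>y\<in>B. p x y * ln (p x y)) + s * ln s"
proof -
  have le: "p x y \<le> q x" "p x y \<le> r y" if "x \<in> A" "y \<in> B" for x y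
    using that fin nonneg unfolding q[OF that(1)] r[OF that(2)]
    by (auto intro!: member_le_sum[of y B] member_le_sum[of x A "\<lambda>x. p x y"])
  have qs: "q x \<le> s" if "x \<in> A" for x
    using that fin nonneg unfolding q[OF that] s
    by (intro member_le_sum[of x A "\<lambda>x. \<Sum>y\<in>B. p x y"]) (auto intro!: sum_nonneg)
  have sum_q: "sum q A = s"
    by (simp add: s q)
  have sum_r: "sum r B = s"
    unfolding s by (subst sum.swap) (simp add: r)
  have summand: "p x y - q x * r y / s \<le> p x y * ln (p x y) + p x y * ln s - p x y * ln (q x) - p x y * ln (r y)"
    if xy: "x \<in> A" "y \<in> B" for x y
  proof (cases "p x y = 0")
    case True
    moreover have "0 \<le> q x" "0 \<le> r y" "0 \<le> s"
      using le[OF xy] nonneg[OF xy] qs[OF xy(1)] by linarith+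
    ultimately show ?thesis by simp
  next
    case False
    then have pos: "p x y > 0" "q x > 0" "r y > 0" "s > 0"
      using le[OF xy] nonneg[OF xy] qs[OF xy(1)] by linarith+
    \<comment> \<open>\<open>t\<close> compares the product of the marginals with the joint mass.
      The bound \<open>ln t \<le> t - 1\<close> leaves the linear terms
      \<open>p x y - q x * r y / s\<close>, whose total is 0.\<close>
    define t where "t = q x * r y / (s * p x y)"
    have t: "t > 0" using pos by (simp add: t_def)
    have "ln t = ln (q x) + ln (r y) - ln s - ln (p x y)"
      using pos by (simp add: t_def ln_div ln_mult)
    then have "p x y * (- ln t) = p x y * (ln (p x y) + ln s - ln (q x) - ln (r y))"
      by simp
    then have "p x y * ln (p x y) + p x y * ln s - p x y * ln (q x) - p x y * ln (r y) = p x y * (- ln t)"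
      by (simp only: right_diff_distrib distrib_left)
    moreover have "p x y * (- ln t) \<ge> p x y * (1 - t)"
      using pos ln_le_minus_one[OF t] by (intro mult_left_mono) auto
    moreover have "p x y * (1 - t) = p x y - q x * r y / s"
      using pos by (simp add: t_def right_diff_distrib)
    ultimately show ?thesis
      by linarith
  qed
  have "(\<Sum>x\<in>A. \<Sum>y\<in>B. p x y - q x * r y / s) = s - (\<Sum>x\<in>A. q x) * (\<Sum>y\<in>B. r y) / s"
    by (simp add: sum_subtractf s sum_product sum_divide_distrib)
  also have "\<dots> = 0"
    by (simp add: sum_q sum_r)
  finally have "0 = (\<Sum>x\<in>A. \<Sum>y\<in>B. p x y - q x * r y / s)"
    by simp
  also have "\<dots> \<le> (\<Sum>x\<in>A. \<Sum>y\<in>B. p x y * ln (p x y) + p x y * ln s - p x y * ln (q x) - p x y * ln (r y))"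
    by (intro sum_mono summand)
  also have "\<dots> = (\<Sum>x\<in>A. \<Sum>y\<in>B. p x y * ln (p x y)) + (\<Sum>x\<in>A. \<Sum>y\<in>B. p x y * ln s)
      - (\<Sum>x\<in>A. \<Sum>y\<in>B. p x y * ln (q x)) - (\<Sum>x\<in>A. \<Sum>y\<in>B. p x y * ln (r y))"
    by (simp add: sum_subtractf sum.distrib)
  also have "(\<Sum>x\<in>A. \<Sum>y\<in>B. p x y * ln s) = s * ln s"
    by (simp add: s sum_distrib_right)
  also have "(\<Sum>x\<in>A. \<Sum>y\<in>B. p x y * ln (q x)) = (\<Sum>x\<in>A. q x * ln (q x))"
    by (simp add: q sum_distrib_right)
  also have "(\<Sum>x\<in>A. \<Sum>y\<in>B. p x y * ln (r y)) = (\<Sum>y\<in>B. r y * ln (r y))"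
    by (subst sum.swap) (simp add: r sum_distrib_right)
  finally show ?thesis by linarith
qed

lemma sum_Times_nested: "(\<Sum>z\<in>C. \<Sum>x\<in>A. f (x, z)) = sum f (A \<times> C)"
  by (subst sum.swap) (simp add: sum.cartesian_product case_prod_unfold)

lemma sum_Times3_nested: "(\<Sum>z\<in>C. \<Sum>x\<in>A. \<Sum>y\<in>B. f (x, y, z)) = sum f (A \<times> B \<times> C)"
proof -
  have "(\<Sum>z\<in>C. \<Sum>x\<in>A. \<Sum>y\<in>B. f (x, y, z)) = (\<Sum>x\<in>A. \<Sum>z\<in>C. \<Sum>y\<in>B. f (x, y, z))"
    by (rule sum.swap)
  also have "\<dots> = (\<Sum>x\<in>A. \<Sum>y\<in>B. \<Sum>z\<in>C. f (x, y, z))"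
    by (intro sum.cong refl sum.swap)
  also have "\<dots> = sum f (A \<times> B \<times> C)"
    by (simp add: sum.cartesian_product case_prod_unfold)
  finally show ?thesis .
qed

context prob_space
begin

text \<open>Values that are not attained contribute \<open>0 * ln 0 = 0\<close>. The sum may
  therefore run over a product of ranges even if not all pairs occur.\<close>

lemma ent_eq_sum:
  assumes "finite S" "X ` space M \<subseteq> S"
  shows "ent M X = - (\<Sum>c\<in>S. prob (X -` {c} \<inter> space M) * ln (prob (X -` {c} \<inter> space M)))"
proof -
  have "X -` {c} \<inter> space M = {}" if "c \<notin> X ` space M" for c
    using that by auto
  then show ?thesis
    unfolding ent_def using assms by (intro arg_cong[of _ _ uminus] sum.mono_neutral_left) auto
qed

lemma prob_marginal:
  assumes X: "simple_function M X" and E: "E \<in> events" and S: "finite S" "X ` space M \<subseteq> S"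
  shows "prob E = (\<Sum>c\<in>S. prob (E \<inter> X -` {c} \<inter> space M))"
proof -
  have ev: "X -` {c} \<inter> space M \<in> events" for c
    using X simple_functionD(2) by blast
  have "E = (\<Union>c\<in>S. E \<inter> (X -` {c} \<inter> space M))"
    using sets.sets_into_space[OF E] S(2) by blast
  also have "prob \<dots> = (\<Sum>c\<in>S. prob (E \<inter> (X -` {c} \<inter> space M)))"
    using E ev S by (intro finite_measure_finite_Union) (auto simp: disjoint_family_on_def)
  finally show ?thesis
    by (simp add: Int_assoc)
qed

lemma ent_nonneg: "0 \<le> ent M X"
proof -
  have "x * ln x \<le> 0" if "0 \<le> x" "x \<le> 1" for x :: real
    using that by (cases "x = 0") (auto intro: mult_nonneg_nonpos)
  then show ?thesis
    unfolding ent_def by (simp add: sum_nonpos)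
qed

lemma ent_const: "ent M (\<lambda>_. c) = 0"
proof -
  have "(\<lambda>_. c) -` {c} \<inter> space M = space M" by auto
  then show ?thesis
    using not_empty by (simp add: ent_def image_constant_conv prob_space)
qed

lemma ent_inj:
  assumes "inj_on g (X ` space M)"
  shows "ent M (\<lambda>x. g (X x)) = ent M X"
proof -
  have "(\<lambda>x. g (X x)) -` {g c} \<inter> space M = X -` {c} \<inter> space M" if "c \<in> X ` space M" for c
    using assms that by (auto simp: inj_on_def)
  moreover have "(\<lambda>x. g (X x)) ` space M = g ` X ` space M"
    by auto
  ultimately show ?thesis
    unfolding ent_def using assms by (simp add: sum.reindex)
qed

text \<open>This is H(X, Y | Z) \<le> H(X | Z) + H(Y | Z) without conditional entropies:
  \<open>entropy_marginals\<close> for each value of \<open>Z\<close>, summed over these values.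
  Equivalently, conditioning on more never increases entropy, which is how it is used.\<close>

lemma ent_strong_subadditive:
  assumes X: "simple_function M X" and Y: "simple_function M Y" and Z: "simple_function M Z"
  shows "ent M (\<lambda>x. (X x, Y x, Z x)) + ent M Z \<le> ent M (\<lambda>x. (X x, Z x)) + ent M (\<lambda>x. (Y x, Z x))"
proof -
  let ?A = "X ` space M" and ?B = "Y ` space M" and ?C = "Z ` space M"
  note fin = simple_functionD(1)[OF X] simple_functionD(1)[OF Y] simple_functionD(1)[OF Z]
  define p where "p x y z = prob ((\<lambda>w. (X w, Y w, Z w)) -` {(x, y, z)} \<inter> space M)" for x y z
  define q where "q x z = prob ((\<lambda>w. (X w, Z w)) -` {(x, z)} \<inter> space M)" for x z
  define r where "r y z = prob ((\<lambda>w. (Y w, Z w)) -` {(y, z)} \<inter> space M)" for y z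
  define s where "s z = prob (Z -` {z} \<inter> space M)" for z
  have XZ: "simple_function M (\<lambda>w. (X w, Z w))" and YZ: "simple_function M (\<lambda>w. (Y w, Z w))"
    using X Y Z by (auto intro: simple_function_Pair)
  have q: "q x z = (\<Sum>y\<in>?B. p x y z)" for x z
    unfolding q_def p_def
    by (subst prob_marginal[OF Y simple_functionD(2)[OF XZ] fin(2)])
      (auto intro!: sum.cong arg_cong[where f = prob])
  have r: "r y z = (\<Sum>x\<in>?A. p x y z)" for y z
    unfolding r_def p_def
    by (subst prob_marginal[OF X simple_functionD(2)[OF YZ] fin(1)])
      (auto intro!: sum.cong arg_cong[where f = prob])
  have s: "s z = (\<Sum>x\<in>?A. \<Sum>y\<in>?B. p x y z)" for z
    unfolding q[symmetric] unfolding s_def q_def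
    by (subst prob_marginal[OF X simple_functionD(2)[OF Z] fin(1)])
      (auto intro!: sum.cong arg_cong[where f = prob])
  have "(\<Sum>z\<in>?C. (\<Sum>x\<in>?A. q x z * ln (q x z)) + (\<Sum>y\<in>?B. r y z * ln (r y z)))
     \<le> (\<Sum>z\<in>?C. (\<Sum>x\<in>?A. \<Sum>y\<in>?B. p x y z * ln (p x y z)) + s z * ln (s z))"
    by (intro sum_mono entropy_marginals fin) (auto simp: q r s, simp add: p_def)
  moreover have "ent M (\<lambda>x. (X x, Y x, Z x)) = - (\<Sum>z\<in>?C. \<Sum>x\<in>?A. \<Sum>y\<in>?B. p x y z * ln (p x y z))"
    by (subst ent_eq_sum[of "?A \<times> ?B \<times> ?C"]) (auto simp: fin p_def sum_Times3_nested[symmetric])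
  moreover have "ent M (\<lambda>x. (X x, Z x)) = - (\<Sum>z\<in>?C. \<Sum>x\<in>?A. q x z * ln (q x z))"
    by (subst ent_eq_sum[of "?A \<times> ?C"]) (auto simp: fin q_def sum_Times_nested[symmetric])
  moreover have "ent M (\<lambda>x. (Y x, Z x)) = - (\<Sum>z\<in>?C. \<Sum>y\<in>?B. r y z * ln (r y z))"
    by (subst ent_eq_sum[of "?B \<times> ?C"]) (auto simp: fin r_def sum_Times_nested[symmetric])
  moreover have "ent M Z = - (\<Sum>z\<in>?C. s z * ln (s z))"
    by (simp add: ent_def s_def)
  ultimately show ?thesis
    by (simp add: sum.distrib)
qed

lemma ent_subadditive:
  assumes X: "simple_function M X" and Y: "simple_function M Y"
  shows "ent M (\<lambda>x. (X x, Y x)) \<le> ent M X + ent M Y"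
proof -
  have "ent M (\<lambda>x. (X x, Y x, ())) + ent M (\<lambda>_. ()) \<le> ent M (\<lambda>x. (X x, ())) + ent M (\<lambda>x. (Y x, ()))"
    by (intro ent_strong_subadditive assms simple_function_const)
  moreover have "ent M (\<lambda>x. (X x, ())) = ent M X" "ent M (\<lambda>x. (Y x, ())) = ent M Y"
    by (intro ent_inj[of "\<lambda>x. (x, ())"]; simp add: inj_on_def)+
  moreover have "ent M (\<lambda>x. (X x, Y x, ())) = ent M (\<lambda>x. (X x, Y x))"
    using ent_inj[of "\<lambda>(x, y). (x, y, ())" "\<lambda>x. (X x, Y x)"] by (simp add: inj_on_def)
  ultimately show ?thesis
    by (simp add: ent_const)
qed

lemma ent_mono:
  assumes X: "simple_function M X" and Y: "simple_function M Y"
  shows "ent M X \<le> ent M (\<lambda>x. (X x, Y x))"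
proof -
  let ?A = "X ` space M" and ?B = "Y ` space M"
  note fin = simple_functionD(1)[OF X] simple_functionD(1)[OF Y]
  define p where "p x y = prob ((\<lambda>w. (X w, Y w)) -` {(x, y)} \<inter> space M)" for x y
  define q where "q x = prob (X -` {x} \<inter> space M)" for x
  have q: "q x = (\<Sum>y\<in>?B. p x y)" for x
    unfolding p_def q_def
    by (subst prob_marginal[OF Y simple_functionD(2)[OF X] fin(2)])
      (auto intro!: sum.cong arg_cong[where f = prob])
  have "p x y * ln (p x y) \<le> p x y * ln (q x)" if "y \<in> ?B" for x y
  proof (cases "p x y = 0")
    case False
    then have "p x y > 0" by (simp add: p_def measure_nonneg order_less_le)
    moreover have "p x y \<le> q x"
      unfolding q using fin that by (intro member_le_sum) (auto simp: p_def)
    ultimately show ?thesis by (intro mult_left_mono) auto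
  qed simp
  then have "(\<Sum>x\<in>?A. \<Sum>y\<in>?B. p x y * ln (p x y)) \<le> (\<Sum>x\<in>?A. \<Sum>y\<in>?B. p x y * ln (q x))"
    by (intro sum_mono)
  also have "\<dots> = (\<Sum>x\<in>?A. q x * ln (q x))"
    by (simp add: q sum_distrib_right)
  also have "\<dots> = - ent M X"
    by (simp add: ent_def q_def)
  finally have "ent M X \<le> - (\<Sum>x\<in>?A. \<Sum>y\<in>?B. p x y * ln (p x y))"
    by simp
  also have "\<dots> = ent M (\<lambda>x. (X x, Y x))"
    by (subst ent_eq_sum[of "?A \<times> ?B"])
      (auto simp: fin p_def sum_Times_nested[symmetric] sum.swap[of _ ?B])
  finally show ?thesis .
qed

end

section \<open>Conditional entropy, itineraries and entropy rates\<close>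

definition itinerary :: "('x \<Rightarrow> 'x) \<Rightarrow> ('x \<Rightarrow> 'c) \<Rightarrow> nat \<Rightarrow> 'x \<Rightarrow> 'c list" where
  "itinerary T X n x = map (\<lambda>i. X ((T ^^ i) x)) [0..<n]"

lemma itinerary_add: "itinerary T X (n + m) x = itinerary T X n x @ itinerary T X m ((T ^^ n) x)"
proof -
  have "(T ^^ i) ((T ^^ n) x) = (T ^^ (n + i)) x" for i
    by (metis add.commute comp_apply funpow_add)
  moreover have "[n..<n + m] = map (\<lambda>i. n + i) [0..<m]"
    by (simp add: map_add_upt add.commute)
  ultimately show ?thesis
    by (simp add: itinerary_def upt_add_eq_append[of 0] del: upt_add_eq_append)
qed

lemma length_itinerary [simp]: "length (itinerary T X n x) = n"
  by (simp add: itinerary_def)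

context prob_space
begin

lemma ent_comp_le:
  assumes X: "simple_function M X"
  shows "ent M (\<lambda>x. g (X x)) \<le> ent M X"
proof -
  have "ent M (\<lambda>x. g (X x)) \<le> ent M (\<lambda>x. (g (X x), X x))"
    using simple_function_compose1[OF X, of g] X by (intro ent_mono)
  also have "\<dots> = ent M X"
    by (rule ent_inj[of "\<lambda>x. (g x, x)"]) (auto simp: inj_on_def)
  finally show ?thesis .
qed

text \<open>Bounds the conditional entropy of \<open>X\<close> given \<open>Y\<close> when each event \<open>X = c\<close> is
  nearly the event \<open>Y \<in> U c\<close>.\<close>

lemma conditional_entropy_approx:
  fixes U :: "'c \<Rightarrow> 'd set"
  assumes X: "simple_function M X" and Y: "simple_function M Y" and e: "e > 0"
  defines "\<delta> \<equiv> \<lambda>c. prob ((X -` {c} \<inter> space M - Y -` U c) \<union> (Y -` U c \<inter> space M - X -` {c}))"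
  shows "ent M (\<lambda>x. (X x, Y x)) - ent M Y \<le> (\<Sum>c\<in>X ` space M. \<delta> c + e + \<delta> c / e)"
proof -
  let ?A = "X ` space M" and ?B = "Y ` space M"
  note fin = simple_functionD(1)[OF X] simple_functionD(1)[OF Y]
  have evX: "X -` S \<inter> space M \<in> events" and evY: "Y -` S' \<inter> space M \<in> events" for S S'
    using X Y simple_functionD(2) by blast+
  have evD: "X -` S \<inter> space M - Y -` S' \<in> events" "Y -` S' \<inter> space M - X -` S \<in> events" for S S'
  proof -
    have "X -` S \<inter> space M - Y -` S' = (X -` S \<inter> space M) - (Y -` S' \<inter> space M)"
      "Y -` S' \<inter> space M - X -` S = (Y -` S' \<inter> space M) - (X -` S \<inter> space M)"
      by auto
    then show "X -` S \<inter> space M - Y -` S' \<in> events" "Y -` S' \<inter> space M - X -` S \<in> events"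
      using evX evY by auto
  qed
  have evXY: "X -` S \<inter> space M \<inter> Y -` S' \<inter> space M \<in> events" for S S'
    using sets.Int[OF evX[of S] evY[of S']] by (simp add: Int_assoc)
  define p where "p x y = prob (X -` {x} \<inter> space M \<inter> Y -` {y} \<inter> space M)" for x y
  define P where "P y = prob (Y -` {y} \<inter> space M)" for y
  have P: "P y = (\<Sum>x\<in>?A. p x y)" for y
    unfolding P_def p_def
    by (subst prob_marginal[OF X simple_functionD(2)[OF Y] fin(1)])
      (auto intro!: sum.cong arg_cong[where f = prob])
  have le: "p x y \<le> P y" for x y
    unfolding P_def p_def using evX evY by (intro finite_measure_mono) auto
  have XY: "ent M (\<lambda>x. (X x, Y x)) = - (\<Sum>x\<in>?A. \<Sum>y\<in>?B. p x y * ln (p x y))"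
  proof -
    have "p x y = prob ((\<lambda>w. (X w, Y w)) -` {(x, y)} \<inter> space M)" for x y
      unfolding p_def by (auto intro!: arg_cong[where f = prob])
    then show ?thesis
      by (subst ent_eq_sum[of "?A \<times> ?B"])
        (auto simp: fin sum_Times_nested[symmetric] sum.swap[of _ ?B])
  qed
  have "ent M Y = - (\<Sum>y\<in>?B. P y * ln (P y))"
    by (simp add: ent_def P_def)
  also have "(\<Sum>y\<in>?B. P y * ln (P y)) = (\<Sum>y\<in>?B. \<Sum>x\<in>?A. p x y * ln (P y))"
    by (simp add: P sum_distrib_right)
  also have "\<dots> = (\<Sum>x\<in>?A. \<Sum>y\<in>?B. p x y * ln (P y))"
    by (rule sum.swap)
  finally have "ent M (\<lambda>x. (X x, Y x)) - ent M Y
      = (\<Sum>x\<in>?A. \<Sum>y\<in>?B. p x y * ln (P y) - p x y * ln (p x y))"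
    by (simp add: XY sum_subtractf)
  also have "\<dots> \<le> (\<Sum>c\<in>?A. \<delta> c + e + \<delta> c / e)"
  proof (rule sum_mono)
    fix c assume "c \<in> ?A"
    \<comment> \<open>Put \<open>z = P y / p c y\<close>. For \<open>y \<in> U c\<close> the bound
      \<open>ln z \<le> z - 1\<close> suffices, since \<open>P y - p c y\<close> is mass on which
      the approximation fails. Outside \<open>U c\<close> it is \<open>p c y\<close> that is such
      mass, while the sum of \<open>P y\<close> is only known to be at most 1 and so must carry the
      small factor \<open>e\<close>.\<close>
    have 1: "p c y * ln (P y) - p c y * ln (p c y)
      \<le> (if y \<in> U c then P y - p c y else e * P y + p c y / e)" for y
    proof (cases "p c y = 0")
      case True
      moreover have "0 \<le> P y" by (simp add: P_def)
      ultimately show ?thesis using e by simp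
    next
      case False
      then have pos: "p c y > 0" by (simp add: p_def measure_nonneg order_less_le)
      with le[of c y] have "P y > 0" by linarith
      define z where "z = P y / p c y"
      have z: "z > 0" using pos \<open>P y > 0\<close> by (simp add: z_def)
      have "p c y * ln (P y) - p c y * ln (p c y) = p c y * ln z"
        using pos \<open>P y > 0\<close> by (simp add: z_def ln_div right_diff_distrib)
      moreover have "p c y * ln z \<le> p c y * (z - 1)"
        using ln_le_minus_one[OF z] pos by (intro mult_left_mono) auto
      \<comment> \<open>Splitting \<open>ln z\<close> as \<open>ln (e * z) + ln (1 / e)\<close>
        before linearising puts the factor \<open>e\<close> on \<open>z\<close>.\<close>
      moreover have "p c y * ln z \<le> p c y * (e * z + 1 / e)"
      proof -
        have "ln (e * z) \<le> e * z - 1" "ln (1 / e) \<le> 1 / e - 1"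
          using z e by (intro ln_le_minus_one; simp)+
        moreover have "ln (e * z) + ln (1 / e) = ln z"
          using z e by (simp add: ln_mult ln_div)
        ultimately show ?thesis
          using pos by (intro mult_left_mono) auto
      qed
      ultimately show ?thesis
        using pos by (simp add: z_def algebra_simps)
    qed
    have 2: "(\<Sum>y\<in>?B \<inter> U c. P y - p c y) \<le> \<delta> c"
    proof -
      have "P y - p c y = prob (Y -` {y} \<inter> space M - X -` {c} \<inter> space M)" for y
        unfolding P_def p_def using finite_measure_Diff'[OF evY[of "{y}"] evX[of "{c}"]]
        by (simp add: Int_ac)
      then have "(\<Sum>y\<in>?B \<inter> U c. P y - p c y)
          = (\<Sum>y\<in>?B \<inter> U c. prob (Y -` {y} \<inter> space M - X -` {c} \<inter> space M))"
        by simp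
      also have "\<dots> = prob (\<Union>y\<in>?B \<inter> U c. Y -` {y} \<inter> space M - X -` {c} \<inter> space M)"
        using fin evX evY by (intro finite_measure_finite_Union[symmetric]) (auto simp: disjoint_family_on_def)
      also have "\<dots> \<le> \<delta> c"
        unfolding \<delta>_def by (intro finite_measure_mono sets.Un evD) auto
      finally show ?thesis .
    qed
    have 3: "(\<Sum>y\<in>?B - U c. p c y) \<le> \<delta> c"
    proof -
      have "(\<Sum>y\<in>?B - U c. p c y) = prob (\<Union>y\<in>?B - U c. X -` {c} \<inter> space M \<inter> Y -` {y} \<inter> space M)"
        unfolding p_def using fin evX evY
        by (intro finite_measure_finite_Union[symmetric]) (auto simp: disjoint_family_on_def intro: evXY)
      also have "\<dots> \<le> \<delta> c"
        unfolding \<delta>_def by (intro finite_measure_mono sets.Un evD) auto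
      finally show ?thesis .
    qed
    have 4: "(\<Sum>y\<in>?B - U c. P y) \<le> 1"
    proof -
      have "(\<Sum>y\<in>?B - U c. P y) = prob (\<Union>y\<in>?B - U c. Y -` {y} \<inter> space M)"
        unfolding P_def using fin evY
        by (intro finite_measure_finite_Union[symmetric]) (auto simp: disjoint_family_on_def)
      then show ?thesis by simp
    qed
    have "(\<Sum>y\<in>?B. p c y * ln (P y) - p c y * ln (p c y))
        \<le> (\<Sum>y\<in>?B. if y \<in> U c then P y - p c y else e * P y + p c y / e)"
      by (intro sum_mono 1)
    also have "\<dots> = (\<Sum>y\<in>?B \<inter> U c. P y - p c y) + (\<Sum>y\<in>?B - U c. e * P y + p c y / e)"
      by (subst sum.If_cases) (auto simp: fin Diff_eq Int_def)
    also have "(\<Sum>y\<in>?B - U c. e * P y + p c y / e) = e * (\<Sum>y\<in>?B - U c. P y) + (\<Sum>y\<in>?B - U c. p c y) / e"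
      by (simp add: sum.distrib sum_distrib_left sum_divide_distrib)
    also have "(\<Sum>y\<in>?B \<inter> U c. P y - p c y) + \<dots> \<le> \<delta> c + (e * 1 + \<delta> c / e)"
      using 2 3 4 e by (intro add_mono mult_left_mono divide_right_mono) auto
    finally show "(\<Sum>y\<in>?B. p c y * ln (P y) - p c y * ln (p c y)) \<le> \<delta> c + e + \<delta> c / e"
      by simp
  qed
  finally show ?thesis .
qed

end

locale measure_preserving = prob_space M for M :: "'x measure" +
  fixes T :: "'x \<Rightarrow> 'x"
  assumes T [measurable]: "T \<in> measurable M M" and distr_T: "distr M M T = M"
begin

lemma measurable_funpow [measurable]: "T ^^ i \<in> measurable M M"
  by (induction i) (auto intro: measurable_comp[OF _ T, unfolded comp_def] simp: comp_def id_def)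

lemma funpow_space: "x \<in> space M \<Longrightarrow> (T ^^ i) x \<in> space M"
  using measurable_space[OF measurable_funpow] .

lemma distr_funpow: "distr M M (T ^^ i) = M"
proof (induction i)
  case (Suc i)
  have "distr M M (T ^^ Suc i) = distr (distr M M (T ^^ i)) M T"
    by (subst distr_distr) auto
  then show ?case by (simp only: Suc distr_T)
qed (simp add: id_def distr_id2)

lemma simple_function_funpow:
  assumes "simple_function M X"
  shows "simple_function M (\<lambda>x. X ((T ^^ i) x))"
  unfolding simple_function_def
proof (intro conjI ballI)
  show "finite ((\<lambda>x. X ((T ^^ i) x)) ` space M)"
    using simple_functionD(1)[OF assms] by (rule rev_finite_subset) (auto simp: funpow_space)
  fix c
  have "(\<lambda>x. X ((T ^^ i) x)) -` {c} \<inter> space M = (T ^^ i) -` (X -` {c} \<inter> space M) \<inter> space M"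
    by (auto simp: funpow_space)
  then show "(\<lambda>x. X ((T ^^ i) x)) -` {c} \<inter> space M \<in> events"
    using measurable_sets[OF measurable_funpow simple_functionD(2)[OF assms]] by simp
qed

lemma ent_funpow:
  assumes "simple_function M X"
  shows "ent M (\<lambda>x. X ((T ^^ i) x)) = ent M X"
proof -
  have "prob ((\<lambda>x. X ((T ^^ i) x)) -` {c} \<inter> space M) = prob (X -` {c} \<inter> space M)" for c
  proof -
    have "prob (X -` {c} \<inter> space M) = measure (distr M M (T ^^ i)) (X -` {c} \<inter> space M)"
      by (simp add: distr_funpow)
    also have "\<dots> = prob ((T ^^ i) -` (X -` {c} \<inter> space M) \<inter> space M)"
      by (rule measure_distr) (use simple_functionD(2)[OF assms] in auto)
    also have "(T ^^ i) -` (X -` {c} \<inter> space M) \<inter> space M = (\<lambda>x. X ((T ^^ i) x)) -` {c} \<inter> space M"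
      by (auto simp: funpow_space)
    finally show ?thesis by simp
  qed
  then show ?thesis
    using simple_functionD(1)[OF assms] by (subst ent_eq_sum[of "X ` space M"]) (auto simp: ent_def funpow_space)
qed

lemma simple_function_itinerary:
  assumes "simple_function M X"
  shows "simple_function M (itinerary T X n)"
proof (induction n)
  case (Suc n)
  have "simple_function M (\<lambda>x. (\<lambda>(l, c). l @ [c]) (itinerary T X n x, X ((T ^^ n) x)))"
    by (rule simple_function_compose1[OF simple_function_Pair[OF Suc simple_function_funpow[OF assms]]])
  then show ?case by (simp add: itinerary_def[abs_def])
qed (simp add: itinerary_def[abs_def])

lemma ent_itinerary_add:
  assumes X: "simple_function M X"
  shows "ent M (itinerary T X (n + m)) \<le> ent M (itinerary T X n) + ent M (itinerary T X m)"
proof -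
  let ?Z = "\<lambda>x. (itinerary T X n x, itinerary T X m ((T ^^ n) x))"
  have "ent M (itinerary T X (n + m)) = ent M (\<lambda>x. (\<lambda>(a, b). a @ b) (?Z x))"
    by (simp add: itinerary_add[abs_def])
  also have "\<dots> = ent M ?Z"
    by (intro ent_inj) (auto simp: inj_on_def)
  also have "\<dots> \<le> ent M (itinerary T X n) + ent M (\<lambda>x. itinerary T X m ((T ^^ n) x))"
    by (rule ent_subadditive[OF simple_function_itinerary[OF X]
          simple_function_funpow[OF simple_function_itinerary[OF X]]])
  also have "ent M (\<lambda>x. itinerary T X m ((T ^^ n) x)) = ent M (itinerary T X m)"
    by (rule ent_funpow[OF simple_function_itinerary[OF X]])
  finally show ?thesis .
qed

text \<open>\<open>entropy_wrt\<close> is a bare \<open>lim\<close>, so convergence has to be known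
  before its value can be used.\<close>

lemma entropy_rate_exists:
  assumes X: "simple_function M X"
  obtains h where "(\<lambda>n. ent M (itinerary T X n) / real n) \<longlonglongrightarrow> h"
proof (rule fekete[of "\<lambda>n. ent M (itinerary T X n)" 0])
  show "- 0 * real n \<le> ent M (itinerary T X n)" for n
    by (simp add: ent_nonneg)
  show "ent M (itinerary T X (n + m)) \<le> ent M (itinerary T X n) + ent M (itinerary T X m)" for n m
    by (rule ent_itinerary_add[OF X])
  fix L assume "(\<lambda>n. ent M (itinerary T X n) / real n) \<longlonglongrightarrow> L"
  then show thesis by (rule that)
qed

text \<open>Once the \<open>Y\<close>-itinerary is known, each new letter of \<open>X\<close> costs
  at most its conditional entropy given the letter of \<open>Y\<close> at the same time. By
  invariance this is H(X | Y) at every time.\<close>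

lemma ent_itinerary_compare:
  assumes X: "simple_function M X" and Y: "simple_function M Y"
  shows "ent M (itinerary T X n) \<le> ent M (itinerary T Y n) + real n * (ent M (\<lambda>x. (X x, Y x)) - ent M Y)"
proof -
  let ?X = "itinerary T X" and ?Y = "itinerary T Y"
  let ?e = "ent M (\<lambda>x. (X x, Y x)) - ent M Y"
  note sf = simple_function_itinerary[OF X] simple_function_itinerary[OF Y]
    simple_function_funpow[OF X] simple_function_funpow[OF Y] simple_function_Pair
  have "ent M (\<lambda>x. (?X n x, ?Y n x)) \<le> ent M (?Y n) + real n * ?e"
  proof (induction n)
    case 0
    have "?X 0 = (\<lambda>_. [])" "?Y 0 = (\<lambda>_. [])" by (auto simp: itinerary_def)
    then show ?case by (simp add: ent_const)
  next
    case (Suc n)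
    let ?X' = "\<lambda>x. X ((T ^^ n) x)" and ?Y' = "\<lambda>x. Y ((T ^^ n) x)"
    have XS: "?X (Suc n) x = ?X n x @ [?X' x]" "?Y (Suc n) x = ?Y n x @ [?Y' x]" for x
      by (simp_all add: itinerary_def)
    \<comment> \<open>Conditioning on more decreases entropy, three times: H(X' | X n, Y n, Y')
      \<le> H(X' | Y n, Y'), then H(Y' | X n, Y n) \<le> H(Y' | Y n), then H(X' | Y n, Y') \<le>
      H(X' | Y'). The remaining facts only reorder tuples or use invariance.\<close>
    have 1: "ent M (\<lambda>x. (?X n x, ?X' x, (?Y n x, ?Y' x))) + ent M (\<lambda>x. (?Y n x, ?Y' x))
        \<le> ent M (\<lambda>x. (?X n x, (?Y n x, ?Y' x))) + ent M (\<lambda>x. (?X' x, (?Y n x, ?Y' x)))"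
      by (intro ent_strong_subadditive sf)
    have 2: "ent M (\<lambda>x. (?X n x, ?Y' x, ?Y n x)) + ent M (?Y n)
        \<le> ent M (\<lambda>x. (?X n x, ?Y n x)) + ent M (\<lambda>x. (?Y' x, ?Y n x))"
      by (intro ent_strong_subadditive sf)
    have 3: "ent M (\<lambda>x. (?X' x, ?Y n x, ?Y' x)) + ent M ?Y'
        \<le> ent M (\<lambda>x. (?X' x, ?Y' x)) + ent M (\<lambda>x. (?Y n x, ?Y' x))"
      by (intro ent_strong_subadditive sf)
    have 4: "ent M (\<lambda>x. (?X n x, ?Y' x, ?Y n x)) = ent M (\<lambda>x. (?X n x, (?Y n x, ?Y' x)))"
      using ent_inj[of "\<lambda>(a, b, c). (a, c, b)" "\<lambda>x. (?X n x, (?Y n x, ?Y' x))"]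
      by (simp add: inj_on_def)
    have 5: "ent M (\<lambda>x. (?Y' x, ?Y n x)) = ent M (\<lambda>x. (?Y n x, ?Y' x))"
      using ent_inj[of "\<lambda>(a, b). (b, a)" "\<lambda>x. (?Y n x, ?Y' x)"] by (simp add: inj_on_def)
    have 6: "ent M (?Y (Suc n)) = ent M (\<lambda>x. (?Y n x, ?Y' x))"
      using ent_inj[of "\<lambda>(a, b). a @ [b]" "\<lambda>x. (?Y n x, ?Y' x)"]
      by (simp add: inj_on_def XS[abs_def])
    have 7: "ent M (\<lambda>x. (?X (Suc n) x, ?Y (Suc n) x)) = ent M (\<lambda>x. (?X n x, ?X' x, (?Y n x, ?Y' x)))"
      using ent_inj[of "\<lambda>(a, b, c, d). (a @ [b], c @ [d])" "\<lambda>x. (?X n x, ?X' x, (?Y n x, ?Y' x))"]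
      by (simp add: inj_on_def XS[abs_def])
    have 8: "ent M (\<lambda>x. (?X' x, ?Y' x)) = ent M (\<lambda>x. (X x, Y x))"
      using ent_funpow[OF simple_function_Pair[OF X Y]] by simp
    have 9: "ent M ?Y' = ent M Y"
      by (rule ent_funpow[OF Y])
    show ?case
      using 1 2 3 4 5 6 7 8 9 Suc by (simp add: algebra_simps)
  qed
  moreover have "ent M (?X n) \<le> ent M (\<lambda>x. (?X n x, ?Y n x))"
    by (intro ent_mono sf)
  ultimately show ?thesis by linarith
qed

lemma partition_entropy_fibers:
  "partition_entropy M ((\<lambda>c. Z -` {c} \<inter> space M) ` (Z ` space M)) = ent M Z"
proof -
  have "inj_on (\<lambda>c. Z -` {c} \<inter> space M) (Z ` space M)"
    by (auto simp: inj_on_def)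
  then show ?thesis
    by (simp add: partition_entropy_def ent_def sum.reindex)
qed

text \<open>\<open>X\<close> names the block of \<open>P\<close> containing a point, so two points
  lie in the same atom exactly when their itineraries agree. The empty intersections removed from
  the join belong to sequences of blocks that no point follows.\<close>

lemma iterated_join_fibers:
  assumes P: "partition_on (space M) P" and X: "\<And>x. x \<in> space M \<Longrightarrow> X x \<in> P \<and> x \<in> X x"
  shows "iterated_join M T P n = (\<lambda>c. itinerary T X n -` {c} \<inter> space M) ` (itinerary T X n ` space M)"
proof -
  have Xeq: "x \<in> A \<longleftrightarrow> X x = A" if "x \<in> space M" "A \<in> P" for x A
    using X[OF that(1)] that partition_onD2[OF P] by (auto simp: disjoint_def)
  have fiber: "itinerary T X n -` {itinerary T X n y} \<inter> space M
      = {x \<in> space M. \<forall>i<n. (T ^^ i) x \<in> X ((T ^^ i) y)}" if "y \<in> space M" for y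
    using Xeq[OF funpow_space] X[OF funpow_space[OF that]] that
    by (auto simp: itinerary_def)
  show ?thesis
  proof (intro equalityI subsetI)
    fix S assume "S \<in> iterated_join M T P n"
    then obtain A where S: "S = {x \<in> space M. \<forall>i<n. (T ^^ i) x \<in> A i}" "\<forall>i<n. A i \<in> P" "S \<noteq> {}"
      by (auto simp: iterated_join_def)
    then obtain y where y: "y \<in> space M" "\<forall>i<n. (T ^^ i) y \<in> A i" by auto
    then have "X ((T ^^ i) y) = A i" if "i < n" for i
      using Xeq[OF funpow_space, of y "A i" i] S(2) that by auto
    then have "S = itinerary T X n -` {itinerary T X n y} \<inter> space M"
      unfolding fiber[OF y(1)] S(1) by auto
    then show "S \<in> (\<lambda>c. itinerary T X n -` {c} \<inter> space M) ` (itinerary T X n ` space M)"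
      using y(1) by blast
  next
    fix S assume "S \<in> (\<lambda>c. itinerary T X n -` {c} \<inter> space M) ` (itinerary T X n ` space M)"
    then obtain y where y: "y \<in> space M" "S = itinerary T X n -` {itinerary T X n y} \<inter> space M"
      by auto
    then have "S = {x \<in> space M. \<forall>i<n. (T ^^ i) x \<in> X ((T ^^ i) y)}" "y \<in> S"
      using fiber by auto
    moreover have "\<forall>i<n. X ((T ^^ i) y) \<in> P"
      using X funpow_space[OF y(1)] by auto
    ultimately show "S \<in> iterated_join M T P n"
      unfolding iterated_join_def
      by (intro DiffI CollectI exI[of _ "\<lambda>i. X ((T ^^ i) y)"] conjI) auto
  qed
qed

lemma entropy_wrt_eq:
  assumes "partition_on (space M) P" and "\<And>x. x \<in> space M \<Longrightarrow> X x \<in> P \<and> x \<in> X x"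
    and "(\<lambda>n. ent M (itinerary T X n) / real n) \<longlonglongrightarrow> h"
  shows "entropy_wrt M T P = h"
proof -
  have "iterated_join M T P n = (\<lambda>c. itinerary T X n -` {c} \<inter> space M) ` (itinerary T X n ` space M)" for n
    using assms(1,2) by (rule iterated_join_fibers)
  then show ?thesis
    using assms(3) by (simp add: entropy_wrt_def partition_entropy_fibers limI)
qed

end

subsection \<open>Kolmogorov--Sinai entropy of the full shift\<close>

text \<open>The sets with this property contain the cylinders and are closed under complements and
  countable unions. Approximation is required for all large \<open>m\<close>, not for one, so that
  finitely many sets can be approximated by words of a common length; the union step needs this, and
  so does the entropy theorem.\<close>

lemma cylinder_approximation:
  fixes \<eta> :: "(nat \<Rightarrow> 'a::{finite,discrete_topology}) measure"
  assumes "\<eta> \<in> borel_prob_measures" and A: "A \<in> sets borel" and "e > 0"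
  shows "\<exists>m0. \<forall>m\<ge>m0. \<exists>U. measure \<eta> ((A - initial_word m -` U) \<union> (initial_word m -` U - A)) < e"
proof -
  interpret prob_space \<eta> using assms by (simp add: borel_prob_measures_def)
  have sets_eta [measurable_cong]: "sets \<eta> = sets borel"
    using assms by (simp add: borel_prob_measures_def)
  have iw: "initial_word m -` U \<in> sets borel" for m and U :: "'a list set"
    using measurable_sets[OF measurable_initial_word, of U] by simp
  have "A \<in> sigma_sets UNIV (range cylinder)"
    using A by (simp add: sets_borel_cylinders)
  then show ?thesis
    using \<open>e > 0\<close>
  proof (induction A arbitrary: e rule: sigma_sets.induct)
    case (Basic A)
    then obtain I where A: "A = cylinder I" by blast
    have "initial_word m -` {J. take (length I) J = I} = A" if "m \<ge> length I" for m
      using that by (auto simp: A cylinder_iff take_initial_word)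
    then show ?case
      using Basic by (intro exI[of _ "length I"] allI impI exI[of _ "{J. take (length I) J = I}"]) simp
  next
    case Empty
    then show ?case by (intro exI[of _ 0] allI impI exI[of _ "{}"]) simp
  next
    case (Compl A)
    then obtain m0 where m0: "\<And>m. m \<ge> m0 \<Longrightarrow> \<exists>U. measure \<eta> ((A - initial_word m -` U) \<union> (initial_word m -` U - A)) < e"
      by blast
    have "\<exists>U. measure \<eta> ((UNIV - A - initial_word m -` U) \<union> (initial_word m -` U - (UNIV - A))) < e"
      if m: "m \<ge> m0" for m
    proof -
      obtain U where "measure \<eta> ((A - initial_word m -` U) \<union> (initial_word m -` U - A)) < e"
        using m0[OF m] by blast
      moreover have "(UNIV - A - initial_word m -` (- U)) \<union> (initial_word m -` (- U) - (UNIV - A))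
          = (A - initial_word m -` U) \<union> (initial_word m -` U - A)"
        by auto
      ultimately show ?thesis by metis
    qed
    then show ?case by blast
  next
    case (Union A)
    have A: "A i \<in> sets \<eta>" for i
      using Union(1) by (simp add: sets_eta sets_borel_cylinders)
    have "(\<lambda>n. prob (\<Union>i<n. A i)) \<longlonglongrightarrow> prob (\<Union>n. \<Union>i<n. A i)"
      by (intro finite_Lim_measure_incseq incseq_SucI) (use A in \<open>auto simp: lessThan_Suc\<close>)
    moreover have "(\<Union>n. \<Union>i<n. A i) = (\<Union>i. A i)" by auto
    ultimately have "eventually (\<lambda>n. prob (\<Union>i<n. A i) > prob (\<Union>i. A i) - e / 2) sequentially"
      using Union(3) by (intro order_tendstoD) auto
    then obtain N where N: "prob (\<Union>i<N. A i) > prob (\<Union>i. A i) - e / 2"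
      by (auto simp: eventually_sequentially)
    \<comment> \<open>Cutting off the union costs at most \<open>e / 2\<close>, and the other half
      is shared by the \<open>N\<close> remaining sets. The summand 1 keeps \<open>d\<close>
      positive when \<open>N = 0\<close>.\<close>
    define d where "d = e / (2 * (real N + 1))"
    have d: "d > 0" using Union(3) by (simp add: d_def)
    have "\<forall>i. \<exists>m0. \<forall>m\<ge>m0. \<exists>U. measure \<eta> ((A i - initial_word m -` U) \<union> (initial_word m -` U - A i)) < d"
      using Union(2)[OF d] by blast
    then obtain k where k: "\<And>i m. m \<ge> k i \<Longrightarrow> \<exists>U. measure \<eta> ((A i - initial_word m -` U) \<union> (initial_word m -` U - A i)) < d"
      by metis
    have "\<exists>U. measure \<eta> (((\<Union>i. A i) - initial_word m -` U) \<union> (initial_word m -` U - (\<Union>i. A i))) < e"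
      if m: "m \<ge> (\<Sum>i<N. k i)" for m
    proof -
      have "\<forall>i\<in>{..<N}. \<exists>U. measure \<eta> ((A i - initial_word m -` U) \<union> (initial_word m -` U - A i)) < d"
      proof
        fix i assume i: "i \<in> {..<N}"
        then have "k i \<le> (\<Sum>i<N. k i)" by (intro member_le_sum) auto
        then show "\<exists>U. measure \<eta> ((A i - initial_word m -` U) \<union> (initial_word m -` U - A i)) < d"
          using m k by (meson le_trans)
      qed
      then obtain U where U: "\<And>i. i < N \<Longrightarrow> measure \<eta> ((A i - initial_word m -` U i) \<union> (initial_word m -` U i - A i)) < d"
        by (auto dest!: bchoice)
      define V where "V = (\<Union>i<N. U i)"
      let ?D = "\<lambda>i. (A i - initial_word m -` U i) \<union> (initial_word m -` U i - A i)"
      have D: "?D i \<in> sets \<eta>" for i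
        using A iw by (auto simp: sets_eta)
      have "measure \<eta> (((\<Union>i. A i) - initial_word m -` V) \<union> (initial_word m -` V - (\<Union>i. A i)))
          \<le> measure \<eta> (((\<Union>i. A i) - (\<Union>i<N. A i)) \<union> (\<Union>i<N. ?D i))"
        using A D by (intro finite_measure_mono) (auto simp: V_def)
      also have "\<dots> \<le> measure \<eta> ((\<Union>i. A i) - (\<Union>i<N. A i)) + measure \<eta> (\<Union>i<N. ?D i)"
        using A D by (intro measure_Un_le) auto
      also have "measure \<eta> ((\<Union>i. A i) - (\<Union>i<N. A i)) = prob (\<Union>i. A i) - prob (\<Union>i<N. A i)"
        using A by (intro finite_measure_Diff) auto
      also have "measure \<eta> (\<Union>i<N. ?D i) \<le> (\<Sum>i<N. measure \<eta> (?D i))"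
        using D by (intro finite_measure_subadditive_finite) auto
      also have "\<dots> \<le> (\<Sum>i<N. d)"
        using U by (intro sum_mono) (auto intro: less_imp_le)
      also have "\<dots> \<le> e / 2"
        using Union(3) by (simp add: d_def field_simps)
      finally have "measure \<eta> (((\<Union>i. A i) - initial_word m -` V) \<union> (initial_word m -` V - (\<Union>i. A i))) < e"
        using N by simp
      then show ?thesis by blast
    qed
    then show ?case by blast
  qed
qed

text \<open>A run of \<open>n\<close> overlapping windows of length \<open>m + 1\<close> reads only
  \<open>n + m\<close> letters, so its entropy is bounded by that of slightly longer words.\<close>

lemma itinerary_initial_word:
  "itinerary shift (initial_word (Suc m)) n x
    = map (\<lambda>i. take (Suc m) (drop i (initial_word (n + m) x))) [0..<n]"
proof -
  have "initial_word (Suc m) ((shift ^^ i) x) = take (Suc m) (drop i (initial_word (n + m) x))" if "i < n" for i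
  proof -
    have "n + m = i + (n - i + m)" using that by simp
    then have "drop i (initial_word (n + m) x) = initial_word (n - i + m) ((shift ^^ i) x)"
      using initial_word_add[of i "n - i + m" x] by simp
    then show ?thesis
      using that by (simp add: take_initial_word)
  qed
  then show ?thesis
    by (simp add: itinerary_def)
qed

text \<open>The one-letter partition generates. The block of any finite partition is nearly
  determined by a word of some fixed length, with conditional entropy at most \<open>e\<close>; its
  rate then exceeds the rate of words by at most \<open>e\<close>, because \<open>m\<close> extra
  letters are negligible against \<open>n\<close>.\<close>

theorem kolmogorov_sinai_shift:
  fixes \<eta> :: "(nat \<Rightarrow> 'a::{finite,discrete_topology}) measure"
  assumes "\<eta> \<in> invariant_measures shift"
  obtains h where "ks_entropy \<eta> shift = ereal h" "(\<lambda>n. ent \<eta> (initial_word n) / real n) \<longlonglongrightarrow> h"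
proof -
  have \<eta>: "\<eta> \<in> borel_prob_measures" "shift \<in> measurable \<eta> \<eta>" "distr \<eta> \<eta> shift = \<eta>"
    using assms by (auto simp: invariant_measures_def)
  interpret measure_preserving \<eta> shift
    using \<eta> by (auto simp: borel_prob_measures_def measure_preserving_def measure_preserving_axioms_def)
  have sets_eta [measurable_cong]: "sets \<eta> = sets borel"
    using \<eta> by (simp add: borel_prob_measures_def)
  have space_eta [simp]: "space \<eta> = UNIV"
    using sets_eq_imp_space_eq[OF sets_eta] by simp
  have sf_word: "simple_function \<eta> (initial_word m)" for m
    unfolding simple_function_def
  proof (intro conjI ballI)
    show "finite (initial_word m ` space \<eta>)"
      by (rule finite_subset[OF _ finite_words[of m]]) auto
    show "initial_word m -` {I} \<inter> space \<eta> \<in> events" for I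
      using measurable_sets[OF measurable_initial_word, of "{I}" m] by (simp add: sets_eta)
  qed
  let ?P = "range (\<lambda>x. cylinder [x])" and ?X = "\<lambda>x. cylinder [x 0]"
  have itin1: "itinerary shift ?X n = (\<lambda>x. map (\<lambda>a. cylinder [a]) (initial_word n x))" for n
    by (simp add: itinerary_def[abs_def] initial_word_def[abs_def] shift_funpow comp_def)
  have inj_cyl: "inj (\<lambda>a::'a. cylinder [a])"
    by (rule injI) (use cylinder_disjoint[of "[_]" "[_]"] in fastforce)
  have ent1: "ent \<eta> (itinerary shift ?X n) = ent \<eta> (initial_word n)" for n
    unfolding itin1 by (rule ent_inj[OF inj_on_subset[OF inj_mapI[OF inj_cyl] subset_UNIV]])
  have P: "partition_on UNIV ?P"
    by (rule partition_onI) (use cylinder_disjoint in \<open>auto simp: cylinder_def disjnt_def\<close>)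
  have "simple_function \<eta> (\<lambda>x. (\<lambda>l. cylinder l) (initial_word 1 x))"
    by (rule simple_function_compose1[OF sf_word])
  then have "simple_function \<eta> ?X"
    by (simp add: initial_word_def)
  from entropy_rate_exists[OF this] obtain h where h: "(\<lambda>n. ent \<eta> (initial_word n) / real n) \<longlonglongrightarrow> h"
    unfolding ent1 by blast
  have "entropy_wrt \<eta> shift ?P = h"
  proof (rule entropy_wrt_eq[of _ ?X])
    show "partition_on (space \<eta>) ?P" using P by simp
    show "?X x \<in> ?P \<and> x \<in> ?X x" for x by (auto simp: cylinder_def)
    show "(\<lambda>n. ent \<eta> (itinerary shift ?X n) / real n) \<longlonglongrightarrow> h"
      using h by (simp only: ent1)
  qed
  moreover have "?P \<in> finite_partitions \<eta>"
    using P by (auto simp: finite_partitions_def sets_eta)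
  moreover have "entropy_wrt \<eta> shift P \<le> h" if "P \<in> finite_partitions \<eta>" for P
  proof -
    have Pf: "finite P" "P \<subseteq> sets \<eta>" "partition_on UNIV P"
      using that by (auto simp: finite_partitions_def)
    define X where "X x = (SOME A. A \<in> P \<and> x \<in> A)" for x
    have X: "X x \<in> P \<and> x \<in> X x" for x
    proof -
      have "\<exists>A. A \<in> P \<and> x \<in> A"
        using partition_onD1[OF Pf(3)] by blast
      from someI_ex[OF this] show ?thesis unfolding X_def .
    qed
    have XP: "X x \<in> P" and xX: "x \<in> X x" for x
      using X by simp_all
    have X_eq: "X x = A" if "x \<in> A" "A \<in> P" for x A
      using disjointD[OF partition_onD2[OF Pf(3)] XP[of x] that(2)] xX[of x] that(1) by blast
    have fibre: "X -` {A} = (if A \<in> P then A else {})" for A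
    proof (rule set_eqI)
      fix x
      show "x \<in> X -` {A} \<longleftrightarrow> x \<in> (if A \<in> P then A else {})"
        using XP[of x] xX[of x] X_eq[of x A] by (cases "A \<in> P") auto
    qed
    have sfX: "simple_function \<eta> X"
      unfolding simple_function_def
    proof (intro conjI ballI)
      show "finite (X ` space \<eta>)"
        using XP by (intro finite_subset[OF _ Pf(1)]) auto
      show "X -` {A} \<inter> space \<eta> \<in> events" for A
        using Pf(2) by (auto simp: fibre)
    qed
    obtain r where r: "(\<lambda>n. ent \<eta> (itinerary shift X n) / real n) \<longlonglongrightarrow> r"
      using entropy_rate_exists[OF sfX] by blast
    have "r \<le> h + e" if e: "e > 0" for e
    proof -
      define N where "N = real (card P) + 1"
      have N: "N \<ge> 1" by (simp add: N_def)
      \<comment> \<open>Approximating every block within \<open>d * d\<close> makes each of the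
        three terms in \<open>conditional_entropy_approx\<close> at most \<open>d\<close>: the first
        since \<open>d \<le> 1\<close>, the last since it is divided by \<open>d\<close>. The sum
        over all blocks is then at most \<open>3 * N * d \<le> e\<close>.\<close>
      define d where "d = min 1 (e / (3 * N))"
      have d: "d > 0" "d \<le> 1" "3 * N * d \<le> e"
        using e N by (auto simp: d_def min_def field_simps)
      have "\<exists>m0. \<forall>m\<ge>m0. \<exists>U. measure \<eta> ((A - initial_word m -` U) \<union> (initial_word m -` U - A)) < d * d"
        if "A \<in> P" for A
        using that Pf(2) d by (intro cylinder_approximation \<eta>) (auto simp: sets_eta)
      then obtain k where k: "\<And>A m. A \<in> P \<Longrightarrow> m \<ge> k A \<Longrightarrow>
          \<exists>U. measure \<eta> ((A - initial_word m -` U) \<union> (initial_word m -` U - A)) < d * d"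
        by metis
      define m where "m = (\<Sum>A\<in>P. k A)"
      have "\<exists>U. measure \<eta> ((A - initial_word (Suc m) -` U) \<union> (initial_word (Suc m) -` U - A)) < d * d"
        if "A \<in> P" for A
      proof -
        have "k A \<le> m" unfolding m_def using that Pf(1) by (intro member_le_sum) auto
        then show ?thesis using k[OF that, of "Suc m"] by simp
      qed
      then obtain U where U: "\<And>A. A \<in> P \<Longrightarrow>
          measure \<eta> ((A - initial_word (Suc m) -` U A) \<union> (initial_word (Suc m) -` U A - A)) < d * d"
        by metis
      let ?Y = "initial_word (Suc m) :: (nat \<Rightarrow> 'a) \<Rightarrow> 'a list"
      have "ent \<eta> (\<lambda>x. (X x, ?Y x)) - ent \<eta> ?Y \<le> (\<Sum>c\<in>X ` space \<eta>.
          prob ((X -` {c} \<inter> space \<eta> - ?Y -` U c) \<union> (?Y -` U c \<inter> space \<eta> - X -` {c})) + d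
          + prob ((X -` {c} \<inter> space \<eta> - ?Y -` U c) \<union> (?Y -` U c \<inter> space \<eta> - X -` {c})) / d)"
        by (rule conditional_entropy_approx[OF sfX sf_word d(1)])
      also have "\<dots> \<le> (\<Sum>c\<in>X ` space \<eta>. d * d + d + d * d / d)"
      proof (intro sum_mono add_mono divide_right_mono)
        fix c assume "c \<in> X ` space \<eta>"
        then have "c \<in> P" using XP by auto
        then show "prob ((X -` {c} \<inter> space \<eta> - ?Y -` U c) \<union> (?Y -` U c \<inter> space \<eta> - X -` {c})) \<le> d * d"
          "prob ((X -` {c} \<inter> space \<eta> - ?Y -` U c) \<union> (?Y -` U c \<inter> space \<eta> - X -` {c})) \<le> d * d"
          using U[of c] fibre[of c] by auto
      qed (use d in auto)
      also have "\<dots> \<le> (\<Sum>c\<in>X ` space \<eta>. 3 * d)"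
        using d by (intro sum_mono) (auto simp: mult_left_le)
      also have "\<dots> = real (card (X ` space \<eta>)) * (3 * d)"
        by simp
      also have "\<dots> \<le> N * (3 * d)"
      proof -
        have "card (X ` space \<eta>) \<le> card P"
          using XP by (intro card_mono Pf(1)) auto
        then show ?thesis
          using d unfolding N_def by (intro mult_right_mono) auto
      qed
      also have "\<dots> \<le> e" using d(3) by simp
      finally have cond: "ent \<eta> (\<lambda>x. (X x, ?Y x)) - ent \<eta> ?Y \<le> e" .
      have "ent \<eta> (itinerary shift X n) / real n
          \<le> ent \<eta> (initial_word (n + m)) / real (n + m) * (1 + real m / real n) + e" if n: "n \<ge> 1" for n
      proof -
        have "ent \<eta> (itinerary shift X n) \<le> ent \<eta> (itinerary shift ?Y n)
            + real n * (ent \<eta> (\<lambda>x. (X x, ?Y x)) - ent \<eta> ?Y)"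
          by (rule ent_itinerary_compare[OF sfX sf_word])
        also have "ent \<eta> (itinerary shift ?Y n) \<le> ent \<eta> (initial_word (n + m))"
          using ent_comp_le[OF sf_word, of "\<lambda>K. map (\<lambda>i. take (Suc m) (drop i K)) [0..<n]" "n + m"]
          by (simp add: itinerary_initial_word[abs_def])
        also have "real n * (ent \<eta> (\<lambda>x. (X x, ?Y x)) - ent \<eta> ?Y) \<le> real n * e"
          using cond by (intro mult_left_mono) auto
        finally have "ent \<eta> (itinerary shift X n) / real n \<le> (ent \<eta> (initial_word (n + m)) + real n * e) / real n"
          by (intro divide_right_mono) auto
        also have "\<dots> = ent \<eta> (initial_word (n + m)) / real (n + m) * (1 + real m / real n) + e"
        proof -
          have "1 + real m / real n = real (n + m) / real n"
            using n by (simp add: field_simps)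
          then have "ent \<eta> (initial_word (n + m)) / real (n + m) * (1 + real m / real n)
              = ent \<eta> (initial_word (n + m)) / real (n + m) * (real (n + m) / real n)"
            by (simp only:)
          also have "\<dots> = ent \<eta> (initial_word (n + m)) / real n"
            using n by simp
          finally show ?thesis
            using n by (simp only:) (simp add: add_divide_distrib)
        qed
        finally show ?thesis .
      qed
      moreover have "(\<lambda>n. ent \<eta> (initial_word (n + m)) / real (n + m) * (1 + real m / real n) + e)
          \<longlonglongrightarrow> h * (1 + 0) + e"
        by (intro tendsto_intros LIMSEQ_ignore_initial_segment[OF h] lim_const_over_n)
      ultimately show ?thesis
        using LIMSEQ_le[OF r] by fastforce
    qed
    then have "r \<le> h" by (rule field_le_epsilon)
    moreover have "entropy_wrt \<eta> shift P = r"
    proof (rule entropy_wrt_eq[OF _ _ r])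
      show "partition_on (space \<eta>) P" using Pf(3) by simp
      show "X x \<in> P \<and> x \<in> X x" for x using XP xX by blast
    qed
    ultimately show ?thesis by simp
  qed
  ultimately have "ks_entropy \<eta> shift = ereal h"
    unfolding ks_entropy_def by (intro antisym SUP_least SUP_upper2[of ?P]) auto
  with h that show ?thesis by blast
qed

subsection \<open>Stationary weights and relative entropy\<close>

text \<open>The values on cylinders of a shift-invariant probability measure: summing over a last
  letter expresses additivity, summing over a first letter expresses invariance. Such functions can
  be subtracted and rescaled without constructing measures.\<close>

definition stationary :: "('a::finite list \<Rightarrow> real) \<Rightarrow> bool" where
  "stationary f \<longleftrightarrow> f [] = 1 \<and> (\<forall>I. 0 \<le> f I) \<and>
     (\<forall>I. (\<Sum>x\<in>UNIV. f (I @ [x])) = f I) \<and> (\<forall>I. (\<Sum>x\<in>UNIV. f (x # I)) = f I)"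

lemma stationary_nonneg: "stationary f \<Longrightarrow> 0 \<le> f I"
  by (simp add: stationary_def)

lemma stationary_sum_right:
  assumes "stationary f"
  shows "(\<Sum>J\<in>words m. f (I @ J)) = f I"
proof (induction m)
  case (Suc m)
  have "(\<Sum>J\<in>words (m + 1). f (I @ J)) = (\<Sum>J\<in>words m. \<Sum>x\<in>UNIV. f ((I @ J) @ [x]))"
    by (subst sum_words_add) (simp add: sum_words_1)
  also have "\<dots> = (\<Sum>J\<in>words m. f (I @ J))"
    using assms by (simp only: stationary_def)
  finally show ?case by (simp add: Suc)
qed simp

lemma stationary_sum_left:
  assumes "stationary f"
  shows "(\<Sum>I\<in>words n. f (I @ J)) = f J"
proof (induction n)
  case (Suc n)
  have "(\<Sum>I\<in>words (1 + n). f (I @ J)) = (\<Sum>x\<in>UNIV. \<Sum>I\<in>words n. f (x # (I @ J)))"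
    by (subst sum_words_add) (simp add: sum_words_1)
  also have "\<dots> = (\<Sum>I\<in>words n. \<Sum>x\<in>UNIV. f (x # (I @ J)))"
    by (rule sum.swap)
  also have "\<dots> = (\<Sum>I\<in>words n. f (I @ J))"
    using assms by (simp only: stationary_def)
  finally show ?case by (simp add: Suc)
qed simp

lemma stationary_sum_words: "stationary f \<Longrightarrow> sum f (words n) = 1"
  using stationary_sum_right[of f "[]" n] by (simp add: stationary_def)

lemma stationary_append_le: "stationary f \<Longrightarrow> f (I @ J) \<le> f I"
  using stationary_sum_right[of f I "length J"]
    member_le_sum[of J "words (length J)" "\<lambda>J. f (I @ J)"]
  by (simp add: words_def[of "length J"] stationary_nonneg finite_lists_length_eq[of UNIV, simplified])

definition rel_entropy :: "('a list \<Rightarrow> real) \<Rightarrow> ('a list \<Rightarrow> real) \<Rightarrow> nat \<Rightarrow> real" where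
  "rel_entropy f g n = (\<Sum>I\<in>words n. f I * ln (f I / g I))"

text \<open>The second bound is a rounded form of the minimum of x ln (x / y) over x, which is - y /
  exp 1. Rounding to 1/2 is harmless: x ln (x / y) - x + y still keeps y / 2 - x, which is positive
  when x is small against y.\<close>

lemma mult_ln_div_ge:
  fixes x y :: real
  assumes "0 \<le> x" "0 \<le> y" "y = 0 \<Longrightarrow> x = 0"
  shows "x - y \<le> x * ln (x / y)" "- y / 2 \<le> x * ln (x / y)"
proof -
  show "x - y \<le> x * ln (x / y)"
  proof (cases "x = 0")
    case False
    then have pos: "x > 0" "y > 0" using assms by (auto simp: order_less_le)
    then have "ln (y / x) \<le> y / x - 1"
      by (intro ln_le_minus_one) simp
    then have "x * ln (y / x) \<le> x * (y / x - 1)"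
      using pos by (intro mult_left_mono) auto
    also have "x * (y / x - 1) = y - x"
      using pos by (simp add: field_simps)
    finally show ?thesis
      using pos by (simp add: ln_div algebra_simps)
  qed (use assms in simp)
  show "- y / 2 \<le> x * ln (x / y)"
  proof (cases "x = 0")
    case False
    then have pos: "x > 0" "y > 0" using assms by (auto simp: order_less_le)
    then have "ln (y / (2 * x)) \<le> y / (2 * x) - 1"
      by (intro ln_le_minus_one) simp
    moreover have "ln (y / (2 * x)) = - ln (x / y) - ln 2"
      using pos by (simp add: ln_div ln_mult)
    moreover have "ln 2 \<le> (1::real)"
      using ln_le_minus_one[of 2] by simp
    ultimately have "- ln (x / y) \<le> y / (2 * x)" by linarith
    then have "x * (- ln (x / y)) \<le> x * (y / (2 * x))"
      using pos by (intro mult_left_mono) auto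
    also have "x * (y / (2 * x)) = y / 2"
      using pos by simp
    finally show ?thesis by simp
  qed (use assms in simp)
qed

lemma rel_entropy_nonneg:
  assumes "stationary f" "stationary g" "\<And>I. g I > 0"
  shows "0 \<le> rel_entropy f g n"
proof -
  have "(\<Sum>I\<in>words n. f I - g I) \<le> rel_entropy f g n"
    unfolding rel_entropy_def using assms(3)
    by (intro sum_mono mult_ln_div_ge stationary_nonneg assms(1,2)) (auto simp: less_imp_neq[symmetric])
  then show ?thesis
    by (simp add: sum_subtractf stationary_sum_words assms)
qed

lemma rel_entropy_self: "(\<And>I. g I > 0) \<Longrightarrow> rel_entropy g g n = 0"
  by (simp add: rel_entropy_def less_imp_neq[symmetric])

lemma rel_entropy_0: "stationary f \<Longrightarrow> stationary g \<Longrightarrow> rel_entropy f g 0 = 0"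
  by (simp add: rel_entropy_def stationary_def)

text \<open>The increment is the relative entropy of the next \<open>m\<close> letters given the
  first \<open>n\<close>. A single block \<open>J\<close> already contributes, because
  \<open>g (I @ J) / g I \<ge> g J / c\<close> whatever \<open>I\<close> is, and stationarity of
  \<open>f\<close> removes the dependence on \<open>n\<close>.\<close>

lemma rel_entropy_increment:
  assumes f: "stationary f" and g: "stationary g" and pos: "\<And>I. g I > 0"
    and c: "c > 0" "\<And>I J. g I * g J \<le> c * g (I @ J)" and J: "length J = m"
  shows "g J / (2 * c) - f J \<le> rel_entropy f g (n + m) - rel_entropy f g n"
proof -
  define y where "y I K = f I * g (I @ K) / g I" for I K
  have y0: "0 \<le> y I K" for I K
    using stationary_nonneg[OF f] pos[of I] pos[of "I @ K"] by (simp add: y_def less_imp_le)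
  have fI: "f (I @ K) = 0" if "f I = 0" for I K
    using stationary_append_le[OF f, of I K] stationary_nonneg[OF f, of "I @ K"] that by simp
  have y_eq_0: "f (I @ K) = 0" if "y I K = 0" for I K
    using that pos[of I] pos[of "I @ K"] fI by (auto simp: y_def)
  have sum_y: "(\<Sum>K\<in>words m. y I K) = f I" for I
    using pos[of I] stationary_sum_right[OF g, of I m]
    by (simp add: y_def sum_distrib_left[symmetric] sum_divide_distrib[symmetric])
  have split: "f (I @ K) * ln (f (I @ K) / y I K)
      = f (I @ K) * ln (f (I @ K) / g (I @ K)) - f (I @ K) * ln (f I / g I)" for I K
  proof (cases "f (I @ K) = 0")
    case False
    then have "f (I @ K) > 0" "f I > 0"
      using stationary_nonneg[OF f, of "I @ K"] stationary_nonneg[OF f, of I] fI[of I K] by (auto simp: order_less_le)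
    then have "ln (f (I @ K) / y I K) = ln (f (I @ K) / g (I @ K)) - ln (f I / g I)"
      using pos[of I] pos[of "I @ K"] by (simp add: y_def ln_div ln_mult)
    then show ?thesis by (simp add: right_diff_distrib)
  qed simp
  have "rel_entropy f g n = (\<Sum>I\<in>words n. (\<Sum>K\<in>words m. f (I @ K)) * ln (f I / g I))"
    by (simp add: rel_entropy_def stationary_sum_right[OF f])
  then have "rel_entropy f g (n + m) - rel_entropy f g n
      = (\<Sum>I\<in>words n. \<Sum>K\<in>words m. f (I @ K) * ln (f (I @ K) / y I K))"
    by (simp add: rel_entropy_def sum_words_add split sum_subtractf sum_distrib_right)
  \<comment> \<open>Adding \<open>y I K - f (I @ K)\<close> changes nothing in total, as both parts
    sum to \<open>f I\<close> over \<open>K\<close>. It makes every summand nonnegative, so all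
    blocks except \<open>J\<close> can be discarded.\<close>
  also have "\<dots> = (\<Sum>I\<in>words n. \<Sum>K\<in>words m. f (I @ K) * ln (f (I @ K) / y I K) - f (I @ K) + y I K)"
    by (simp add: sum.distrib sum_subtractf sum_y stationary_sum_right[OF f])
  also have "\<dots> \<ge> (\<Sum>I\<in>words n. f (I @ J) * ln (f (I @ J) / y I J) - f (I @ J) + y I J)"
  proof (rule sum_mono)
    fix I :: "'a list"
    have "0 \<le> f (I @ K) * ln (f (I @ K) / y I K) - f (I @ K) + y I K" for K
      using mult_ln_div_ge(1)[OF stationary_nonneg[OF f, of "I @ K"] y0[of I K] y_eq_0] by simp
    then show "f (I @ J) * ln (f (I @ J) / y I J) - f (I @ J) + y I J
        \<le> (\<Sum>K\<in>words m. f (I @ K) * ln (f (I @ K) / y I K) - f (I @ K) + y I K)"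
      using J by (intro member_le_sum) (auto simp: in_words_iff)
  qed
  also have "(\<Sum>I\<in>words n. f (I @ J) * ln (f (I @ J) / y I J) - f (I @ J) + y I J)
      \<ge> (\<Sum>I\<in>words n. y I J / 2 - f (I @ J))"
  proof (rule sum_mono)
    fix I :: "'a list"
    show "y I J / 2 - f (I @ J) \<le> f (I @ J) * ln (f (I @ J) / y I J) - f (I @ J) + y I J"
      using mult_ln_div_ge(2)[OF stationary_nonneg[OF f, of "I @ J"] y0[of I J] y_eq_0] by simp
  qed
  also have "(\<Sum>I\<in>words n. y I J / 2 - f (I @ J)) \<ge> (\<Sum>I\<in>words n. f I * (g J / (2 * c)) - f (I @ J))"
  proof (rule sum_mono)
    fix I :: "'a list"
    have "g J / c \<le> g (I @ J) / g I"
      using c(1) c(2)[of I J] pos[of I] by (simp add: field_simps)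
    then have "f I * (g J / c) \<le> f I * (g (I @ J) / g I)"
      by (intro mult_left_mono stationary_nonneg[OF f])
    then show "f I * (g J / (2 * c)) - f (I @ J) \<le> y I J / 2 - f (I @ J)"
      by (simp add: y_def)
  qed
  also have "(\<Sum>I\<in>words n. f I * (g J / (2 * c)) - f (I @ J)) = g J / (2 * c) - f J"
  proof -
    have "(\<Sum>I\<in>words n. f I * (g J / (2 * c))) = g J / (2 * c)"
      by (simp only: sum_distrib_right[symmetric] stationary_sum_words[OF f] mult_1)
    then show ?thesis
      by (simp only: sum_subtractf stationary_sum_left[OF f])
  qed
  finally show ?thesis by simp
qed

text \<open>Along multiples of \<open>length J\<close> the increments add up. A positive value of
  \<open>g J / (2 * c) - f J\<close> would make the relative entropy grow linearly.\<close>

lemma zero_rate_lower_bound: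
  assumes f: "stationary f" and g: "stationary g" and pos: "\<And>I. g I > 0"
    and c: "c \<ge> 1" "\<And>I J. g I * g J \<le> c * g (I @ J)"
    and lim: "(\<lambda>n. rel_entropy f g n / real n) \<longlonglongrightarrow> 0"
  shows "g J / (2 * c) \<le> f J"
proof (cases "J = []")
  case True
  then show ?thesis using f g c(1) by (simp add: stationary_def field_simps)
next
  case False
  define m where "m = length J"
  have m: "m > 0" using False by (simp add: m_def)
  define d where "d = g J / (2 * c) - f J"
  have inc: "real k * d \<le> rel_entropy f g (k * m)" for k
  proof (induction k)
    case (Suc k)
    have "d \<le> rel_entropy f g (k * m + m) - rel_entropy f g (k * m)"
      unfolding d_def using c(1) by (intro rel_entropy_increment f g pos c(2)) (auto simp: m_def)
    then show ?case using Suc by (simp add: algebra_simps)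
  qed (simp add: rel_entropy_0 f g)
  have "d / real m \<le> rel_entropy f g (Suc k * m) / real (Suc k * m)" for k
  proof -
    have "d / real m = real (Suc k) * d / real (Suc k * m)"
      using m by (simp del: of_nat_Suc mult_Suc)
    also have "\<dots> \<le> rel_entropy f g (Suc k * m) / real (Suc k * m)"
      by (intro divide_right_mono inc) simp
    finally show ?thesis .
  qed
  moreover have "(\<lambda>k. rel_entropy f g (Suc k * m) / real (Suc k * m)) \<longlonglongrightarrow> 0"
    by (rule LIMSEQ_subseq_LIMSEQ[OF lim, of "\<lambda>k. Suc k * m", unfolded comp_def])
      (use m in \<open>auto simp: strict_mono_def\<close>)
  ultimately have "d / real m \<le> 0"
    by (intro LIMSEQ_le_const) auto
  then show ?thesis
    using m by (simp add: d_def divide_le_0_iff)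
qed

text \<open>Two stationary weights with vanishing relative entropy rate coincide: split off the largest
  multiple \<open>t g\<close> below \<open>f\<close>; the normalised remainder still has vanishing rate, so it
  dominates a multiple of \<open>g\<close> again unless \<open>t = 1\<close>.\<close>

lemma zero_rate_imp_eq:
  assumes f: "stationary f" and g: "stationary g" and pos: "\<And>I. g I > 0"
    and c: "c \<ge> 1" "\<And>I J. g I * g J \<le> c * g (I @ J)"
    and lim: "(\<lambda>n. rel_entropy f g n / real n) \<longlonglongrightarrow> 0"
  shows "f = g"
proof -
  define t where "t = (INF J. f J / g J)"
  have bdd: "bdd_below (range (\<lambda>J. f J / g J))"
    using stationary_nonneg[OF f] pos by (intro bdd_belowI[of _ 0]) (auto intro!: divide_nonneg_pos)
  have tf: "t * g J \<le> f J" for J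
  proof -
    have "t \<le> f J / g J"
      unfolding t_def by (rule cINF_lower[OF bdd]) simp
    then show ?thesis using pos[of J] by (simp add: field_simps)
  qed
  have t_ge: "s \<le> t" if "\<And>J. s * g J \<le> f J" for s
    unfolding t_def using that pos by (intro cINF_greatest) (auto simp: field_simps)
  have "1 / (2 * c) \<le> t"
    using zero_rate_lower_bound[OF f g pos c lim] by (intro t_ge) simp
  then have t0: "t > 0" using c(1) by (smt (verit) divide_pos_pos)
  have "t \<ge> 1"
  proof (rule ccontr)
    assume "\<not> t \<ge> 1"
    then have t1: "t < 1" by simp
    define h where "h J = (f J - t * g J) / (1 - t)" for J
    have h: "stationary h"
      using f g t1 tf unfolding stationary_def h_def
      by (auto simp: sum_divide_distrib[symmetric] sum_subtractf sum_distrib_left[symmetric])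
    have up: "rel_entropy h g n \<le> (rel_entropy f g n - t * ln t) / (1 - t) - ln (1 - t)" for n
    proof -
      \<comment> \<open>The logarithm of \<open>h J\<close> is bounded using
        \<open>h \<le> f / (1 - t)\<close>. The subtracted part satisfies
        \<open>t * g J * ln (f J / g J) \<ge> t * g J * ln t\<close> because
        \<open>f \<ge> t * g\<close>. After summation the excess over
        \<open>rel_entropy f g n / (1 - t)\<close> does not depend on \<open>n\<close>.\<close>
      have *: "h J * ln (h J / g J) \<le> (f J * ln (f J / g J) - t * (g J * ln t)) / (1 - t) - h J * ln (1 - t)" for J
      proof -
        have fJ: "f J > 0" using tf[of J] t0 pos[of J] by (smt (verit) mult_pos_pos)
        have 1: "h J * ln (h J / g J) \<le> h J * ln (f J / g J) - h J * ln (1 - t)"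
        proof (cases "h J = 0")
          case False
          then have hJ: "h J > 0" using stationary_nonneg[OF h, of J] by simp
          have "h J \<le> f J / (1 - t)"
            unfolding h_def using t0 t1 pos[of J] by (intro divide_right_mono) auto
          then have "ln (h J) \<le> ln (f J / (1 - t))"
            using hJ by simp
          then have "ln (h J / g J) \<le> ln (f J / g J) - ln (1 - t)"
            using hJ fJ t1 pos[of J] by (simp add: ln_div)
          then have "h J * ln (h J / g J) \<le> h J * (ln (f J / g J) - ln (1 - t))"
            using hJ by (intro mult_left_mono) auto
          then show ?thesis by (simp add: right_diff_distrib)
        qed simp
        have "t \<le> f J / g J" using tf[of J] pos[of J] by (simp add: field_simps)
        then have "ln t \<le> ln (f J / g J)" using t0 by simp
        then have "t * (g J * ln t) \<le> t * (g J * ln (f J / g J))"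
          using t0 pos[of J] by (intro mult_left_mono) auto
        then have "(f J * ln (f J / g J) - t * (g J * ln (f J / g J))) / (1 - t)
            \<le> (f J * ln (f J / g J) - t * (g J * ln t)) / (1 - t)"
          using t1 by (intro divide_right_mono) auto
        moreover have "h J * ln (f J / g J) = (f J * ln (f J / g J) - t * (g J * ln (f J / g J))) / (1 - t)"
          by (simp add: h_def left_diff_distrib)
        ultimately show ?thesis using 1 by linarith
      qed
      have "rel_entropy h g n
          \<le> (\<Sum>J\<in>words n. (f J * ln (f J / g J) - t * (g J * ln t)) / (1 - t) - h J * ln (1 - t))"
        unfolding rel_entropy_def by (intro sum_mono *)
      also have "\<dots> = (rel_entropy f g n - t * (sum g (words n) * ln t)) / (1 - t) - sum h (words n) * ln (1 - t)"
        by (simp add: rel_entropy_def sum_subtractf sum_divide_distrib[symmetric] sum_distrib_left[symmetric]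
            sum_distrib_right[symmetric])
      also have "\<dots> = (rel_entropy f g n - t * ln t) / (1 - t) - ln (1 - t)"
        by (simp add: stationary_sum_words g h)
      finally show ?thesis .
    qed
    have h_rate: "(\<lambda>n. rel_entropy h g n / real n) \<longlonglongrightarrow> 0"
    proof (rule tendsto_sandwich[OF _ _ tendsto_const])
      show "eventually (\<lambda>n. 0 \<le> rel_entropy h g n / real n) sequentially"
        using rel_entropy_nonneg[OF h g pos] by simp
      show "eventually (\<lambda>n. rel_entropy h g n / real n
          \<le> rel_entropy f g n / real n * (1 / (1 - t)) + (- t * ln t / (1 - t) - ln (1 - t)) / real n) sequentially"
      proof (intro always_eventually allI)
        fix n
        have "rel_entropy h g n / real n \<le> ((rel_entropy f g n - t * ln t) / (1 - t) - ln (1 - t)) / real n"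
          by (intro divide_right_mono up) simp
        also have "\<dots> = rel_entropy f g n / real n * (1 / (1 - t)) + (- t * ln t / (1 - t) - ln (1 - t)) / real n"
          by (simp add: add_divide_distrib diff_divide_distrib)
        finally show "rel_entropy h g n / real n
          \<le> rel_entropy f g n / real n * (1 / (1 - t)) + (- t * ln t / (1 - t) - ln (1 - t)) / real n" .
      qed
      have "(\<lambda>n. rel_entropy f g n / real n * (1 / (1 - t)) + (- t * ln t / (1 - t) - ln (1 - t)) / real n)
          \<longlonglongrightarrow> 0 * (1 / (1 - t)) + 0"
        by (intro tendsto_add tendsto_mult lim tendsto_const lim_const_over_n)
      then show "(\<lambda>n. rel_entropy f g n / real n * (1 / (1 - t)) + (- t * ln t / (1 - t) - ln (1 - t)) / real n)
          \<longlonglongrightarrow> 0" by simp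
    qed
    have "(t + (1 - t) / (2 * c)) * g J \<le> f J" for J
    proof -
      have "(1 - t) * (g J / (2 * c)) \<le> (1 - t) * h J"
        using zero_rate_lower_bound[OF h g pos c h_rate] t1 by (intro mult_left_mono) auto
      also have "(1 - t) * h J = f J - t * g J"
        using t1 by (simp add: h_def)
      finally show ?thesis
        by (simp add: distrib_right)
    qed
    then have "t + (1 - t) / (2 * c) \<le> t" by (rule t_ge)
    moreover have "(1 - t) / (2 * c) > 0" using t1 c(1) by simp
    ultimately show False by simp
  qed
  have ge: "g J \<le> f J" for J
  proof -
    have "1 * g J \<le> t * g J"
      using \<open>t \<ge> 1\<close> pos[of J] by (intro mult_right_mono) auto
    then show ?thesis using tf[of J] by linarith
  qed
  show "f = g"
  proof
    fix J :: "'a list"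
    have "(\<Sum>I\<in>words (length J). f I - g I) = 0"
      by (simp add: sum_subtractf stationary_sum_words f g)
    then have "\<forall>I\<in>words (length J). f I - g I = 0"
      using ge by (subst (asm) sum_nonneg_eq_0_iff) auto
    then show "f J = g J" by (simp add: words_def)
  qed
qed

subsection \<open>Gibbs weights and Gibbs measures\<close>

text \<open>By Ionescu-Tulcea with transition probabilities \<open>f (I @ [x]) / f I\<close>, which
  positivity makes well defined; their products along a word telescope to \<open>f\<close>.\<close>

lemma weight_extension:
  fixes f :: "'a::{finite,discrete_topology} list \<Rightarrow> real"
  assumes f: "stationary f" and pos: "\<And>I. f I > 0"
  obtains \<mu> where "\<mu> \<in> borel_prob_measures" "\<And>I. measure \<mu> (cylinder I) = f I"
proof -
  define M :: "nat \<Rightarrow> 'a measure" where "M = (\<lambda>_. count_space UNIV)"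
  define P :: "nat \<Rightarrow> (nat \<Rightarrow> 'a) \<Rightarrow> 'a measure" where
    "P i \<omega> = density (count_space UNIV) (\<lambda>x. ennreal (f (initial_word i \<omega> @ [x]) / f (initial_word i \<omega>)))" for i \<omega>
  have PiM_eq: "PiM {0..<n} M = count_space (Pi\<^sub>E {0..<n} (\<lambda>_. UNIV))" for n
    unfolding M_def by (intro count_space_PiM_finite) auto
  have prob_P: "prob_space (P i \<omega>)" for i \<omega>
  proof
    have "emeasure (P i \<omega>) (space (P i \<omega>)) = (\<integral>\<^sup>+x. ennreal (f (initial_word i \<omega> @ [x]) / f (initial_word i \<omega>)) \<partial>count_space UNIV)"
      by (simp add: P_def emeasure_density)
    also have "\<dots> = (\<Sum>x\<in>UNIV. ennreal (f (initial_word i \<omega> @ [x]) / f (initial_word i \<omega>)))"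
      by (simp add: nn_integral_count_space_finite)
    also have "\<dots> = ennreal (\<Sum>x\<in>UNIV. f (initial_word i \<omega> @ [x]) / f (initial_word i \<omega>))"
      using pos by (intro sum_ennreal) (simp add: less_imp_le)
    also have "(\<Sum>x\<in>UNIV. f (initial_word i \<omega> @ [x]) / f (initial_word i \<omega>)) = 1"
      using f pos[of "initial_word i \<omega>"] by (simp add: sum_divide_distrib[symmetric] stationary_def)
    finally show "emeasure (P i \<omega>) (space (P i \<omega>)) = 1" by simp
  qed
  interpret Ionescu_Tulcea P M
  proof (rule Ionescu_Tulcea.intro)
    show "P i \<in> measurable (PiM {0..<i} M) (subprob_algebra (M i))" for i
      unfolding PiM_eq
      by (auto simp: space_subprob_algebra M_def P_def[of i] prob_space_imp_subprob_space[OF prob_P[unfolded P_def]])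
  qed (rule prob_P)
  \<comment> \<open>\<open>restrict\<close> returns \<open>undefined\<close> from \<open>n\<close>
    on, so \<open>r \<omega> n\<close> is the point of the finite product that represents the first
    \<open>n\<close> letters of \<open>\<omega>\<close>.\<close>
  define r where "r \<omega> n = restrict \<omega> {0..<n}" for \<omega> :: "nat \<Rightarrow> 'a" and n
  have r_space: "r \<omega> n \<in> space (PiM {0..<n} M)" for \<omega> n
    by (simp add: r_def M_def space_PiM)
  have r_sets: "{r \<omega> n} \<in> sets (PiM {0..<n} M)" for \<omega> n
    unfolding PiM_eq by (simp add: r_def)
  have r_word: "initial_word n (r \<omega> n) = initial_word n \<omega>" for \<omega> n
    by (simp add: initial_word_def r_def)
  have C: "emeasure (C 0 n (\<lambda>_. undefined)) {r \<omega> n} = ennreal (f (initial_word n \<omega>))" for \<omega> n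
  proof (induction n)
    case 0
    have "r \<omega> 0 = (\<lambda>_. undefined)" by (simp add: r_def restrict_def fun_eq_iff)
    then show ?case using f r_space[of \<omega> 0] r_sets[of \<omega> 0]
      by (simp add: initial_word_def stationary_def)
  next
    case (Suc n)
    let ?K = "C 0 n (\<lambda>_. undefined)"
    let ?q = "f (initial_word (Suc n) \<omega>) / f (initial_word n \<omega>)"
    have undef: "(\<lambda>_. undefined) \<in> space (PiM {0..<0} M)"
      by (simp add: space_PiM)
    have eP: "emeasure (eP n x) {r \<omega> (Suc n)} = ennreal ?q * indicator {r \<omega> n} x"
      if x: "x \<in> space (PiM {0..<n} M)" for x
    proof -
      have ext: "x \<in> extensional {0..<n}"
        using x by (auto simp: space_PiM PiE_def)
      have "emeasure (eP n x) {r \<omega> (Suc n)} = P n x ((\<lambda>y. x(n := y)) -` {r \<omega> (Suc n)} \<inter> space (M n))"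
        by (rule emeasure_eP[OF x r_sets])
      also have "(\<lambda>y. x(n := y)) -` {r \<omega> (Suc n)} \<inter> space (M n) = (if x = r \<omega> n then {\<omega> n} else {})"
      proof -
        have "x(n := y) = r \<omega> (Suc n) \<longleftrightarrow> x = r \<omega> n \<and> y = \<omega> n" for y
        proof
          assume eq: "x(n := y) = r \<omega> (Suc n)"
          have "x i = r \<omega> n i" for i
            using fun_cong[OF eq, of i] ext by (cases "i < n") (auto simp: r_def extensional_def)
          moreover have "y = \<omega> n" using fun_cong[OF eq, of n] by (simp add: r_def)
          ultimately show "x = r \<omega> n \<and> y = \<omega> n" by blast
        next
          assume "x = r \<omega> n \<and> y = \<omega> n"
          then show "x(n := y) = r \<omega> (Suc n)" by (auto simp: r_def)
        qed
        then show ?thesis by (auto simp: M_def)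
      qed
      also have "emeasure (P n x) \<dots> = ennreal ?q * indicator {r \<omega> n} x"
      proof (cases "x = r \<omega> n")
        case True
        have "initial_word (Suc n) \<omega> = initial_word n \<omega> @ [\<omega> n]"
          by (simp add: initial_word_def)
        then show ?thesis
          using True by (simp add: P_def r_word emeasure_density nn_integral_count_space_indicator[symmetric]
              nn_integral_indicator_singleton)
      qed simp
      finally show ?thesis .
    qed
    have "emeasure (C 0 (Suc n) (\<lambda>_. undefined)) {r \<omega> (Suc n)} = (\<integral>\<^sup>+x. emeasure (eP n x) {r \<omega> (Suc n)} \<partial>?K)"
    proof -
      have "eP n \<in> ?K \<rightarrow>\<^sub>M subprob_algebra (PiM {0..<Suc n} M)"
        unfolding measurable_cong_sets[OF sets_C[OF undef, of n] refl] using measurable_eP[of n] by simp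
      moreover have "space ?K \<noteq> {}"
        using space_C[OF undef, of n] r_space[of \<omega> n] by auto
      ultimately show ?thesis
        using emeasure_bind[OF _ _ r_sets[of \<omega> "Suc n"]] by simp
    qed
    also have "\<dots> = (\<integral>\<^sup>+x. ennreal ?q * indicator {r \<omega> n} x \<partial>?K)"
      using space_C[OF undef, of n] by (intro nn_integral_cong eP) simp
    also have "\<dots> = ennreal ?q * emeasure ?K {r \<omega> n}"
      using r_sets[of \<omega> n] sets_C[OF undef, of n] by (subst nn_integral_cmult_indicator) auto
    also have "\<dots> = ennreal (?q * f (initial_word n \<omega>))"
      unfolding Suc using pos by (intro ennreal_mult[symmetric] divide_nonneg_pos) (auto simp: less_imp_le)
    also have "?q * f (initial_word n \<omega>) = f (initial_word (Suc n) \<omega>)"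
      using pos[of "initial_word n \<omega>"] by simp
    finally show ?case .
  qed
  have r_eq_iff: "r x n = r y n \<longleftrightarrow> (\<forall>i<n. x i = y i)" for x y n
  proof (intro iffI allI impI)
    fix i assume eq: "r x n = r y n" and "i < n"
    have "r x n i = r y n i" by (simp only: eq)
    then show "x i = y i"
      using \<open>i < n\<close> by (simp add: r_def)
  qed (auto simp: r_def restrict_def fun_eq_iff)
  have cyl: "cylinder I = PF.emb UNIV {0..<length I} {r (\<lambda>i. I ! i) (length I)}" for I :: "'a list"
    by (auto simp: prod_emb_def M_def cylinder_def space_PiM r_def[symmetric] r_eq_iff)
  have lim_cyl: "emeasure PF.lim (cylinder I) = ennreal (f I)" for I :: "'a list"
  proof -
    have "emeasure PF.lim (cylinder I) = emeasure (CI {0..<length I}) {r (\<lambda>i. I ! i) (length I)}"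
      unfolding cyl by (intro lim r_sets) simp
    also have "\<dots> = emeasure (C 0 (length I) (\<lambda>_. undefined)) {r (\<lambda>i. I ! i) (length I)}"
    proof -
      have "{r ((!) I) (length I)} \<subseteq> Pi\<^sub>E {0..<length I} (\<lambda>i. space (M i))"
        using r_space[of "(!) I" "length I"] by (simp add: space_PiM)
      then show ?thesis
        by (subst emeasure_CI[OF _ r_sets]) (auto simp: prod_emb_id)
    qed
    also have "\<dots> = ennreal (f (initial_word (length I) (\<lambda>i. I ! i)))"
      by (rule C)
    also have "initial_word (length I) (\<lambda>i. I ! i) = I"
      by (simp add: initial_word_def map_nth)
    finally show ?thesis .
  qed
  have space_lim: "space (PiM UNIV M) = UNIV"
    unfolding space_PiM by (simp add: M_def)
  have "cylinder I \<in> sets PF.lim" for I :: "'a list"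
    unfolding cyl PF.sets_lim by (intro measurable_prod_emb r_sets subset_UNIV)
  \<comment> \<open>The projective limit carries the product sigma-algebra of the letters; the
    identity transports its measure to \<open>borel\<close>.\<close>
  then have id: "(\<lambda>x. x) \<in> PF.lim \<rightarrow>\<^sub>M borel"
    by (intro measurable_borel_cylinders) (simp add: space_lim)
  have "prob_space PF.lim"
    by (rule prob_spaceI) (use lim_cyl[of "[]"] f in \<open>simp add: space_lim stationary_def\<close>)
  then have "distr PF.lim borel (\<lambda>x. x) \<in> borel_prob_measures"
    using id by (simp add: borel_prob_measures_def prob_space.prob_space_distr)
  moreover have "measure (distr PF.lim borel (\<lambda>x. x)) (cylinder I) = f I" for I :: "'a list"
    using id pos[of I] lim_cyl[of I]
    by (simp add: emeasure_distr space_lim measure_def less_imp_le)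
  ultimately show ?thesis using that by blast
qed

lemma sum_words_Suc_right:
  fixes F :: "'a::finite list \<Rightarrow> real"
  shows "(\<Sum>K\<in>words n. \<Sum>x\<in>UNIV. F (K @ [x])) = sum F (words (Suc n))"
  using sum_words_add[of F n 1] by (simp add: sum_words_1)

lemma sum_words_Suc_left:
  fixes F :: "'a::finite list \<Rightarrow> real"
  shows "(\<Sum>x\<in>UNIV. \<Sum>L\<in>words n. F (x # L)) = sum F (words (Suc n))"
  using sum_words_add[of F 1 n] by (simp add: sum_words_1)

text \<open>By Tychonoff the box of admissible functions is compact. The countable index set makes
  the product metrizable, so sequences in the box have convergent subsequences; this takes the place
  of a diagonal argument.\<close>

lemma bounded_pointwise_subsequence:
  fixes h :: "nat \<Rightarrow> 'i::countable \<Rightarrow> real"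
  assumes "\<And>N I. 0 \<le> h N I" "\<And>N I. h N I \<le> B I"
  obtains f r where "strict_mono r" "\<And>I. (\<lambda>k. h (r k) I) \<longlonglongrightarrow> f I"
proof -
  let ?K = "Pi\<^sub>E UNIV (\<lambda>I. {0..B I}) :: ('i \<Rightarrow> real) set"
  have "compactin (product_topology (\<lambda>_::'i. euclidean :: real topology) UNIV) ?K"
    by (subst compactin_PiE) simp
  then have "compact ?K"
    by (simp add: euclidean_product_topology)
  then have "seq_compact ?K"
    by (rule compact_imp_seq_compact)
  moreover have "\<forall>N. h N \<in> ?K"
    using assms by auto
  ultimately obtain f r where fr: "strict_mono r" "(h \<circ> r) \<longlonglongrightarrow> f"
    unfolding seq_compact_def by blast
  have "(\<lambda>k. h (r k) I) \<longlonglongrightarrow> f I" for I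
    using continuous_on_tendsto_compose[OF continuous_on_product_coordinates[of I] fr(2)]
    by (simp add: comp_def)
  with fr(1) that show ?thesis by blast
qed

text \<open>The weight \<open>f I\<close> is a limit of the normalised \<open>w\<close>-mass of long words containing
  \<open>I\<close> at position \<open>i\<close>, averaged over \<open>i < N\<close>; prepending a letter moves the position
  by one, which changes the average by \<open>O(1 / N)\<close>.\<close>

lemma gibbs_weight_exists:
  fixes w :: "'a::finite list \<Rightarrow> real"
  assumes pos: "\<And>I. w I > 0" and w0: "w [] = 1" and c: "c \<ge> 1"
    and up: "\<And>I J. w (I @ J) \<le> c * (w I * w J)" and low: "\<And>I J. w I * w J \<le> c * w (I @ J)"
  obtains f Q C where "stationary f" "C \<ge> 1"
    "\<And>I. f I \<le> C * (w I * exp (- real (length I) * Q))"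
    "\<And>I. w I * exp (- real (length I) * Q) \<le> C * f I"
proof -
  define Z where "Z n = sum w (words n)" for n
  have words_ne: "words n \<noteq> ({} :: 'a list set)" for n
    by (metis empty_iff initial_word_in_words)
  have Zpos: "Z n > 0" for n
    unfolding Z_def using pos words_ne by (intro sum_pos) auto
  have Z_up: "Z (n + m) \<le> c * (Z n * Z m)" for n m
  proof -
    have "Z (n + m) \<le> (\<Sum>I\<in>words n. \<Sum>J\<in>words m. c * (w I * w J))"
      unfolding Z_def sum_words_add by (intro sum_mono up)
    also have "\<dots> = c * (Z n * Z m)"
      unfolding Z_def sum_product by (simp only: sum_distrib_left)
    finally show ?thesis .
  qed
  have Z_low: "Z n * Z m \<le> c * Z (n + m)" for n m
  proof -
    have "Z n * Z m = (\<Sum>I\<in>words n. \<Sum>J\<in>words m. w I * w J)"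
      by (simp add: Z_def sum_product)
    also have "\<dots> \<le> (\<Sum>I\<in>words n. \<Sum>J\<in>words m. c * w (I @ J))"
      by (intro sum_mono low)
    also have "\<dots> = c * Z (n + m)"
      by (simp add: Z_def sum_words_add sum_distrib_left)
    finally show ?thesis .
  qed
  have "\<bar>ln (Z (n + m)) - ln (Z n) - ln (Z m)\<bar> \<le> ln c" for n m
  proof -
    have "ln (Z (n + m)) \<le> ln (c * (Z n * Z m))"
      using Z_up[of n m] Zpos[of "n + m"] by simp
    moreover have "ln (Z n * Z m) \<le> ln (c * Z (n + m))"
      using Z_low[of n m] Zpos[of n] Zpos[of m] Zpos[of "n + m"] c by (subst ln_le_cancel_iff) auto
    ultimately show ?thesis
      using Zpos[of n] Zpos[of m] Zpos[of "n + m"] c by (simp add: ln_mult abs_le_iff)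
  qed
  then obtain Q where Q: "\<And>n. n \<ge> 1 \<Longrightarrow> \<bar>ln (Z n) - real n * Q\<bar> \<le> ln c"
    using almost_additive_sequence[of "\<lambda>n. ln (Z n)" "ln c"] by metis
  \<comment> \<open>The case \<open>n = 0\<close> occurs when nothing precedes or follows
    \<open>I\<close>. It rests on \<open>w [] = 1\<close>.\<close>
  have Q0: "\<bar>ln (Z n) - real n * Q\<bar> \<le> ln c" for n
    using Q[of n] c by (cases n) (simp_all add: Z_def w0)
  have Z_exp: "Z n \<le> c * exp (real n * Q)" "exp (real n * Q) \<le> c * Z n" for n
  proof -
    have "ln (Z n) \<le> ln c + real n * Q" using Q0[of n] by linarith
    then have "exp (ln (Z n)) \<le> exp (ln c + real n * Q)" by simp
    then show "Z n \<le> c * exp (real n * Q)" using Zpos[of n] c by (simp add: exp_add)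
    have "real n * Q \<le> ln c + ln (Z n)" using Q0[of n] by linarith
    then have "exp (real n * Q) \<le> exp (ln c + ln (Z n))" by simp
    then show "exp (real n * Q) \<le> c * Z n" using Zpos[of n] c by (simp add: exp_add)
  qed
  \<comment> \<open>With \<open>2 * N\<close> letters there is room for \<open>I\<close> at every
    position up to \<open>N\<close> as soon as \<open>length I \<le> N\<close>. For words that are
    too long the subtraction truncates; \<open>h\<close> below is set to 0 whenever
    \<open>length I \<ge> N\<close>.\<close>
  define G where "G N i I = (\<Sum>K\<in>words i. \<Sum>L\<in>words (2 * N - i - length I). w (K @ I @ L)) / Z (2 * N)" for N i I
  define E where "E I = w I * exp (- real (length I) * Q)" for I
  have E0: "E I > 0" for I using pos by (simp add: E_def)
  have ww: "w (K @ I @ L) \<le> c ^ 2 * (w K * w I * w L)" "w K * w I * w L \<le> c ^ 2 * w (K @ I @ L)" for K I L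
  proof -
    have "w (K @ I @ L) \<le> c * (w K * w (I @ L))" by (rule up)
    also have "\<dots> \<le> c * (w K * (c * (w I * w L)))"
      using up pos c by (intro mult_left_mono) (auto simp: less_imp_le)
    finally show "w (K @ I @ L) \<le> c ^ 2 * (w K * w I * w L)"
      by (simp add: power2_eq_square mult_ac)
    have "w K * (w I * w L) \<le> w K * (c * w (I @ L))"
      using low pos by (intro mult_left_mono) (auto simp: less_imp_le)
    also have "\<dots> = c * (w K * w (I @ L))" by simp
    also have "\<dots> \<le> c * (c * w (K @ I @ L))"
      using low c by (intro mult_left_mono) auto
    finally show "w K * w I * w L \<le> c ^ 2 * w (K @ I @ L)"
      by (simp add: power2_eq_square mult_ac)
  qed
  \<comment> \<open>The five factors \<open>c\<close>: two for cutting \<open>K @ I @ L\<close> into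
    its parts, two for exchanging \<open>Z i\<close> and \<open>Z l\<close> with exponentials, one
    for the normalisation \<open>Z (2 * N)\<close>.\<close>
  have G_bounds: "G N i I \<le> c ^ 5 * E I" "E I \<le> c ^ 5 * G N i I" if "i + length I \<le> 2 * N" for N i I
  proof -
    define l where "l = 2 * N - i - length I"
    have N: "2 * N = i + length I + l" using that by (simp add: l_def)
    have prod: "(\<Sum>K\<in>words i. \<Sum>L\<in>words l. w K * w I * w L) = w I * (Z i * Z l)"
      unfolding Z_def sum_product by (simp add: sum_distrib_left mult_ac)
    have exps: "exp (real i * Q) * exp (real l * Q) = exp (- real (length I) * Q) * exp (real (2 * N) * Q)"
    proof -
      have "real (2 * N) = real i + real (length I) + real l"
        using arg_cong[OF N, of real] by (simp only: of_nat_add)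
      then show ?thesis
        by (simp only: exp_add[symmetric]) (simp add: algebra_simps)
    qed
    have "G N i I * Z (2 * N) \<le> (\<Sum>K\<in>words i. \<Sum>L\<in>words l. c ^ 2 * (w K * w I * w L))"
      unfolding G_def l_def[symmetric] using Zpos[of "2 * N"] by (auto intro!: sum_mono ww(1))
    also have "\<dots> = c ^ 2 * (w I * (Z i * Z l))"
      unfolding prod[symmetric] by (simp add: sum_distrib_left)
    also have "\<dots> \<le> c ^ 2 * (w I * ((c * exp (real i * Q)) * (c * exp (real l * Q))))"
      using Z_exp(1) Zpos pos c by (intro mult_left_mono mult_mono) (auto simp: less_imp_le)
    also have "\<dots> = c ^ 4 * (w I * (exp (real i * Q) * exp (real l * Q)))"
      by (simp add: power2_eq_square power4_eq_xxxx mult_ac)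
    also have "\<dots> = c ^ 4 * E I * exp (real (2 * N) * Q)"
      unfolding exps by (simp add: E_def mult_ac)
    also have "\<dots> \<le> c ^ 4 * E I * (c * Z (2 * N))"
      using E0 c by (intro mult_left_mono Z_exp(2)) (auto simp: less_imp_le)
    also have "\<dots> = c ^ 5 * E I * Z (2 * N)"
      by (simp add: eval_nat_numeral mult_ac)
    finally show "G N i I \<le> c ^ 5 * E I"
      using Zpos[of "2 * N"] by simp
    have "E I * Z (2 * N) \<le> E I * (c * exp (real (2 * N) * Q))"
      using E0 by (intro mult_left_mono Z_exp(1)) (auto simp: less_imp_le)
    also have "\<dots> = c * (w I * (exp (real i * Q) * exp (real l * Q)))"
      unfolding exps by (simp add: E_def mult_ac)
    also have "\<dots> \<le> c * (w I * ((c * Z i) * (c * Z l)))"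
      using Z_exp(2) Zpos pos c by (intro mult_left_mono mult_mono) (auto simp: less_imp_le)
    also have "\<dots> = c ^ 3 * (\<Sum>K\<in>words i. \<Sum>L\<in>words l. w K * w I * w L)"
      unfolding prod by (simp add: power3_eq_cube mult_ac)
    also have "\<dots> \<le> c ^ 3 * (\<Sum>K\<in>words i. \<Sum>L\<in>words l. c ^ 2 * w (K @ I @ L))"
      using c by (intro mult_left_mono sum_mono ww(2)) auto
    also have "\<dots> = c ^ 5 * (\<Sum>K\<in>words i. \<Sum>L\<in>words l. w (K @ I @ L))"
      by (simp add: sum_distrib_left[symmetric] power_add[symmetric] flip: mult.assoc)
    also have "\<dots> = c ^ 5 * G N i I * Z (2 * N)"
      using Zpos[of "2 * N"] by (simp add: G_def l_def)
    finally show "E I \<le> c ^ 5 * G N i I"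
      using Zpos[of "2 * N"] by simp
  qed
  have G0: "0 \<le> G N i I" for N i I
    unfolding G_def using pos Zpos by (intro divide_nonneg_pos sum_nonneg) (auto simp: less_imp_le)
  have G_right: "(\<Sum>x\<in>UNIV. G N i (I @ [x])) = G N i I" if "i + length I < 2 * N" for N i I
  proof -
    have "(\<Sum>x\<in>UNIV. \<Sum>K\<in>words i. \<Sum>L\<in>words (2 * N - i - length (I @ [x])). w (K @ (I @ [x]) @ L))
        = (\<Sum>K\<in>words i. \<Sum>x\<in>UNIV. \<Sum>L\<in>words (2 * N - i - Suc (length I)). w (K @ I @ (x # L)))"
      by (subst sum.swap) simp
    also have "\<dots> = (\<Sum>K\<in>words i. \<Sum>L\<in>words (Suc (2 * N - i - Suc (length I))). w (K @ I @ L))"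
      by (intro sum.cong refl sum_words_Suc_left)
    also have "Suc (2 * N - i - Suc (length I)) = 2 * N - i - length I"
      using that by simp
    finally show ?thesis
      by (simp add: G_def sum_divide_distrib[symmetric])
  qed
  have G_left: "(\<Sum>x\<in>UNIV. G N i (x # I)) = G N (Suc i) I" for N i I
  proof -
    have "(\<Sum>x\<in>UNIV. \<Sum>K\<in>words i. \<Sum>L\<in>words (2 * N - i - length (x # I)). w (K @ (x # I) @ L))
        = (\<Sum>K\<in>words i. \<Sum>x\<in>UNIV. \<Sum>L\<in>words (2 * N - Suc i - length I). w ((K @ [x]) @ I @ L))"
      by (subst sum.swap) simp
    also have "\<dots> = (\<Sum>K\<in>words (Suc i). \<Sum>L\<in>words (2 * N - Suc i - length I). w (K @ I @ L))"
      by (rule sum_words_Suc_right)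
    finally show ?thesis
      by (simp add: G_def sum_divide_distrib[symmetric])
  qed
  define h where "h N I = (if length I < N then (\<Sum>i<N. G N i I) / real N else 0)" for N I
  have h0: "0 \<le> h N I" for N I
    using G0 by (auto simp: h_def intro!: divide_nonneg_nonneg sum_nonneg)
  have h_up: "h N I \<le> c ^ 5 * E I" for N I
  proof (cases "length I < N")
    case True
    then have "(\<Sum>i<N. G N i I) \<le> (\<Sum>i<N. c ^ 5 * E I)"
      by (intro sum_mono G_bounds(1)) auto
    with True show ?thesis by (simp add: h_def field_simps)
  next
    case False
    then show ?thesis using c E0[of I] by (simp add: h_def)
  qed
  have h_low: "E I \<le> c ^ 5 * h N I" if "length I < N" for N I
  proof -
    have "(\<Sum>i<N. E I) \<le> (\<Sum>i<N. c ^ 5 * G N i I)"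
      using that by (intro sum_mono G_bounds(2)) auto
    then have "real N * E I \<le> c ^ 5 * (\<Sum>i<N. G N i I)"
      by (simp add: sum_distrib_left)
    with that show ?thesis by (simp add: h_def field_simps)
  qed
  obtain f r where r: "strict_mono r" and f: "\<And>I. (\<lambda>k. h (r k) I) \<longlonglongrightarrow> f I"
    using bounded_pointwise_subsequence[of h "\<lambda>I. c ^ 5 * E I", OF h0 h_up] by blast
  have r_ge: "eventually (\<lambda>k. n < r k) sequentially" for n
    using filterlim_subseq[OF r] unfolding filterlim_at_top
    by (auto dest: spec[of _ "Suc n"] simp: Suc_le_eq)
  have "stationary f"
    unfolding stationary_def
  proof (intro conjI allI)
    have "h N [] = 1" if "0 < N" for N
    proof -
      have "G N i [] = 1" if "i < N" for i
      proof -
        have "2 * N = i + (2 * N - i)" using that by simp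
        then have "Z (2 * N) = (\<Sum>K\<in>words i. \<Sum>L\<in>words (2 * N - i). w (K @ L))"
          unfolding Z_def by (metis sum_words_add)
        then show ?thesis
          using Zpos[of "2 * N"] by (simp add: G_def)
      qed
      then show ?thesis using that by (simp add: h_def)
    qed
    then have "eventually (\<lambda>k. h (r k) [] = 1) sequentially"
      using r_ge[of 0] by (auto elim: eventually_mono)
    then show "f [] = 1"
      using f[of "[]"] by (metis LIMSEQ_unique tendsto_eventually)
    show "0 \<le> f I" for I
      using f[of I] h0 by (intro LIMSEQ_le_const) auto
    show "(\<Sum>x\<in>UNIV. f (I @ [x])) = f I" for I
    proof -
      have "(\<Sum>x\<in>UNIV. h N (I @ [x])) = h N I" if "length I + 1 < N" for N
      proof -
        have "(\<Sum>x\<in>UNIV. \<Sum>i<N. G N i (I @ [x])) = (\<Sum>i<N. \<Sum>x\<in>UNIV. G N i (I @ [x]))"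
          by (rule sum.swap)
        also have "\<dots> = (\<Sum>i<N. G N i I)"
          using that by (intro sum.cong refl G_right) auto
        finally show ?thesis
          using that by (simp add: h_def sum_divide_distrib[symmetric])
      qed
      then have ev: "eventually (\<lambda>k. (\<Sum>x\<in>UNIV. h (r k) (I @ [x])) = h (r k) I) sequentially"
        using r_ge[of "length I + 1"] by (auto elim: eventually_mono)
      have "(\<lambda>k. \<Sum>x\<in>UNIV. h (r k) (I @ [x])) \<longlonglongrightarrow> (\<Sum>x\<in>UNIV. f (I @ [x]))"
        by (intro tendsto_sum f)
      then have "(\<lambda>k. h (r k) I) \<longlonglongrightarrow> (\<Sum>x\<in>UNIV. f (I @ [x]))"
        using tendsto_cong[OF ev] by simp
      then show ?thesis using f LIMSEQ_unique by blast
    qed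
    show "(\<Sum>x\<in>UNIV. f (x # I)) = f I" for I
    proof -
      have diff: "\<bar>(\<Sum>x\<in>UNIV. h N (x # I)) - h N I\<bar> \<le> c ^ 5 * E I / real N" if N: "length I + 1 < N" for N
      proof -
        have "(\<Sum>x\<in>UNIV. \<Sum>i<N. G N i (x # I)) = (\<Sum>i<N. \<Sum>x\<in>UNIV. G N i (x # I))"
          by (rule sum.swap)
        also have "\<dots> = (\<Sum>i<N. G N (Suc i) I)"
          by (simp add: G_left)
        finally have "(\<Sum>x\<in>UNIV. h N (x # I)) - h N I = ((\<Sum>i<N. G N (Suc i) I) - (\<Sum>i<N. G N i I)) / real N"
          using N by (simp add: h_def sum_divide_distrib[symmetric] diff_divide_distrib)
        \<comment> \<open>Only the two extreme positions survive the telescoping, and both still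
          obey \<open>G_bounds\<close>; this is why position \<open>N\<close> must fit into the
          \<open>2 * N\<close> letters.\<close>
        also have "(\<Sum>i<N. G N (Suc i) I) - (\<Sum>i<N. G N i I) = G N N I - G N 0 I"
          using sum_lessThan_telescope[of "\<lambda>i. G N i I" N] by (simp only: sum_subtractf)
        finally have eq: "(\<Sum>x\<in>UNIV. h N (x # I)) - h N I = (G N N I - G N 0 I) / real N" .
        have "\<bar>G N N I - G N 0 I\<bar> \<le> c ^ 5 * E I"
          using G_bounds(1)[of N I N] G_bounds(1)[of 0 I N] G0[of N N I] G0[of N 0 I] N by auto
        then show ?thesis
          unfolding eq using N by (simp add: divide_right_mono)
      qed
      have "(\<lambda>k. (\<Sum>x\<in>UNIV. h (r k) (x # I)) - h (r k) I) \<longlonglongrightarrow> 0"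
      proof (rule Lim_null_comparison)
        show "eventually (\<lambda>k. norm ((\<Sum>x\<in>UNIV. h (r k) (x # I)) - h (r k) I) \<le> c ^ 5 * E I / real (r k)) sequentially"
          using r_ge[of "length I + 1"] by (rule eventually_mono) (use diff in simp)
        show "(\<lambda>k. c ^ 5 * E I / real (r k)) \<longlonglongrightarrow> 0"
          using LIMSEQ_subseq_LIMSEQ[OF lim_const_over_n r, of "c ^ 5 * E I"] by (simp add: comp_def)
      qed
      moreover have "(\<lambda>k. (\<Sum>x\<in>UNIV. h (r k) (x # I)) - h (r k) I) \<longlonglongrightarrow> (\<Sum>x\<in>UNIV. f (x # I)) - f I"
        by (intro tendsto_diff tendsto_sum f)
      ultimately show ?thesis using LIMSEQ_unique by force
    qed
  qed
  moreover have "f I \<le> c ^ 5 * E I" for I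
    using f[of I] h_up by (intro LIMSEQ_le_const2) auto
  moreover have "E I \<le> c ^ 5 * f I" for I
  proof (rule tendsto_lowerbound[of "\<lambda>k. c ^ 5 * h (r k) I" _ sequentially])
    show "eventually (\<lambda>k. E I \<le> c ^ 5 * h (r k) I) sequentially"
      using r_ge[of "length I"] by (rule eventually_mono) (rule h_low)
  qed (auto intro!: tendsto_mult f)
  moreover have "c ^ 5 \<ge> 1" using c by simp
  ultimately show ?thesis
    using that unfolding E_def by blast
qed

subsection \<open>Factor maps and potentials\<close>

definition fiber :: "('a \<Rightarrow> 'd) \<Rightarrow> 'd list \<Rightarrow> 'a list set" where
  "fiber p J = {I. length I = length J \<and> map p I = J}"

lemma fiber_subset_words: "fiber p J \<subseteq> words (length J)"
  by (auto simp: fiber_def words_def)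

lemma fiber_length: "I \<in> fiber p J \<Longrightarrow> length I = length J"
  by (simp add: fiber_def)

lemma finite_fiber [simp, intro]: "finite (fiber p J :: 'a::finite list set)"
  by (rule finite_subset[OF fiber_subset_words finite_words])

lemma fiber_nonempty: "surj p \<Longrightarrow> fiber p J \<noteq> {}"
proof -
  assume "surj p"
  then have "map (inv p) J \<in> fiber p J"
    by (simp add: fiber_def comp_def surj_f_inv_f)
  then show ?thesis by blast
qed

lemma fiber_Nil [simp]: "fiber p [] = {[]}"
  by (auto simp: fiber_def)

lemma sum_fiber_append:
  fixes u :: "'a::finite list \<Rightarrow> real"
  shows "sum u (fiber p (J @ J')) = (\<Sum>I\<in>fiber p J. \<Sum>I'\<in>fiber p J'. u (I @ I'))"
proof -
  have "bij_betw (\<lambda>(I, I'). I @ I') (fiber p J \<times> fiber p J') (fiber p (J @ J'))"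
    by (rule bij_betwI[where g = "\<lambda>K. (take (length J) K, drop (length J) K)"])
      (auto simp: fiber_def take_map[symmetric] drop_map[symmetric])
  then have "sum u (fiber p (J @ J')) = (\<Sum>v\<in>fiber p J \<times> fiber p J'. u (case v of (I, I') \<Rightarrow> I @ I'))"
    by (rule sum.reindex_bij_betw[symmetric])
  then show ?thesis
    by (simp add: sum.cartesian_product case_prod_unfold)
qed

lemma sum_words_fibers:
  fixes F :: "'a::finite list \<Rightarrow> real" and p :: "'a \<Rightarrow> 'd::finite"
  shows "(\<Sum>J\<in>words n. \<Sum>I\<in>fiber p J. F I) = sum F (words n)"
proof -
  have "sum F (words n) = (\<Sum>J\<in>words n. sum F {I \<in> words n. map p I = J})"
    by (rule sum.group[symmetric]) (auto simp: in_words_iff)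
  also have "\<dots> = (\<Sum>J\<in>words n. \<Sum>I\<in>fiber p J. F I)"
    by (rule sum.cong[OF refl], rule sum.cong) (auto simp: fiber_def in_words_iff)
  finally show ?thesis by simp
qed

text \<open>By bounded distortion any point of a cylinder can stand for the supremum, so almost
  additivity at one point of \<open>cylinder (I @ J)\<close> carries over to words. Empty words are
  excluded since they would involve \<open>\<phi> 0\<close>.\<close>

lemma word_sup_quasi_multiplicative:
  fixes \<phi> :: "nat \<Rightarrow> (nat \<Rightarrow> 'a::{finite,discrete_topology}) \<Rightarrow> real"
  assumes aa: "almost_additive shift \<phi>" and bd: "bounded_distortion \<phi>"
  obtains C where "C \<ge> 1"
    "\<And>I. I \<noteq> [] \<Longrightarrow> word_sup \<phi> I > 0"
    "\<And>I x. I \<noteq> [] \<Longrightarrow> x \<in> cylinder I \<Longrightarrow> \<phi> (length I) x \<le> word_sup \<phi> I \<and> word_sup \<phi> I \<le> C * \<phi> (length I) x"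
    "\<And>I J. I \<noteq> [] \<Longrightarrow> J \<noteq> [] \<Longrightarrow> word_sup \<phi> (I @ J) \<le> C * (word_sup \<phi> I * word_sup \<phi> J)"
    "\<And>I J. I \<noteq> [] \<Longrightarrow> J \<noteq> [] \<Longrightarrow> word_sup \<phi> I * word_sup \<phi> J \<le> C * word_sup \<phi> (I @ J)"
proof -
  have pos: "\<phi> n x > 0" if "n \<ge> 1" for n x
    using aa that by (auto simp: almost_additive_def)
  obtain c where c: "c > 0" and add: "\<And>n m x. n \<ge> 1 \<Longrightarrow> m \<ge> 1 \<Longrightarrow>
      inverse c * \<phi> n x * \<phi> m ((shift ^^ n) x) \<le> \<phi> (n + m) x \<and>
      \<phi> (n + m) x \<le> c * \<phi> n x * \<phi> m ((shift ^^ n) x)"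
    using aa unfolding almost_additive_def by blast
  obtain d where d: "d > 0" and dist: "\<And>I x y. I \<noteq> [] \<Longrightarrow> x \<in> cylinder I \<Longrightarrow> y \<in> cylinder I \<Longrightarrow>
      \<phi> (length I) x \<le> d * \<phi> (length I) y"
    using bd unfolding bounded_distortion_def
    by (metis One_nat_def Suc_leI length_greater_0_conv)
  define c' d' where "c' = max 1 c" and "d' = max 1 d"
  have c': "c' \<ge> 1" "c \<le> c'" and d': "d' \<ge> 1" "d \<le> d'"
    by (auto simp: c'_def d'_def)
  have ws: "\<phi> (length I) x \<le> word_sup \<phi> I" "word_sup \<phi> I \<le> d' * \<phi> (length I) x"
    if I: "I \<noteq> []" and x: "x \<in> cylinder I" for I x
  proof -
    have le: "\<phi> (length I) y \<le> d' * \<phi> (length I) x" if y: "y \<in> cylinder I" for y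
    proof -
      have "d * \<phi> (length I) x \<le> d' * \<phi> (length I) x"
        using d'(2) pos[of "length I" x] I
        by (intro mult_right_mono) (auto simp: less_imp_le Suc_le_eq)
      then show ?thesis using dist[OF I y x] by linarith
    qed
    show "\<phi> (length I) x \<le> word_sup \<phi> I"
      unfolding word_sup_def using le x by (intro cSUP_upper bdd_aboveI2[of _ _ "d' * \<phi> (length I) x"]) auto
    show "word_sup \<phi> I \<le> d' * \<phi> (length I) x"
      unfolding word_sup_def using le by (intro cSUP_least) auto
  qed
  have wpos: "word_sup \<phi> I > 0" if "I \<noteq> []" for I
  proof -
    obtain x where "x \<in> cylinder I" using cylinder_nonempty by blast
    then show ?thesis
      using ws(1)[OF that, of x] pos[of "length I" x] that by (simp add: Suc_le_eq)
  qed
  \<comment> \<open>One \<open>c'\<close> for almost additivity and two \<open>d'\<close> for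
    replacing both suprema in the lower estimate.\<close>
  define C where "C = c' * d' * d'"
  have C: "C \<ge> 1" "C \<ge> d'" "C \<ge> c' * d'"
  proof -
    have "1 * 1 \<le> c' * d'" using c' d' by (intro mult_mono) auto
    then show "C \<ge> c' * d'" unfolding C_def using d' mult_left_mono[of 1 d' "c' * d'"] by simp
    show "C \<ge> d'" unfolding C_def using \<open>1 * 1 \<le> c' * d'\<close> d' mult_right_mono[of 1 "c' * d'" d'] by simp
    then show "C \<ge> 1" using d' by simp
  qed
  have mult: "word_sup \<phi> (I @ J) \<le> C * (word_sup \<phi> I * word_sup \<phi> J)"
    "word_sup \<phi> I * word_sup \<phi> J \<le> C * word_sup \<phi> (I @ J)" if IJ: "I \<noteq> []" "J \<noteq> []" for I J
  proof -
    obtain x where x: "x \<in> cylinder (I @ J)" using cylinder_nonempty by blast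
    define y where "y = (shift ^^ length I) x"
    have xI: "x \<in> cylinder I" and yJ: "y \<in> cylinder J"
      using x by (auto simp: cylinder_append y_def)
    have n: "length I \<ge> 1" "length J \<ge> 1" using IJ by (auto simp: Suc_le_eq)
    define A B where "A = \<phi> (length I) x" and "B = \<phi> (length J) y"
    have AB: "A > 0" "B > 0" using pos n by (auto simp: A_def B_def)
    have up: "\<phi> (length (I @ J)) x \<le> c' * (A * B)"
    proof -
      have "\<phi> (length (I @ J)) x \<le> c * (A * B)"
        using add[OF n, of x] by (simp add: A_def B_def y_def mult.assoc)
      also have "\<dots> \<le> c' * (A * B)" using c' AB by (intro mult_right_mono) auto
      finally show ?thesis .
    qed
    have low: "A * B \<le> c' * \<phi> (length (I @ J)) x"
    proof -
      have "inverse c * (A * B) \<le> \<phi> (length (I @ J)) x"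
        using add[OF n, of x] by (simp add: A_def B_def y_def mult.assoc)
      then have "A * B \<le> c * \<phi> (length (I @ J)) x" using c by (simp add: field_simps)
      also have "\<dots> \<le> c' * \<phi> (length (I @ J)) x"
        using c' pos[of "length (I @ J)" x] n by (intro mult_right_mono) (auto simp: less_imp_le)
      finally show ?thesis .
    qed
    have wI: "A \<le> word_sup \<phi> I" "word_sup \<phi> I \<le> d' * A"
      using ws[OF IJ(1) xI] by (auto simp: A_def)
    have wJ: "B \<le> word_sup \<phi> J" "word_sup \<phi> J \<le> d' * B"
      using ws[OF IJ(2) yJ] by (auto simp: B_def)
    have wIJ: "\<phi> (length (I @ J)) x \<le> word_sup \<phi> (I @ J)" "word_sup \<phi> (I @ J) \<le> d' * \<phi> (length (I @ J)) x"
      using ws[of "I @ J" x] x IJ by auto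
    have "word_sup \<phi> (I @ J) \<le> d' * (c' * (A * B))"
      using wIJ(2) up d' by (meson mult_left_mono order_trans zero_le_one)
    also have "\<dots> \<le> d' * (c' * (word_sup \<phi> I * word_sup \<phi> J))"
      using c' d' wI wJ AB by (intro mult_left_mono mult_mono) auto
    also have "\<dots> = c' * d' * (word_sup \<phi> I * word_sup \<phi> J)" by simp
    also have "\<dots> \<le> C * (word_sup \<phi> I * word_sup \<phi> J)"
      using C(3) wpos IJ by (intro mult_right_mono) (auto simp: less_imp_le)
    finally show "word_sup \<phi> (I @ J) \<le> C * (word_sup \<phi> I * word_sup \<phi> J)" .
    have "word_sup \<phi> I * word_sup \<phi> J \<le> (d' * A) * (d' * B)"
      using wI wJ AB d' wpos IJ by (intro mult_mono) (auto simp: less_imp_le)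
    also have "\<dots> = d' * d' * (A * B)" by simp
    also have "\<dots> \<le> d' * d' * (c' * \<phi> (length (I @ J)) x)"
      using low d' by (intro mult_left_mono) auto
    also have "\<dots> \<le> d' * d' * (c' * word_sup \<phi> (I @ J))"
      using wIJ(1) c' d' by (intro mult_left_mono) auto
    finally show "word_sup \<phi> I * word_sup \<phi> J \<le> C * word_sup \<phi> (I @ J)"
      by (simp add: C_def mult_ac)
  qed
  have "\<phi> (length I) x \<le> word_sup \<phi> I \<and> word_sup \<phi> I \<le> C * \<phi> (length I) x"
    if "I \<noteq> []" "x \<in> cylinder I" for I x
  proof -
    have "d' * \<phi> (length I) x \<le> C * \<phi> (length I) x"
      using C(2) pos[of "length I" x] that by (intro mult_right_mono) (auto simp: less_imp_le Suc_le_eq)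
    then show ?thesis using ws[OF that] by linarith
  qed
  with C(1) wpos mult that show ?thesis by blast
qed

section \<open>Invariant measures, their factor images and integrals of the potential on
  words\<close>

lemma disjoint_family_on_cylinders:
  assumes "\<And>i j. i \<in> A \<Longrightarrow> j \<in> A \<Longrightarrow> i \<noteq> j \<Longrightarrow> length (g i) = length (g j) \<and> g i \<noteq> g j"
  shows "disjoint_family_on (\<lambda>i. cylinder (g i)) A"
  unfolding disjoint_family_on_def using assms cylinder_disjoint by blast

lemma measurable_shift_same: "shift \<in> measurable \<mu> \<mu>" if "sets \<mu> = sets borel"
  for \<mu> :: "(nat \<Rightarrow> 'a::{finite,discrete_topology}) measure"
  using measurable_shift by (simp add: measurable_cong_sets[OF that that])

text \<open>Normalisation and the sums over a last letter hold for every Borel probability measure.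
  The sums over a first letter are the cylinder values of the image under the shift, and a measure
  is determined by its cylinder values.\<close>

lemma stationary_invariant_measure:
  fixes \<eta> :: "(nat \<Rightarrow> 'a::{finite,discrete_topology}) measure"
  assumes "\<eta> \<in> borel_prob_measures"
  shows "\<eta> \<in> invariant_measures shift \<longleftrightarrow> stationary (\<lambda>I. measure \<eta> (cylinder I))"
proof -
  interpret prob_space \<eta> using assms by (simp add: borel_prob_measures_def)
  have sets_eta: "sets \<eta> = sets borel" using assms by (simp add: borel_prob_measures_def)
  have cyl: "cylinder I \<in> events" for I :: "'a list" by (simp add: sets_eta)
  have space: "space \<eta> = UNIV" using sets_eq_imp_space_eq[OF sets_eta] by simp
  have shift: "shift \<in> measurable \<eta> \<eta>" by (rule measurable_shift_same[OF sets_eta])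
  have left: "measure (distr \<eta> \<eta> shift) (cylinder I) = (\<Sum>x\<in>UNIV. prob (cylinder (x # I)))" for I :: "'a list"
  proof -
    have "measure (distr \<eta> \<eta> shift) (cylinder I) = prob (\<Union>x\<in>UNIV. cylinder (x # I))"
      using shift cyl by (simp add: measure_distr space shift_vimage_cylinder)
    also have "\<dots> = (\<Sum>x\<in>UNIV. prob (cylinder (x # I)))"
      by (intro finite_measure_finite_Union disjoint_family_on_cylinders) (auto simp: cyl)
    finally show ?thesis .
  qed
  have right: "(\<Sum>x\<in>UNIV. prob (cylinder (I @ [x]))) = prob (cylinder I)" for I :: "'a list"
    unfolding cylinder_snoc[of I]
    by (intro finite_measure_finite_Union[symmetric] disjoint_family_on_cylinders) (auto simp: cyl)
  have nil: "prob (cylinder []) = 1" using prob_space by (simp add: space)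
  have "distr \<eta> \<eta> shift \<in> borel_prob_measures"
    using shift sets_eta by (simp add: borel_prob_measures_def prob_space_distr)
  then have "distr \<eta> \<eta> shift = \<eta> \<longleftrightarrow> (\<forall>I. measure (distr \<eta> \<eta> shift) (cylinder I) = prob (cylinder I))"
    using measure_eq_cylinders[OF _ assms] by metis
  then show ?thesis
    using assms shift left right nil by (simp add: invariant_measures_def stationary_def)
qed

lemma factor_vimage_cylinder:
  assumes "one_block_factor_map p \<pi>"
  shows "\<pi> -` cylinder J = (\<Union>I\<in>fiber p J. cylinder I)"
proof (intro equalityI subsetI)
  fix x assume "x \<in> \<pi> -` cylinder J"
  then have "initial_word (length J) x \<in> fiber p J"
    using assms by (auto simp: one_block_factor_map_def cylinder_def fiber_def initial_word_def intro!: nth_equalityI)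
  then show "x \<in> (\<Union>I\<in>fiber p J. cylinder I)"
    using in_cylinder_initial_word by blast
next
  fix x assume "x \<in> (\<Union>I\<in>fiber p J. cylinder I)"
  then show "x \<in> \<pi> -` cylinder J"
    using assms by (auto simp: one_block_factor_map_def cylinder_def fiber_def)
qed

lemma factor_measure:
  fixes p :: "'a::{finite,discrete_topology} \<Rightarrow> 'd::{finite,discrete_topology}"
  assumes \<pi>: "one_block_factor_map p \<pi>" and \<eta>: "\<eta> \<in> invariant_measures shift"
  shows "distr \<eta> borel \<pi> \<in> invariant_measures shift"
    and "measure (distr \<eta> borel \<pi>) (cylinder J) = (\<Sum>I\<in>fiber p J. measure \<eta> (cylinder I))"
proof -
  have pr: "\<eta> \<in> borel_prob_measures" and sh: "shift \<in> measurable \<eta> \<eta>" "distr \<eta> \<eta> shift = \<eta>"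
    using \<eta> by (auto simp: invariant_measures_def)
  interpret prob_space \<eta> using pr by (simp add: borel_prob_measures_def)
  have sets_eta: "sets \<eta> = sets borel" using pr by (simp add: borel_prob_measures_def)
  have cyl: "cylinder I \<in> events" for I :: "'a list" by (simp add: sets_eta)
  have space: "space \<eta> = UNIV" using sets_eq_imp_space_eq[OF sets_eta] by simp
  have m: "\<pi> \<in> \<eta> \<rightarrow>\<^sub>M borel"
    by (rule measurable_borel_cylinders) (use cyl in \<open>auto simp: factor_vimage_cylinder[OF \<pi>] space\<close>)
  show "measure (distr \<eta> borel \<pi>) (cylinder J) = (\<Sum>I\<in>fiber p J. measure \<eta> (cylinder I))" for J
  proof -
    have "measure (distr \<eta> borel \<pi>) (cylinder J) = prob (\<Union>I\<in>fiber p J. cylinder I)"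
      using m by (simp add: measure_distr space factor_vimage_cylinder[OF \<pi>])
    also have "\<dots> = (\<Sum>I\<in>fiber p J. prob (cylinder I))"
      by (intro finite_measure_finite_Union disjoint_family_on_cylinders)
        (auto simp: cyl, metis fiber_length)
    finally show ?thesis .
  qed
  have "distr (distr \<eta> borel \<pi>) (distr \<eta> borel \<pi>) shift = distr (distr \<eta> borel \<pi>) borel shift"
    by (rule distr_cong) auto
  also have "\<dots> = distr \<eta> borel (shift \<circ> \<pi>)"
    using m by (intro distr_distr) auto
  also have "shift \<circ> \<pi> = \<pi> \<circ> shift"
    using \<pi> by (simp add: one_block_factor_map_def)
  also have "distr \<eta> borel (\<pi> \<circ> shift) = distr (distr \<eta> \<eta> shift) borel \<pi>"
    using m sh(1) by (intro distr_distr[symmetric]) auto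
  finally have "distr (distr \<eta> borel \<pi>) (distr \<eta> borel \<pi>) shift = distr \<eta> borel \<pi>"
    using sh(2) by simp
  moreover have "shift \<in> measurable (distr \<eta> borel \<pi>) (distr \<eta> borel \<pi>)"
    by (rule measurable_shift_same) simp
  ultimately show "distr \<eta> borel \<pi> \<in> invariant_measures shift"
    using m by (simp add: invariant_measures_def borel_prob_measures_def prob_space_distr)
qed

lemma ent_initial_word:
  fixes \<eta> :: "(nat \<Rightarrow> 'a::{finite,discrete_topology}) measure"
  assumes "\<eta> \<in> borel_prob_measures"
  shows "ent \<eta> (initial_word n) = - (\<Sum>I\<in>words n. measure \<eta> (cylinder I) * ln (measure \<eta> (cylinder I)))"
proof -
  interpret prob_space \<eta> using assms by (simp add: borel_prob_measures_def)
  have "sets \<eta> = sets borel" using assms by (simp add: borel_prob_measures_def)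
  from sets_eq_imp_space_eq[OF this] have space: "space \<eta> = UNIV" by simp
  have "ent \<eta> (initial_word n) = - (\<Sum>I\<in>words n. prob (initial_word n -` {I} \<inter> space \<eta>)
      * ln (prob (initial_word n -` {I} \<inter> space \<eta>)))"
    by (rule ent_eq_sum) auto
  also have "\<dots> = - (\<Sum>I\<in>words n. prob (cylinder I) * ln (prob (cylinder I)))"
    by (intro arg_cong[of _ _ uminus] sum.cong refl)
      (simp add: in_words_iff cylinder_eq_vimage space)
  finally show ?thesis .
qed

text \<open>On each cylinder of length \<open>n\<close> the integrand is within \<open>k\<close> of
  the constant \<open>ln (\<theta> I)\<close>. This gives integrability, and the error
  \<open>k / n\<close> disappears in the mean.\<close>

lemma potential_mean_eq:
  fixes \<phi> :: "nat \<Rightarrow> (nat \<Rightarrow> 'a::{finite,discrete_topology}) \<Rightarrow> real"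
  assumes \<eta>: "\<eta> \<in> borel_prob_measures"
    and cont: "\<And>n. n \<ge> 1 \<Longrightarrow> continuous_on UNIV (\<phi> n)" and pos: "\<And>n x. n \<ge> 1 \<Longrightarrow> \<phi> n x > 0"
    and \<theta>: "\<And>I x. I \<noteq> [] \<Longrightarrow> x \<in> cylinder I \<Longrightarrow> \<bar>ln (\<phi> (length I) x) - ln (\<theta> I)\<bar> \<le> k"
    and lim: "(\<lambda>n. (\<Sum>I\<in>words n. measure \<eta> (cylinder I) * ln (\<theta> I)) / real n) \<longlonglongrightarrow> L"
  shows "potential_mean \<phi> \<eta> = L"
proof -
  interpret prob_space \<eta> using \<eta> by (simp add: borel_prob_measures_def)
  have sets_eta: "sets \<eta> = sets borel" using \<eta> by (simp add: borel_prob_measures_def)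
  have cyl: "cylinder I \<in> events" for I :: "'a list" by (simp add: sets_eta)
  define S where "S n = (\<Sum>I\<in>words n. measure \<eta> (cylinder I) * ln (\<theta> I))" for n
  have diff: "\<bar>(\<integral>x. ln (\<phi> n x) \<partial>\<eta>) - S n\<bar> \<le> k" if n: "n \<ge> 1" for n
  proof -
    let ?g = "\<lambda>x. \<Sum>I\<in>words n. indicator (cylinder I) x * ln (\<theta> I)"
    have g: "?g x = ln (\<theta> (initial_word n x))" for x
    proof -
      have "indicator (cylinder I) x = (if I = initial_word n x then 1 else 0 :: real)" if "I \<in> words n" for I
        using that by (auto simp: indicator_def cylinder_iff in_words_iff)
      then have "?g x = (\<Sum>I\<in>words n. if I = initial_word n x then ln (\<theta> I) else 0)"
        by (intro sum.cong) auto
      then show ?thesis by simp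
    qed
    have int_g: "integrable \<eta> ?g"
      using cyl by (intro Bochner_Integration.integrable_sum integrable_mult_left integrable_real_indicator)
        (auto simp: less_top[symmetric])
    have lint_g: "(\<integral>x. ?g x \<partial>\<eta>) = S n"
      unfolding S_def using cyl
      by (subst Bochner_Integration.integral_sum) (auto simp: less_top[symmetric])
    have near: "\<bar>ln (\<phi> n x) - ?g x\<bar> \<le> k" for x
      unfolding g using \<theta>[of "initial_word n x" x] n by (cases "initial_word n x = []") (auto dest: arg_cong[of _ _ length])
    have meas: "(\<lambda>x. ln (\<phi> n x)) \<in> borel_measurable \<eta>"
    proof -
      have "\<phi> n \<in> borel_measurable borel"
        using cont[OF n] by (rule borel_measurable_continuous_onI)
      then have "\<phi> n \<in> borel_measurable \<eta>"
        by (simp add: measurable_cong_sets[OF sets_eta refl])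
      then show ?thesis by measurable
    qed
    have int_d: "integrable \<eta> (\<lambda>x. ln (\<phi> n x) - ?g x)"
      using near meas int_g by (intro integrable_const_bound[of _ k]) (auto intro!: borel_measurable_diff)
    then have int: "integrable \<eta> (\<lambda>x. ln (\<phi> n x))"
      using Bochner_Integration.integrable_add[OF int_d int_g] by simp
    have "(\<integral>x. ln (\<phi> n x) \<partial>\<eta>) - S n = (\<integral>x. ln (\<phi> n x) - ?g x \<partial>\<eta>)"
      using Bochner_Integration.integral_diff[OF int int_g] lint_g by simp
    moreover have "ln (\<phi> n x) - ?g x \<le> k" "- k \<le> ln (\<phi> n x) - ?g x" for x
      using near[of x] by linarith+
    then have "(\<integral>x. ln (\<phi> n x) - ?g x \<partial>\<eta>) \<le> k" "- k \<le> (\<integral>x. ln (\<phi> n x) - ?g x \<partial>\<eta>)"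
      by (intro integral_le_const integral_ge_const int_d AE_I2; simp)+
    ultimately show ?thesis by linarith
  qed
  have "(\<lambda>n. 1 / real n * (\<integral>x. ln (\<phi> n x) \<partial>\<eta>) - S n / real n) \<longlonglongrightarrow> 0"
  proof (rule Lim_null_comparison)
    show "eventually (\<lambda>n. norm (1 / real n * (\<integral>x. ln (\<phi> n x) \<partial>\<eta>) - S n / real n) \<le> k / real n) sequentially"
      unfolding eventually_sequentially
    proof (intro exI[of _ 1] allI impI)
      fix n :: nat assume n: "n \<ge> 1"
      have "norm (1 / real n * (\<integral>x. ln (\<phi> n x) \<partial>\<eta>) - S n / real n) = \<bar>(\<integral>x. ln (\<phi> n x) \<partial>\<eta>) - S n\<bar> / real n"
        by (simp add: diff_divide_distrib[symmetric])
      also have "\<dots> \<le> k / real n"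
        using diff[OF n] by (rule divide_right_mono) simp
      finally show "norm (1 / real n * (\<integral>x. ln (\<phi> n x) \<partial>\<eta>) - S n / real n) \<le> k / real n" .
    qed
  qed (rule lim_const_over_n)
  from tendsto_add[OF this lim[folded S_def]]
  show ?thesis
    unfolding potential_mean_def by (intro limI) simp
qed

section \<open>The Gibbs weight of the weighted problem\<close>

lemma comparable_on_ln:
  assumes "\<And>i. i \<in> K \<Longrightarrow> f i > 0" "\<And>i. i \<in> K \<Longrightarrow> g i > 0" "\<And>i. i \<in> K \<Longrightarrow> \<bar>ln (f i) - ln (g i)\<bar> \<le> k"
  shows "comparable_on K f g"
  unfolding comparable_on_def
proof (intro exI[of _ "exp k"] conjI ballI)
  fix i assume i: "i \<in> K"
  note pos = assms(1,2)[OF i]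
  have "ln (f i) \<le> k + ln (g i)" "ln (g i) \<le> k + ln (f i)"
    using assms(3)[OF i] by linarith+
  then have "exp (ln (f i)) \<le> exp (k + ln (g i))" "exp (ln (g i)) \<le> exp (k + ln (f i))"
    by simp_all
  then show "inverse (exp k) * g i \<le> f i" "f i \<le> exp k * g i"
    using pos by (auto simp: exp_add field_simps)
qed simp

lemma quasi_multiplicative_fiber_sum:
  fixes u :: "'a::finite list \<Rightarrow> real" and p :: "'a \<Rightarrow> 'd"
  assumes up: "\<And>I J. u (I @ J) \<le> k * (u I * u J)" and low: "\<And>I J. u I * u J \<le> k * u (I @ J)"
  shows "sum u (fiber p (J @ J')) \<le> k * (sum u (fiber p J) * sum u (fiber p J'))"
    and "sum u (fiber p J) * sum u (fiber p J') \<le> k * sum u (fiber p (J @ J'))"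
proof -
  have "sum u (fiber p (J @ J')) \<le> (\<Sum>I\<in>fiber p J. \<Sum>I'\<in>fiber p J'. k * (u I * u I'))"
    unfolding sum_fiber_append by (intro sum_mono up)
  then show "sum u (fiber p (J @ J')) \<le> k * (sum u (fiber p J) * sum u (fiber p J'))"
    unfolding sum_product by (simp only: sum_distrib_left)
  have "(\<Sum>I\<in>fiber p J. \<Sum>I'\<in>fiber p J'. u I * u I') \<le> (\<Sum>I\<in>fiber p J. \<Sum>I'\<in>fiber p J'. k * u (I @ I'))"
    by (intro sum_mono low)
  then show "sum u (fiber p J) * sum u (fiber p J') \<le> k * sum u (fiber p (J @ J'))"
    unfolding sum_product sum_fiber_append by (simp only: sum_distrib_left)
qed

text \<open>The weight \<open>w\<close> inherits quasi-multiplicativity from \<open>u\<close> and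
  \<open>v\<close>. Since \<open>v (map p I)\<close> is constant on a fibre, the fibre sums of
  \<open>w\<close> are exactly \<open>v J powr (1 - \<beta>)\<close>; hence the estimates for
  \<open>f\<close> and for its fibre sums share the same \<open>Q\<close>.\<close>

lemma weighted_gibbs_weight_exists:
  fixes u :: "'a::finite list \<Rightarrow> real" and p :: "'a \<Rightarrow> 'd::finite"
  assumes p: "surj p" and ab: "a > 0" "b \<ge> 0"
    and pos: "\<And>I. u I > 0" and u0: "u [] = 1" and k: "k \<ge> 1"
    and up: "\<And>I J. u (I @ J) \<le> k * (u I * u J)" and low: "\<And>I J. u I * u J \<le> k * u (I @ J)"
  defines "v \<equiv> \<lambda>J. sum u (fiber p J)"
  obtains f Q C where "stationary f" "\<And>I. f I > 0" "C \<ge> 1"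
    "\<And>I J. f (I @ J) \<le> C * (f I * f J)" "\<And>I J. f I * f J \<le> C * f (I @ J)"
    "\<And>I. \<bar>ln (f I) - (ln (u I) - b / (a + b) * ln (v (map p I)) - real (length I) * Q)\<bar> \<le> ln C"
    "\<And>J. \<bar>ln (sum f (fiber p J)) - (a / (a + b) * ln (v J) - real (length J) * Q)\<bar> \<le> ln C"
proof -
  define \<beta> where "\<beta> = b / (a + b)"
  have ab0: "a + b > 0" using ab by simp
  have \<beta>: "0 \<le> \<beta>" "\<beta> \<le> 1" "1 - \<beta> = a / (a + b)"
    using ab ab0 by (auto simp: \<beta>_def field_simps)
  have vpos: "v J > 0" for J
    unfolding v_def using pos fiber_nonempty[OF p] by (intro sum_pos) auto
  have v0: "v [] = 1" by (simp add: v_def u0)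
  have v_mult: "v (J @ J') \<le> k * (v J * v J')" "v J * v J' \<le> k * v (J @ J')" for J J'
    unfolding v_def by (rule quasi_multiplicative_fiber_sum[OF up low])+
  define w where "w I = u I / v (map p I) powr \<beta>" for I
  have wpos: "w I > 0" for I
    using pos[of I] vpos[of "map p I"] by (simp add: w_def)
  have ln_w: "ln (w I) = ln (u I) - \<beta> * ln (v (map p I))" for I
    using pos[of I] vpos[of "map p I"] by (simp add: w_def ln_div ln_powr)
  have ln_u: "\<bar>ln (u (I @ J)) - ln (u I) - ln (u J)\<bar> \<le> ln k" for I J
  proof -
    have "ln (u (I @ J)) \<le> ln (k * (u I * u J))"
      using up pos k by (subst ln_le_cancel_iff) (auto intro!: mult_pos_pos)
    moreover have "ln (u I * u J) \<le> ln (k * u (I @ J))"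
      using low pos k by (subst ln_le_cancel_iff) (auto intro!: mult_pos_pos)
    ultimately show ?thesis
      using pos[of I] pos[of J] pos[of "I @ J"] k by (simp add: ln_mult abs_le_iff)
  qed
  have ln_v: "\<bar>ln (v (I @ J)) - ln (v I) - ln (v J)\<bar> \<le> ln k" for I J
  proof -
    have "ln (v (I @ J)) \<le> ln (k * (v I * v J))"
      using v_mult(1)[of I J] vpos k by (subst ln_le_cancel_iff) (auto intro!: mult_pos_pos)
    moreover have "ln (v I * v J) \<le> ln (k * v (I @ J))"
      using v_mult(2)[of I J] vpos k by (subst ln_le_cancel_iff) (auto intro!: mult_pos_pos)
    ultimately show ?thesis
      using vpos[of I] vpos[of J] vpos[of "I @ J"] k by (simp add: ln_mult abs_le_iff)
  qed
  \<comment> \<open>One \<open>k\<close> comes from \<open>u\<close>; the power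
    \<open>\<beta> \<le> 1\<close> of \<open>v\<close> costs \<open>k powr \<beta>\<close>, which is
    at most another \<open>k\<close>.\<close>
  define c where "c = k * k"
  have c: "c \<ge> 1" unfolding c_def using k mult_mono[of 1 k 1 k] by simp
  have lnc: "ln c = ln k + ln k" using k by (simp add: c_def ln_mult)
  have ln_w2: "\<bar>ln (w (I @ J)) - ln (w I) - ln (w J)\<bar> \<le> ln c" for I J
  proof -
    have "ln (w (I @ J)) - ln (w I) - ln (w J) = (ln (u (I @ J)) - ln (u I) - ln (u J))
        - \<beta> * (ln (v (map p I @ map p J)) - ln (v (map p I)) - ln (v (map p J)))"
      by (simp add: ln_w algebra_simps)
    also have "\<bar>\<dots>\<bar> \<le> ln k + \<beta> * ln k"
    proof -
      have "\<bar>\<beta> * (ln (v (map p I @ map p J)) - ln (v (map p I)) - ln (v (map p J)))\<bar> \<le> \<beta> * ln k"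
        using \<beta> ln_v by (simp only: abs_mult abs_of_nonneg) (intro mult_left_mono)
      then show ?thesis using ln_u[of I J] by linarith
    qed
    also have "\<dots> \<le> ln c"
      using \<beta> k mult_right_mono[of \<beta> 1 "ln k"] by (simp add: lnc)
    finally show ?thesis .
  qed
  have w_up: "w (I @ J) \<le> c * (w I * w J)" and w_low: "w I * w J \<le> c * w (I @ J)" for I J
  proof -
    have "ln (w (I @ J)) \<le> ln (c * (w I * w J))" "ln (w I * w J) \<le> ln (c * w (I @ J))"
      using ln_w2[of I J] wpos[of I] wpos[of J] wpos[of "I @ J"] c by (auto simp: ln_mult)
    then show "w (I @ J) \<le> c * (w I * w J)" "w I * w J \<le> c * w (I @ J)"
      using wpos[of I] wpos[of J] wpos[of "I @ J"] c by (auto simp: ln_le_cancel_iff)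
  qed
  have w0: "w [] = 1" by (simp add: w_def u0 v0)
  obtain f Q D where f: "stationary f" and D: "D \<ge> 1"
    and f_up: "\<And>I. f I \<le> D * (w I * exp (- real (length I) * Q))"
    and f_low: "\<And>I. w I * exp (- real (length I) * Q) \<le> D * f I"
    by (rule gibbs_weight_exists[OF wpos w0 c w_up w_low]) (rule that)
  have fpos: "f I > 0" for I
  proof -
    have "0 < w I * exp (- real (length I) * Q)" using wpos[of I] by simp
    then have "0 < D * f I" using f_low[of I] by linarith
    then show ?thesis using D by (simp add: zero_less_mult_iff)
  qed
  have ln_f: "\<bar>ln (f I) - (ln (w I) - real (length I) * Q)\<bar> \<le> ln D" for I
  proof -
    have "ln (f I) \<le> ln (D * (w I * exp (- real (length I) * Q)))"
      using f_up[of I] fpos[of I] wpos[of I] D by (subst ln_le_cancel_iff) auto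
    moreover have "ln (w I * exp (- real (length I) * Q)) \<le> ln (D * f I)"
      using f_low[of I] fpos[of I] wpos[of I] D by (subst ln_le_cancel_iff) auto
    ultimately show ?thesis
      using fpos[of I] wpos[of I] D by (simp add: ln_mult abs_le_iff)
  qed
  have sum_w: "sum w (fiber p J) = v J powr (1 - \<beta>)" for J
  proof -
    have "sum w (fiber p J) = (\<Sum>I\<in>fiber p J. u I / v J powr \<beta>)"
      by (intro sum.cong) (auto simp: w_def fiber_def)
    also have "\<dots> = v J powr 1 / v J powr \<beta>"
      using vpos[of J] by (simp add: sum_divide_distrib[symmetric] v_def)
    also have "\<dots> = v J powr (1 - \<beta>)"
      by (simp add: powr_diff)
    finally show ?thesis .
  qed
  have ln_F: "\<bar>ln (sum f (fiber p J)) - (a / (a + b) * ln (v J) - real (length J) * Q)\<bar> \<le> ln D" for J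
  proof -
    have Fpos: "sum f (fiber p J) > 0"
      using fpos fiber_nonempty[OF p] by (intro sum_pos) auto
    let ?e = "exp (- real (length J) * Q)"
    have "sum f (fiber p J) \<le> (\<Sum>I\<in>fiber p J. D * (w I * ?e))"
      by (intro sum_mono order_trans[OF f_up]) (auto dest: fiber_length)
    also have "\<dots> = D * (v J powr (1 - \<beta>) * ?e)"
      by (simp only: sum_distrib_left[symmetric] sum_distrib_right[symmetric] sum_w)
    finally have "ln (sum f (fiber p J)) \<le> ln (D * (v J powr (1 - \<beta>) * ?e))"
      using Fpos vpos[of J] D by (subst ln_le_cancel_iff) auto
    moreover have "v J powr (1 - \<beta>) * ?e \<le> D * sum f (fiber p J)"
    proof -
      have "v J powr (1 - \<beta>) * ?e = (\<Sum>I\<in>fiber p J. w I * ?e)"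
        by (simp only: sum_distrib_right[symmetric] sum_w)
      also have "\<dots> \<le> (\<Sum>I\<in>fiber p J. D * f I)"
      proof (intro sum_mono)
        fix I assume "I \<in> fiber p J"
        then show "w I * ?e \<le> D * f I" using f_low[of I] by (auto dest: fiber_length)
      qed
      finally show ?thesis by (simp add: sum_distrib_left)
    qed
    then have "ln (v J powr (1 - \<beta>) * ?e) \<le> ln (D * sum f (fiber p J))"
      using Fpos vpos[of J] D by (subst ln_le_cancel_iff) auto
    ultimately show ?thesis
      using Fpos vpos[of J] D \<beta>(3) by (simp add: ln_mult ln_powr abs_le_iff)
  qed
  \<comment> \<open>Quasi-multiplicativity of \<open>f\<close> is reduced to that of
    \<open>w\<close>: three exchanges of \<open>f\<close> with \<open>w\<close> at \<open>D\<close>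
    each, and one \<open>c\<close> for \<open>w\<close> itself.\<close>
  define C where "C = D * D * D * c"
  have CD: "ln D \<ge> 0" "ln c \<ge> 0" and lnC: "ln C = 3 * ln D + ln c"
    using D c by (auto simp: C_def ln_mult)
  have Cpos: "C > 0" unfolding C_def using D c by simp
  have C: "C \<ge> 1"
  proof -
    have "ln 1 \<le> ln C" using lnC CD by simp
    then show ?thesis using Cpos by (subst (asm) ln_le_cancel_iff) auto
  qed
  have fC: "ln (f (I @ J)) \<le> ln (C * (f I * f J))" "ln (f I * f J) \<le> ln (C * f (I @ J))" for I J
  proof -
    have "real (length (I @ J)) * Q = real (length I) * Q + real (length J) * Q"
      by (simp add: algebra_simps)
    then show "ln (f (I @ J)) \<le> ln (C * (f I * f J))" "ln (f I * f J) \<le> ln (C * f (I @ J))"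
      using ln_f[of I] ln_f[of J] ln_f[of "I @ J"] ln_w2[of I J] lnC
        fpos[of I] fpos[of J] fpos[of "I @ J"] Cpos
      by (simp_all add: ln_mult abs_le_iff)
  qed
  show ?thesis
  proof (rule that[OF f fpos C, of Q])
    show "f (I @ J) \<le> C * (f I * f J)" "f I * f J \<le> C * f (I @ J)" for I J
      using fC[of I J] fpos[of I] fpos[of J] fpos[of "I @ J"] Cpos by (auto simp: ln_le_cancel_iff)
    show "\<bar>ln (f I) - (ln (u I) - b / (a + b) * ln (v (map p I)) - real (length I) * Q)\<bar> \<le> ln C" for I
      using ln_f[of I] lnC CD unfolding ln_w \<beta>_def by linarith
    show "\<bar>ln (sum f (fiber p J)) - (a / (a + b) * ln (v J) - real (length J) * Q)\<bar> \<le> ln C" for J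
      using ln_F[of J] lnC CD by linarith
  qed
qed

section \<open>Free energy and relative entropy\<close>

lemma rel_entropy_eq:
  assumes "\<And>I. 0 \<le> g I" "\<And>I. f I > 0"
  shows "rel_entropy g f n = (\<Sum>I\<in>words n. g I * ln (g I)) - (\<Sum>I\<in>words n. g I * ln (f I))"
proof -
  have "g I * ln (g I / f I) = g I * ln (g I) - g I * ln (f I)" for I
  proof (cases "g I = 0")
    case False
    then have "g I > 0" using assms(1)[of I] by simp
    then show ?thesis using assms(2)[of I] by (simp add: ln_div right_diff_distrib)
  qed simp
  then show ?thesis by (simp add: rel_entropy_def sum_subtractf)
qed

text \<open>The first \<open>n\<close> and the last \<open>m\<close> letters of a word of length
  \<open>n + m\<close> are again distributed by \<open>g\<close>, so the averages of
  \<open>t\<close> are almost additive with the same \<open>k\<close>.\<close>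

lemma stationary_mean_limit:
  fixes t :: "'a::finite list \<Rightarrow> real"
  assumes g: "stationary g"
    and t: "\<And>I J. I \<noteq> [] \<Longrightarrow> J \<noteq> [] \<Longrightarrow> \<bar>t (I @ J) - t I - t J\<bar> \<le> k"
  obtains L where "(\<lambda>n. (\<Sum>I\<in>words n. g I * t I) / real n) \<longlonglongrightarrow> L"
proof -
  define S where "S n = (\<Sum>I\<in>words n. g I * t I)" for n
  have "\<bar>S (n + m) - S n - S m\<bar> \<le> k" if nm: "n \<ge> 1" "m \<ge> 1" for n m
  proof -
    have "S n = (\<Sum>I\<in>words n. \<Sum>J\<in>words m. g (I @ J) * t I)"
      by (simp add: S_def sum_distrib_right[symmetric] stationary_sum_right[OF g])
    moreover have "S m = (\<Sum>I\<in>words n. \<Sum>J\<in>words m. g (I @ J) * t J)"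
      by (subst sum.swap) (simp add: S_def sum_distrib_right[symmetric] stationary_sum_left[OF g])
    ultimately have "S (n + m) - S n - S m = (\<Sum>I\<in>words n. \<Sum>J\<in>words m. g (I @ J) * (t (I @ J) - t I - t J))"
      by (simp add: S_def sum_words_add sum_subtractf right_diff_distrib)
    also have "\<bar>\<dots>\<bar> \<le> (\<Sum>I\<in>words n. \<Sum>J\<in>words m. g (I @ J) * k)"
    proof (rule order_trans[OF sum_abs], rule sum_mono, rule order_trans[OF sum_abs], rule sum_mono)
      fix I J :: "'a list"
      assume "I \<in> words n" "J \<in> words m"
      then have "I \<noteq> []" "J \<noteq> []" using nm by (auto simp: in_words_iff)
      then show "\<bar>g (I @ J) * (t (I @ J) - t I - t J)\<bar> \<le> g (I @ J) * k"
        using t stationary_nonneg[OF g] by (simp add: abs_mult mult_left_mono)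
    qed
    also have "\<dots> = k"
      by (simp add: sum_distrib_right[symmetric] stationary_sum_right[OF g] stationary_sum_words[OF g])
    finally show ?thesis .
  qed
  then show ?thesis
    using almost_additive_sequence[of S k] that unfolding S_def by metis
qed

text \<open>The free energy of \<open>\<eta>\<close> falls short of \<open>P\<close> by the weighted relative entropy rate
  of \<open>\<eta>\<close> with respect to the Gibbs weight \<open>f\<close>.\<close>

lemma free_energy_deficit:
  fixes p :: "'a::{finite,discrete_topology} \<Rightarrow> 'd::{finite,discrete_topology}"
  assumes \<pi>: "one_block_factor_map p \<pi>" and \<phi>: "almost_additive shift \<phi>" "bounded_distortion \<phi>"
    and fpos: "\<And>I. f I > 0" and Fpos: "\<And>J. sum f (fiber p J) > 0"
    and gibbs: "\<And>I. I \<noteq> [] \<Longrightarrow> \<bar>ln (word_sup \<phi> I) - a * ln (f I) - b * ln (sum f (fiber p (map p I)))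
        - real (length I) * P\<bar> \<le> K"
    and \<eta>: "\<eta> \<in> invariant_measures shift"
  defines "g \<equiv> \<lambda>I. measure \<eta> (cylinder I)"
  obtains F where "weighted_free_energy shift shift \<pi> a b \<phi> \<eta> = ereal F"
    "(\<lambda>n. (a * rel_entropy g f n + b * rel_entropy (\<lambda>J. sum g (fiber p J)) (\<lambda>J. sum f (fiber p J)) n) / real n)
        \<longlonglongrightarrow> P - F"
proof -
  obtain C where C: "C \<ge> 1" and wpos: "\<And>I. I \<noteq> [] \<Longrightarrow> word_sup \<phi> I > 0"
    and ws: "\<And>I x. I \<noteq> [] \<Longrightarrow> x \<in> cylinder I \<Longrightarrow> \<phi> (length I) x \<le> word_sup \<phi> I \<and> word_sup \<phi> I \<le> C * \<phi> (length I) x"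
    and wm: "\<And>I J. I \<noteq> [] \<Longrightarrow> J \<noteq> [] \<Longrightarrow> word_sup \<phi> (I @ J) \<le> C * (word_sup \<phi> I * word_sup \<phi> J)"
      "\<And>I J. I \<noteq> [] \<Longrightarrow> J \<noteq> [] \<Longrightarrow> word_sup \<phi> I * word_sup \<phi> J \<le> C * word_sup \<phi> (I @ J)"
    using word_sup_quasi_multiplicative[OF \<phi>] by metis
  have \<phi>pos: "\<phi> n x > 0" and \<phi>cont: "continuous_on UNIV (\<phi> n)" if "n \<ge> 1" for n x
    using \<phi>(1) that by (auto simp: almost_additive_def)
  let ?\<eta>' = "distr \<eta> borel \<pi>"
  have pr: "\<eta> \<in> borel_prob_measures" using \<eta> by (simp add: invariant_measures_def)
  have g: "stationary g"
    using stationary_invariant_measure[OF pr] \<eta> by (simp add: g_def)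
  have g_eq: "measure \<eta> (cylinder I) = g I" for I
    by (simp add: g_def)
  have \<eta>': "?\<eta>' \<in> invariant_measures shift" and g': "measure ?\<eta>' (cylinder J) = sum g (fiber p J)" for J
    using factor_measure[OF \<pi> \<eta>] by (auto simp: g_def)
  have pr': "?\<eta>' \<in> borel_prob_measures" using \<eta>' by (simp add: invariant_measures_def)
  obtain h where h: "ks_entropy \<eta> shift = ereal h" "(\<lambda>n. ent \<eta> (initial_word n) / real n) \<longlonglongrightarrow> h"
    using kolmogorov_sinai_shift[OF \<eta>] by blast
  obtain h' where h': "ks_entropy ?\<eta>' shift = ereal h'" "(\<lambda>n. ent ?\<eta>' (initial_word n) / real n) \<longlonglongrightarrow> h'"
    using kolmogorov_sinai_shift[OF \<eta>'] by blast
  define S where "S n = (\<Sum>I\<in>words n. g I * ln (word_sup \<phi> I))" for n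
  have "\<bar>ln (word_sup \<phi> (I @ J)) - ln (word_sup \<phi> I) - ln (word_sup \<phi> J)\<bar> \<le> ln C"
    if IJ: "I \<noteq> []" "J \<noteq> []" for I J
  proof -
    have pos: "word_sup \<phi> I > 0" "word_sup \<phi> J > 0" "word_sup \<phi> (I @ J) > 0"
      using wpos IJ by auto
    have "ln (word_sup \<phi> (I @ J)) \<le> ln (C * (word_sup \<phi> I * word_sup \<phi> J))"
      using wm(1)[OF IJ] pos C by (subst ln_le_cancel_iff) auto
    moreover have "ln (word_sup \<phi> I * word_sup \<phi> J) \<le> ln (C * word_sup \<phi> (I @ J))"
      using wm(2)[OF IJ] pos C by (subst ln_le_cancel_iff) auto
    ultimately show ?thesis
      using pos C by (simp add: ln_mult abs_le_iff)
  qed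
  then obtain L where L: "(\<lambda>n. S n / real n) \<longlonglongrightarrow> L"
    using stationary_mean_limit[OF g, of "\<lambda>I. ln (word_sup \<phi> I)" "ln C"] unfolding S_def by metis
  have mean: "potential_mean \<phi> \<eta> = L"
  proof (rule potential_mean_eq[OF pr \<phi>cont \<phi>pos])
    show "\<bar>ln (\<phi> (length I) x) - ln (word_sup \<phi> I)\<bar> \<le> ln C" if I: "I \<noteq> []" "x \<in> cylinder I" for I x
    proof -
      have pos: "\<phi> (length I) x > 0" using \<phi>pos I by (simp add: Suc_le_eq)
      have "ln (\<phi> (length I) x) \<le> ln (word_sup \<phi> I)"
        using ws[OF I] pos wpos[OF I(1)] by (subst ln_le_cancel_iff) auto
      moreover have "ln (word_sup \<phi> I) \<le> ln (C * \<phi> (length I) x)"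
        using ws[OF I] pos wpos[OF I(1)] C by (subst ln_le_cancel_iff) auto
      ultimately show ?thesis
        using pos C by (simp add: ln_mult abs_le_iff)
    qed
    show "(\<lambda>n. (\<Sum>I\<in>words n. measure \<eta> (cylinder I) * ln (word_sup \<phi> I)) / real n) \<longlonglongrightarrow> L"
      using L by (simp add: S_def g_def)
  qed
  let ?g' = "\<lambda>J. sum g (fiber p J)" and ?f' = "\<lambda>J. sum f (fiber p J)"
  define E where "E n = S n + a * ent \<eta> (initial_word n) + b * ent ?\<eta>' (initial_word n)" for n
  define R where "R n = a * rel_entropy g f n + b * rel_entropy ?g' ?f' n" for n
  \<comment> \<open>In \<open>E n + R n\<close> the entropies of \<open>\<eta>\<close> and of its
    image cancel against those inside the relative entropies. What is left after subtracting
    \<open>real n * P\<close> is the \<open>g\<close>-average of the expression that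
    \<open>gibbs\<close> bounds by \<open>K\<close>.\<close>
  have bound: "\<bar>E n + R n - real n * P\<bar> \<le> K" if n: "n \<ge> 1" for n
  proof -
    \<comment> \<open>Sums over words of the factor are rewritten as sums over words of the source,
      so that one average over \<open>I\<close> collects all terms.\<close>
    have "(\<Sum>J\<in>words n. ?g' J * ln (?f' J)) = (\<Sum>J\<in>words n. \<Sum>I\<in>fiber p J. g I * ln (?f' (map p I)))"
      by (intro sum.cong refl, simp only: sum_distrib_right, rule sum.cong) (auto simp: fiber_def)
    also have "\<dots> = (\<Sum>I\<in>words n. g I * ln (?f' (map p I)))"
      by (rule sum_words_fibers)
    finally have f': "(\<Sum>J\<in>words n. ?g' J * ln (?f' J)) = (\<Sum>I\<in>words n. g I * ln (?f' (map p I)))" .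
    have R: "rel_entropy g f n = - ent \<eta> (initial_word n) - (\<Sum>I\<in>words n. g I * ln (f I))"
      "rel_entropy ?g' ?f' n = - ent ?\<eta>' (initial_word n) - (\<Sum>I\<in>words n. g I * ln (?f' (map p I)))"
      using stationary_nonneg[OF g] fpos Fpos
      by (simp_all add: rel_entropy_eq sum_nonneg ent_initial_word[OF pr] ent_initial_word[OF pr'] g' f' g_eq)
    have "E n + R n = S n - a * (\<Sum>I\<in>words n. g I * ln (f I)) - b * (\<Sum>I\<in>words n. g I * ln (?f' (map p I)))"
      by (simp add: E_def R_def R algebra_simps)
    moreover have "real n * P = (\<Sum>I\<in>words n. g I * (real n * P))"
      by (simp only: sum_distrib_right[symmetric] stationary_sum_words[OF g] mult_1)
    moreover have "S n - a * (\<Sum>I\<in>words n. g I * ln (f I)) - b * (\<Sum>I\<in>words n. g I * ln (?f' (map p I)))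
        - (\<Sum>I\<in>words n. g I * (real n * P))
      = (\<Sum>I\<in>words n. g I * (ln (word_sup \<phi> I) - a * ln (f I) - b * ln (?f' (map p I)) - real n * P))"
      by (simp add: S_def sum_subtractf sum_distrib_left right_diff_distrib mult.left_commute)
    ultimately have "\<bar>E n + R n - real n * P\<bar>
      = \<bar>\<Sum>I\<in>words n. g I * (ln (word_sup \<phi> I) - a * ln (f I) - b * ln (?f' (map p I)) - real n * P)\<bar>"
      by linarith
    also have "\<dots> \<le> (\<Sum>I\<in>words n. g I * K)"
    proof (rule order_trans[OF sum_abs], rule sum_mono)
      fix I :: "'a list" assume "I \<in> words n"
      then have I: "I \<noteq> []" "length I = n" using n by (auto simp: in_words_iff)
      then show "\<bar>g I * (ln (word_sup \<phi> I) - a * ln (f I) - b * ln (?f' (map p I)) - real n * P)\<bar> \<le> g I * K"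
        using gibbs[OF I(1)] stationary_nonneg[OF g, of I] by (simp add: abs_mult mult_left_mono)
    qed
    also have "\<dots> = K"
      by (simp only: sum_distrib_right[symmetric] stationary_sum_words[OF g] mult_1)
    finally show ?thesis .
  qed
  have lim0: "(\<lambda>n. E n / real n + R n / real n - real n * P / real n) \<longlonglongrightarrow> 0"
  proof (rule Lim_null_comparison)
    show "eventually (\<lambda>n. norm (E n / real n + R n / real n - real n * P / real n) \<le> K / real n) sequentially"
      unfolding eventually_sequentially
    proof (intro exI[of _ 1] allI impI)
      fix n :: nat assume n: "n \<ge> 1"
      have "norm (E n / real n + R n / real n - real n * P / real n) = \<bar>E n + R n - real n * P\<bar> / real n"
        by (simp only: add_divide_distrib[symmetric] diff_divide_distrib[symmetric]) simp
      also have "\<dots> \<le> K / real n"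
        using bound[OF n] by (rule divide_right_mono) simp
      finally show "norm (E n / real n + R n / real n - real n * P / real n) \<le> K / real n" .
    qed
  qed (rule lim_const_over_n)
  have limP: "(\<lambda>n. real n * P / real n) \<longlonglongrightarrow> P"
    by (rule tendsto_eventually) (auto simp: eventually_sequentially intro!: exI[of _ 1])
  have limE: "(\<lambda>n. E n / real n) \<longlonglongrightarrow> L + a * h + b * h'"
  proof -
    have "(\<lambda>n. S n / real n + a * (ent \<eta> (initial_word n) / real n) + b * (ent ?\<eta>' (initial_word n) / real n))
        \<longlonglongrightarrow> L + a * h + b * h'"
      by (intro tendsto_add tendsto_mult tendsto_const L h(2) h'(2))
    then show ?thesis by (simp add: E_def add_divide_distrib)
  qed
  have "(\<lambda>n. R n / real n) \<longlonglongrightarrow> P - (L + a * h + b * h')"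
    using tendsto_diff[OF tendsto_add[OF lim0 limP] limE] by simp
  moreover have "weighted_free_energy shift shift \<pi> a b \<phi> \<eta> = ereal (L + a * h + b * h')"
    by (simp add: weighted_free_energy_def mean h(1) h'(1))
  ultimately show ?thesis using that unfolding R_def by blast
qed

subsection \<open>Weighted equilibrium states\<close>

theorem theorem1p2:
  fixes p :: "'a::{finite,discrete_topology} \<Rightarrow> 'd::{finite,discrete_topology}"
    and \<pi> :: "(nat \<Rightarrow> 'a) \<Rightarrow> nat \<Rightarrow> 'd"
    and a b :: real
    and \<phi> :: "nat \<Rightarrow> (nat \<Rightarrow> 'a) \<Rightarrow> real"
  assumes "one_block_factor_map p \<pi>"
    and "a > 0" and "b \<ge> 0"
    and "almost_additive shift \<phi>"
    and "bounded_distortion \<phi>"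
  shows
    "(\<exists>!\<mu>. weighted_equilibrium_state shift shift \<pi> a b \<phi> \<mu>) \<and>
     (\<exists>P::real. weighted_pressure shift shift \<pi> a b \<phi> = ereal P \<and>
       (\<forall>\<mu> \<nu>. weighted_equilibrium_state shift shift \<pi> a b \<phi> \<mu> \<and> \<nu> = distr \<mu> borel \<pi> \<longrightarrow>
         quasi_bernoulli \<mu> \<and>
         comparable_on {I. I \<noteq> []}
           (\<lambda>I. measure \<mu> (cylinder I))
           (\<lambda>I. exp (- real (length I) * P / (a + b))
                  * (word_sup \<phi> I powr (1 / a) / fiber_sum p a \<phi> (map p I) powr (b / (a + b)))) \<and>
         comparable_on {J. J \<noteq> []}
           (\<lambda>J. measure \<nu> (cylinder J))
           (\<lambda>J. exp (- real (length J) * P / (a + b)) * fiber_sum p a \<phi> J powr (a / (a + b))) \<and>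
         comparable_on {I. I \<noteq> []}
           (\<lambda>I. measure \<mu> (cylinder I) powr a * measure \<nu> (cylinder (map p I)) powr b)
           (\<lambda>I. word_sup \<phi> I * exp (- real (length I) * P))))"
proof -
  note \<pi> = assms(1) and ab = assms(2,3)
  have surj_p: "surj p"
  proof (rule surjI)
    fix d
    have "surj \<pi>" using \<pi> by (simp add: one_block_factor_map_def)
    then have "\<pi> (inv \<pi> (\<lambda>_. d)) 0 = d" by (simp add: surj_f_inv_f)
    then show "p (inv \<pi> (\<lambda>_. d) 0) = d" using \<pi> by (simp add: one_block_factor_map_def)
  qed
  have ab0: "a + b > 0" using ab by simp
  obtain C0 where C0: "C0 \<ge> 1" and wpos: "\<And>I. I \<noteq> [] \<Longrightarrow> word_sup \<phi> I > 0"
    and wm: "\<And>I J. I \<noteq> [] \<Longrightarrow> J \<noteq> [] \<Longrightarrow> word_sup \<phi> (I @ J) \<le> C0 * (word_sup \<phi> I * word_sup \<phi> J)"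
      "\<And>I J. I \<noteq> [] \<Longrightarrow> J \<noteq> [] \<Longrightarrow> word_sup \<phi> I * word_sup \<phi> J \<le> C0 * word_sup \<phi> (I @ J)"
    using word_sup_quasi_multiplicative[OF assms(4,5)] by metis
  \<comment> \<open>\<open>word_sup \<phi> []\<close> would be a supremum of
    \<open>\<phi> 0\<close>, about which nothing is known. The value 1 extends
    quasi-multiplicativity to the empty word.\<close>
  define u where "u I = (if I = [] then 1 else word_sup \<phi> I powr (1 / a))" for I
  define k where "k = C0 powr (1 / a)"
  have k: "k \<ge> 1" unfolding k_def using C0 ab by (simp add: ge_one_powr_ge_zero)
  have u0: "u [] = 1" by (simp add: u_def)
  have upos: "u I > 0" for I
    using wpos[of I] by (cases "I = []") (auto simp: u_def)
  have u_up: "u (I @ J) \<le> k * (u I * u J)" for I J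
  proof (cases "I = [] \<or> J = []")
    case True
    then show ?thesis using k upos[of I] upos[of J] by (auto simp: u0)
  next
    case False
    then have "word_sup \<phi> (I @ J) powr (1 / a) \<le> (C0 * (word_sup \<phi> I * word_sup \<phi> J)) powr (1 / a)"
      using wm(1)[of I J] wpos[of "I @ J"] ab by (intro powr_mono2) auto
    also have "\<dots> = k * (word_sup \<phi> I powr (1 / a) * word_sup \<phi> J powr (1 / a))"
      using False wpos[of I] wpos[of J] C0 by (simp add: k_def powr_mult)
    finally show ?thesis using False by (simp add: u_def)
  qed
  have u_low: "u I * u J \<le> k * u (I @ J)" for I J
  proof (cases "I = [] \<or> J = []")
    case True
    then show ?thesis using k upos[of I] upos[of J] by (auto simp: u0)
  next
    case False
    then have "(word_sup \<phi> I * word_sup \<phi> J) powr (1 / a) \<le> (C0 * word_sup \<phi> (I @ J)) powr (1 / a)"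
      using wm(2)[of I J] wpos[of I] wpos[of J] ab by (intro powr_mono2) auto
    also have "\<dots> = k * word_sup \<phi> (I @ J) powr (1 / a)"
      using False wpos[of "I @ J"] C0 by (simp add: k_def powr_mult)
    finally show ?thesis
      using False wpos[of I] wpos[of J] by (simp add: u_def powr_mult)
  qed
  let ?v = "\<lambda>J. sum u (fiber p J)"
  have v_eq: "fiber_sum p a \<phi> J = ?v J" if "J \<noteq> []" for J
    unfolding fiber_sum_def fiber_def using that by (intro sum.cong) (auto simp: u_def)
  have vpos: "?v J > 0" for J
    using upos fiber_nonempty[OF surj_p] by (intro sum_pos) auto
  obtain f Q C where f: "stationary f" and fpos: "\<And>I. f I > 0" and C: "C \<ge> 1"
    and f_up: "\<And>I J. f (I @ J) \<le> C * (f I * f J)" and f_low: "\<And>I J. f I * f J \<le> C * f (I @ J)"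
    and ln_f: "\<And>I. \<bar>ln (f I) - (ln (u I) - b / (a + b) * ln (?v (map p I)) - real (length I) * Q)\<bar> \<le> ln C"
    and ln_F: "\<And>J. \<bar>ln (sum f (fiber p J)) - (a / (a + b) * ln (?v J) - real (length J) * Q)\<bar> \<le> ln C"
    by (rule weighted_gibbs_weight_exists[OF surj_p ab upos u0 k u_up u_low]) (rule that)
  let ?F = "\<lambda>J. sum f (fiber p J)"
  have Fpos: "?F J > 0" for J
    using fpos fiber_nonempty[OF surj_p] by (intro sum_pos) auto
  define P where "P = (a + b) * Q"
  have Q: "- real n * P / (a + b) = - real n * Q" for n
    using ab0 by (simp add: P_def)
  have ln_u: "ln (u I) = ln (word_sup \<phi> I) / a" if "I \<noteq> []" for I
    using that wpos[of I] by (simp add: u_def ln_powr)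
  have gibbs: "\<bar>ln (word_sup \<phi> I) - a * ln (f I) - b * ln (?F (map p I)) - real (length I) * P\<bar> \<le> (a + b) * ln C"
    if I: "I \<noteq> []" for I
  proof -
    define x where "x = ln (f I) - (ln (u I) - b / (a + b) * ln (?v (map p I)) - real (length I) * Q)"
    define y where "y = ln (?F (map p I)) - (a / (a + b) * ln (?v (map p I)) - real (length I) * Q)"
    \<comment> \<open>With these two identities the terms in \<open>ln (?v (map p I))\<close> and in
      \<open>Q\<close> drop out of the left-hand side, and only the errors \<open>x\<close> and
      \<open>y\<close> remain.\<close>
    have "a * (b / (a + b)) = b * (a / (a + b))" "a * ln (u I) = ln (word_sup \<phi> I)"
      using ab ln_u[OF I] by auto
    then have eq: "ln (word_sup \<phi> I) - a * ln (f I) - b * ln (?F (map p I)) - real (length I) * P = - (a * x) - b * y"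
      unfolding x_def y_def P_def by (simp add: algebra_simps)
    have "\<bar>a * x\<bar> \<le> a * ln C" "\<bar>b * y\<bar> \<le> b * ln C"
      using ln_f[of I] ln_F[of "map p I"] ab by (auto simp: x_def y_def abs_mult intro!: mult_left_mono)
    then have "\<bar>- (a * x) - b * y\<bar> \<le> a * ln C + b * ln C" by linarith
    then show ?thesis unfolding eq by (simp only: distrib_right)
  qed
  obtain \<mu> where \<mu>pr: "\<mu> \<in> borel_prob_measures" and \<mu>: "\<And>I. measure \<mu> (cylinder I) = f I"
    using weight_extension[OF f fpos] by blast
  have \<mu>inv: "\<mu> \<in> invariant_measures shift"
    using stationary_invariant_measure[OF \<mu>pr] f by (simp add: \<mu>)
  have \<nu>: "measure (distr \<mu> borel \<pi>) (cylinder J) = ?F J" for J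
    using factor_measure(2)[OF \<pi> \<mu>inv] by (simp add: \<mu>)
  have stat_F: "stationary ?F"
    using stationary_invariant_measure[of "distr \<mu> borel \<pi>"] factor_measure(1)[OF \<pi> \<mu>inv]
    by (simp add: \<nu> invariant_measures_def)
  note deficit = free_energy_deficit[OF \<pi> assms(4,5) fpos Fpos gibbs]
  have energy_le: "weighted_free_energy shift shift \<pi> a b \<phi> \<eta> \<le> ereal P"
    and energy_eq: "weighted_free_energy shift shift \<pi> a b \<phi> \<eta> = ereal P \<Longrightarrow> \<eta> = \<mu>"
    if \<eta>: "\<eta> \<in> invariant_measures shift" for \<eta>
  proof -
    define g where "g = (\<lambda>I :: 'a list. measure \<eta> (cylinder I))"
    have pr: "\<eta> \<in> borel_prob_measures" using \<eta> by (simp add: invariant_measures_def)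
    have g: "stationary g"
      using stationary_invariant_measure[OF pr] \<eta> by (simp add: g_def)
    let ?G = "\<lambda>J. sum g (fiber p J)"
    have G: "stationary ?G"
      using stationary_invariant_measure[of "distr \<eta> borel \<pi>"] factor_measure[OF \<pi> \<eta>]
      by (simp add: g_def invariant_measures_def)
    obtain F where F: "weighted_free_energy shift shift \<pi> a b \<phi> \<eta> = ereal F"
      "(\<lambda>n. (a * rel_entropy g f n + b * rel_entropy ?G ?F n) / real n) \<longlonglongrightarrow> P - F"
      by (rule deficit[OF _ \<eta>, folded g_def]) (assumption, rule that)
    have D: "0 \<le> rel_entropy g f n" "0 \<le> rel_entropy ?G ?F n" for n
      using rel_entropy_nonneg[OF g f fpos] rel_entropy_nonneg[OF G stat_F Fpos] by auto
    have "0 \<le> P - F"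
      using ab D by (intro LIMSEQ_le_const[OF F(2)] exI[of _ 0]) (auto intro!: divide_nonneg_nonneg add_nonneg_nonneg)
    then show "weighted_free_energy shift shift \<pi> a b \<phi> \<eta> \<le> ereal P"
      by (simp add: F(1))
    assume "weighted_free_energy shift shift \<pi> a b \<phi> \<eta> = ereal P"
    then have lim0: "(\<lambda>n. (a * rel_entropy g f n + b * rel_entropy ?G ?F n) / real n / a) \<longlonglongrightarrow> 0"
      using tendsto_divide[OF F(2) tendsto_const[of a]] F(1) ab by simp
    \<comment> \<open>The relative entropy on the factor is nonnegative and has weight
      \<open>b \<ge> 0\<close>, so dropping it and dividing by \<open>a > 0\<close> bounds the rate
      on the source.\<close>
    have "(\<lambda>n. rel_entropy g f n / real n) \<longlonglongrightarrow> 0"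
    proof (rule tendsto_sandwich[OF _ _ tendsto_const lim0])
      show "eventually (\<lambda>n. 0 \<le> rel_entropy g f n / real n) sequentially"
        using D by simp
      show "eventually (\<lambda>n. rel_entropy g f n / real n
          \<le> (a * rel_entropy g f n + b * rel_entropy ?G ?F n) / real n / a) sequentially"
      proof (intro always_eventually allI)
        fix n
        have "rel_entropy g f n / real n = a * rel_entropy g f n / real n / a"
          using ab by simp
        also have "\<dots> \<le> (a * rel_entropy g f n + b * rel_entropy ?G ?F n) / real n / a"
          using ab D by (intro divide_right_mono) auto
        finally show "rel_entropy g f n / real n
          \<le> (a * rel_entropy g f n + b * rel_entropy ?G ?F n) / real n / a" .
      qed
    qed
    then have "g = f"
      by (rule zero_rate_imp_eq[OF g f fpos C f_low])
    then show "\<eta> = \<mu>"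
      by (intro measure_eq_cylinders[OF pr \<mu>pr]) (simp add: \<mu> g_def fun_eq_iff)
  qed
  have energy_\<mu>: "weighted_free_energy shift shift \<pi> a b \<phi> \<mu> = ereal P"
  proof -
    obtain F where "weighted_free_energy shift shift \<pi> a b \<phi> \<mu> = ereal F"
      "(\<lambda>n. (a * rel_entropy f f n + b * rel_entropy ?F ?F n) / real n) \<longlonglongrightarrow> P - F"
      by (rule deficit[OF _ \<mu>inv, unfolded \<mu>]) (assumption, rule that)
    moreover have "rel_entropy f f n = 0" "rel_entropy ?F ?F n = 0" for n
      using rel_entropy_self[OF fpos] rel_entropy_self[OF Fpos] by auto
    ultimately show ?thesis
      \<comment> \<open>Against itself the Gibbs weight has no deficit: the sequence is constantly
        0, so \<open>F = P\<close>.\<close>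
      using LIMSEQ_unique[OF tendsto_const] by force
  qed
  have pressure: "weighted_pressure shift shift \<pi> a b \<phi> = ereal P"
    unfolding weighted_pressure_def
  proof (rule antisym)
    show "(SUP \<eta>\<in>invariant_measures shift. weighted_free_energy shift shift \<pi> a b \<phi> \<eta>) \<le> ereal P"
      by (intro SUP_least energy_le)
    show "ereal P \<le> (SUP \<eta>\<in>invariant_measures shift. weighted_free_energy shift shift \<pi> a b \<phi> \<eta>)"
      using SUP_upper[OF \<mu>inv, of "weighted_free_energy shift shift \<pi> a b \<phi>"] energy_\<mu> by simp
  qed
  have state_iff: "weighted_equilibrium_state shift shift \<pi> a b \<phi> \<eta> \<longleftrightarrow> \<eta> = \<mu>" for \<eta>
    unfolding weighted_equilibrium_state_def pressure using energy_eq energy_\<mu> \<mu>inv by blast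
  have quasi: "quasi_bernoulli \<mu>"
    unfolding quasi_bernoulli_def
  proof (intro conjI exI[of _ C] allI impI)
    fix U :: "(nat \<Rightarrow> 'a) set" assume U: "open U \<and> U \<noteq> {}"
    then obtain x n where "cylinder (initial_word n x) \<subseteq> U"
      using open_contains_cylinder by (metis ex_in_conv)
    moreover have "finite_measure \<mu>" "sets \<mu> = sets borel"
      using \<mu>pr by (auto simp: borel_prob_measures_def prob_space_def)
    ultimately have "measure \<mu> (cylinder (initial_word n x)) \<le> measure \<mu> U"
      using U by (intro finite_measure.finite_measure_mono) auto
    then show "0 < measure \<mu> U" using fpos[of "initial_word n x"] by (simp add: \<mu>)
  next
    fix I J :: "'a list"
    show "inverse C \<le> measure \<mu> (cylinder (I @ J)) / (measure \<mu> (cylinder I) * measure \<mu> (cylinder J))"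
      using f_low[of I J] fpos[of I] fpos[of J] C by (simp add: \<mu> field_simps)
    show "measure \<mu> (cylinder (I @ J)) / (measure \<mu> (cylinder I) * measure \<mu> (cylinder J)) \<le> C"
      using f_up[of I J] fpos[of I] fpos[of J] by (simp add: \<mu> field_simps)
  qed (use \<mu>pr C in auto)
  have "comparable_on {I. I \<noteq> []} (\<lambda>I. measure \<mu> (cylinder I))
      (\<lambda>I. exp (- real (length I) * P / (a + b))
        * (word_sup \<phi> I powr (1 / a) / fiber_sum p a \<phi> (map p I) powr (b / (a + b))))"
  proof (rule comparable_on_ln)
    fix I :: "'a list" assume "I \<in> {I. I \<noteq> []}"
    then have I: "I \<noteq> []" by simp
    let ?r = "exp (- real (length I) * P / (a + b)) * (word_sup \<phi> I powr (1 / a) / fiber_sum p a \<phi> (map p I) powr (b / (a + b)))"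
    have r: "?r = exp (- real (length I) * Q) * (u I / ?v (map p I) powr (b / (a + b)))"
      unfolding Q using I by (simp add: v_eq u_def)
    show "measure \<mu> (cylinder I) > 0" by (simp add: \<mu> fpos)
    show "?r > 0" unfolding r using upos[of I] vpos[of "map p I"] by simp
    have "ln ?r = ln (u I) - b / (a + b) * ln (?v (map p I)) - real (length I) * Q"
      unfolding r using upos[of I] vpos[of "map p I"] by (simp add: ln_mult ln_div ln_powr)
    then show "\<bar>ln (measure \<mu> (cylinder I)) - ln ?r\<bar> \<le> ln C"
      using ln_f[of I] by (simp only: \<mu>)
  qed
  moreover have "comparable_on {J. J \<noteq> []} (\<lambda>J. measure (distr \<mu> borel \<pi>) (cylinder J))
      (\<lambda>J. exp (- real (length J) * P / (a + b)) * fiber_sum p a \<phi> J powr (a / (a + b)))"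
  proof (rule comparable_on_ln)
    fix J :: "'d list" assume "J \<in> {J. J \<noteq> []}"
    then have J: "J \<noteq> []" by simp
    let ?r = "exp (- real (length J) * P / (a + b)) * fiber_sum p a \<phi> J powr (a / (a + b))"
    have r: "?r = exp (- real (length J) * Q) * ?v J powr (a / (a + b))"
      unfolding Q using J by (simp add: v_eq)
    show "measure (distr \<mu> borel \<pi>) (cylinder J) > 0" by (simp add: \<nu> Fpos)
    show "?r > 0" unfolding r using vpos[of J] by simp
    have "ln ?r = a / (a + b) * ln (?v J) - real (length J) * Q"
      unfolding r using vpos[of J] by (simp add: ln_mult ln_powr)
    then show "\<bar>ln (measure (distr \<mu> borel \<pi>) (cylinder J)) - ln ?r\<bar> \<le> ln C"
      using ln_F[of J] by (simp only: \<nu>)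
  qed
  moreover have "comparable_on {I. I \<noteq> []}
      (\<lambda>I. measure \<mu> (cylinder I) powr a * measure (distr \<mu> borel \<pi>) (cylinder (map p I)) powr b)
      (\<lambda>I. word_sup \<phi> I * exp (- real (length I) * P))"
  proof (rule comparable_on_ln)
    fix I :: "'a list" assume "I \<in> {I. I \<noteq> []}"
    then have I: "I \<noteq> []" by simp
    show "measure \<mu> (cylinder I) powr a * measure (distr \<mu> borel \<pi>) (cylinder (map p I)) powr b > 0"
      using fpos[of I] Fpos[of "map p I"] by (simp add: \<mu> \<nu>)
    show "word_sup \<phi> I * exp (- real (length I) * P) > 0" using wpos[OF I] by simp
    have "ln (word_sup \<phi> I * exp (- real (length I) * P)) = ln (word_sup \<phi> I) - real (length I) * P"
      using wpos[OF I] by (simp add: ln_mult)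
    moreover have "ln (f I powr a * ?F (map p I) powr b) = a * ln (f I) + b * ln (?F (map p I))"
      using fpos[of I] Fpos[of "map p I"] by (simp add: ln_mult ln_powr)
    ultimately show "\<bar>ln (measure \<mu> (cylinder I) powr a * measure (distr \<mu> borel \<pi>) (cylinder (map p I)) powr b)
        - ln (word_sup \<phi> I * exp (- real (length I) * P))\<bar> \<le> (a + b) * ln C"
      using gibbs[OF I] unfolding \<mu> \<nu> by linarith
  qed
  ultimately show ?thesis
    using quasi pressure unfolding state_iff by auto
qed

end
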